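(* Let $0<p,q,r\le\infty$, $\beta\in\mathbb{R}$ and $0<c<1$. Then, for $f\in\mathrm T^{p,q,r}_\beta$, $$\|f\|_{\mathrm T^{p,q,r}_\beta}\simeq\|m^{q,r}_{\beta,c}(f)\|_{L^p(\mathbb{R}^d)}$$ with implicit constants depending only on $d,p,q,r,\beta,c$.
   Context: The symbol ⨍ denotes the mean-value integral and $B(x,t)$ the open ball in $\mathbb{R}^d$; $\mathbb{R}^{d+1}_+=(0,\infty)\times\mathbb{R}^d$. $\square_k=\{2^kx+[0,2^k)^d:x\in\mathbb{Z}^d\}$, $\square=\bigcup_{k\in\mathbb{Z}}\square_k$ is the family of all dyadic cubes; $\ell(Q)$ is the side length of $Q$; $\bar Q=(\frac{\ell(Q)}{2},\ell(Q)]\times Q$ is the Whitney box of $Q$ (not the closure). For measurable $f$ on $\mathbb{R}^{d+1}_+$, $P\in\square$ and $0<c<1$ define $$G^{q,r}_{\beta,P}(f)(x)=\Big(\sum_{Q\subset P}\mathbf 1_Q(x)|Q|^{-\frac{\beta q}{d}}\|f\|^q_{L^r(\bar Q,\frac{\mathrm{d}y\,\mathrm{d}s}{s^{d+1}})}\Big)^{1/q}$$ (sum over dyadic $Q\subset P$; supremum if $q=\infty$), $$m^{q,r}_{\beta,P,c}(f)=\inf\{t:\ |\{x\in P:G^{q,r}_{\beta,P}(f)(x)>t\}|<c|P|\},\qquad m^{q,r}_{\beta,c}(f)(x)=\sup_{P\in\square}m^{q,r}_{\beta,P,c}(f)\mathbf 1_P(x).$$ For $0<r\le\infty$ write $W_{r,\beta}f(t,x)=\big(⨍_{t/2}^t⨍_{B(x,t)}|s^{-\beta}f(s,y)|^r\,\mathrm{d}y\,\mathrm{d}s\big)^{1/r}$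 (essential supremum over $(\frac t2,t]\times B(x,t)$ if $r=\infty$). The tent space $\mathrm T^{p,q,r}_\beta$ is the set of measurable $f$ with finite (quasi-)norm, where $$\|f\|_{\mathrm T^{p,q,r}_\beta}=\Big\|\Big(\int_0^\infty (W_{r,\beta}f(t,\cdot))^q\frac{\mathrm{d}t}{t}\Big)^{1/q}\Big\|_{L^p(\mathbb{R}^d)}\quad(p<\infty),$$ with $\operatorname{ess\,sup}_{t>0}$ in place of the $t$-integral if $q=\infty$; $$\|f\|_{\mathrm T^{\infty,q,r}_\beta}=\sup_{\tau>0}\sup_{y\in\mathbb{R}^d}\Big(\int_0^\tau⨍_{B(y,\tau)}(W_{r,\beta}f(t,x))^q\frac{\mathrm{d}x\,\mathrm{d}t}{t}\Big)^{1/q}\quad(q<\infty),\qquad \|f\|_{\mathrm T^{\infty,\infty,r}_\beta}=\sup_{t>0}\sup_{x\in\mathbb{R}^d}W_{r,\beta}f(t,x).$$ *)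

theory Defs
  imports "HOL-Analysis.Analysis" "HOL-Probability.Essential_Supremum"
begin

text \<open>All norms are \<^typ>\<open>ennreal\<close>-valued, so that they are defined for every measurable
  function. The exponents \<open>p\<close>, \<open>q\<close>, \<open>r\<close> are \<^typ>\<open>ennreal\<close> as well; a finite exponent is turned
  into a real number by \<^const>\<open>enn2real\<close>. A point of the upper half-space
  \<open>(0,\<infinity>) \<times> \<real>\<^sup>d\<close> is a pair \<open>(s, y)\<close>, and \<open>d = CARD('d)\<close>.\<close>

text \<open>Only used with \<open>a > 0\<close>; then \<open>0\<^sup>a = 0\<close> and \<open>\<infinity>\<^sup>a = \<infinity>\<close>.\<close>
definition epowr :: "ennreal \<Rightarrow> real \<Rightarrow> ennreal" where
  "epowr x a = (if x = \<infinity> then \<infinity> else ennreal (enn2real x powr a))"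

definition Lp_norm :: "'a measure \<Rightarrow> ennreal \<Rightarrow> ('a \<Rightarrow> ennreal) \<Rightarrow> ennreal" where
  "Lp_norm M p g =
     (if p = \<infinity> then esssup M g
      else epowr (\<integral>\<^sup>+x. epowr (g x) (enn2real p) \<partial>M) (1 / enn2real p))"

definition mean_integral :: "'a::euclidean_space set \<Rightarrow> ('a \<Rightarrow> ennreal) \<Rightarrow> ennreal" where
  "mean_integral A g = (\<integral>\<^sup>+x\<in>A. g x \<partial>lebesgue) / emeasure lebesgue A"

definition dyadic_cubes_gen :: "int \<Rightarrow> (real ^ 'd) set set" where
  "dyadic_cubes_gen k =
     {(\<lambda>y. (2 powi k) *\<^sub>R x + y) ` {y. \<forall>i. 0 \<le> y $ i \<and> y $ i < 2 powi k} | x. \<forall>i. x $ i \<in> \<int>}"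

definition dyadic_cubes :: "(real ^ 'd) set set" where
  "dyadic_cubes = (\<Union>k. dyadic_cubes_gen k)"

definition side_length :: "(real ^ 'd) set \<Rightarrow> real" where
  "side_length Q = (THE l. \<exists>k. l = 2 powi k \<and> Q \<in> dyadic_cubes_gen k)"

definition whitney_box :: "(real ^ 'd) set \<Rightarrow> (real \<times> (real ^ 'd)) set" where
  "whitney_box Q = {side_length Q / 2<..side_length Q} \<times> Q"

definition whitney_norm :: "ennreal \<Rightarrow> (real \<times> (real ^ 'd) \<Rightarrow> complex) \<Rightarrow> (real ^ 'd) set \<Rightarrow> ennreal" where
  "whitney_norm r f Q =
     Lp_norm (density (lebesgue_on (whitney_box Q)) (\<lambda>(s, y). ennreal (1 / s ^ (CARD('d) + 1)))) r
       (\<lambda>z. ennreal (norm (f z)))"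

definition G_fun :: "ennreal \<Rightarrow> ennreal \<Rightarrow> real \<Rightarrow> (real ^ 'd) set \<Rightarrow>
    (real \<times> (real ^ 'd) \<Rightarrow> complex) \<Rightarrow> real ^ 'd \<Rightarrow> ennreal" where
  "G_fun q r \<beta> P f x =
     (if q = \<infinity> then
        (SUP Q\<in>{Q \<in> dyadic_cubes. Q \<subseteq> P}.
          indicator Q x * ennreal (measure lebesgue Q powr (- \<beta> / CARD('d))) * whitney_norm r f Q)
      else
        epowr (\<Sum>\<^sub>\<infinity>Q\<in>{Q \<in> dyadic_cubes. Q \<subseteq> P}.
          indicator Q x * ennreal (measure lebesgue Q powr (- \<beta> * enn2real q / CARD('d)))
            * epowr (whitney_norm r f Q) (enn2real q)) (1 / enn2real q))"

definition m_cube :: "ennreal \<Rightarrow> ennreal \<Rightarrow> real \<Rightarrow> (real ^ 'd) set \<Rightarrow> real \<Rightarrow>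
    (real \<times> (real ^ 'd) \<Rightarrow> complex) \<Rightarrow> ennreal" where
  "m_cube q r \<beta> P c f =
     Inf {t. emeasure lebesgue {x \<in> P. G_fun q r \<beta> P f x > t} < ennreal c * emeasure lebesgue P}"

definition m_fun :: "ennreal \<Rightarrow> ennreal \<Rightarrow> real \<Rightarrow> real \<Rightarrow>
    (real \<times> (real ^ 'd) \<Rightarrow> complex) \<Rightarrow> real ^ 'd \<Rightarrow> ennreal" where
  "m_fun q r \<beta> c f x = (SUP P\<in>dyadic_cubes. m_cube q r \<beta> P c f * indicator P x)"

definition W_fun :: "ennreal \<Rightarrow> real \<Rightarrow> (real \<times> (real ^ 'd) \<Rightarrow> complex) \<Rightarrow> real \<Rightarrow> real ^ 'd \<Rightarrow> ennreal" where
  "W_fun r \<beta> f t x =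
     (if r = \<infinity> then
        esssup (lebesgue_on ({t/2<..t} \<times> ball x t)) (\<lambda>(s, y). ennreal (norm (s powr (- \<beta>) *\<^sub>R f (s, y))))
      else
        epowr (mean_integral {t/2<..t} (\<lambda>s. mean_integral (ball x t)
          (\<lambda>y. ennreal (norm (s powr (- \<beta>) *\<^sub>R f (s, y)) powr enn2real r)))) (1 / enn2real r))"

text \<open>For \<open>p = q = \<infinity>\<close> the suprema are genuine ones, for \<open>q = \<infinity> > p\<close> the supremum in \<open>t\<close> is essential.\<close>
definition tent_norm :: "ennreal \<Rightarrow> ennreal \<Rightarrow> ennreal \<Rightarrow> real \<Rightarrow>
    (real \<times> (real ^ 'd) \<Rightarrow> complex) \<Rightarrow> ennreal" where
  "tent_norm p q r \<beta> f =
     (if p \<noteq> \<infinity> then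
        Lp_norm lebesgue p (\<lambda>x.
          if q = \<infinity> then esssup (lebesgue_on {0<..}) (\<lambda>t. W_fun r \<beta> f t x)
          else epowr (\<integral>\<^sup>+t\<in>{0<..}. epowr (W_fun r \<beta> f t x) (enn2real q) * ennreal (1 / t) \<partial>lebesgue)
                 (1 / enn2real q))
      else if q \<noteq> \<infinity> then
        (SUP \<tau>\<in>{0<..}. SUP y.
          epowr (\<integral>\<^sup>+t\<in>{0<..<\<tau>}. mean_integral (ball y \<tau>) (\<lambda>x. epowr (W_fun r \<beta> f t x) (enn2real q))
                   * ennreal (1 / t) \<partial>lebesgue) (1 / enn2real q))
      else (SUP t\<in>{0<..}. SUP x. W_fun r \<beta> f t x))"

definition tent_space :: "ennreal \<Rightarrow> ennreal \<Rightarrow> ennreal \<Rightarrow> real \<Rightarrow>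
    (real \<times> (real ^ 'd) \<Rightarrow> complex) set" where
  "tent_space p q r \<beta> =
     {f. f \<in> borel_measurable (lebesgue_on ({0<..} \<times> UNIV)) \<and> tent_norm p q r \<beta> f < \<infinity>}"

end

theory Submission
  imports Defs
begin

text \<open>For \<open>q = \<infinity>\<close> the sums below are suprema and everything is easier, so let \<open>q < \<infinity>\<close>. With
  \<open>a\<^sub>Q = |Q|\<^bsup>-\<beta>/d\<^esup> \<parallel>f\<parallel>\<^bsub>L\<^sup>r\<^esub>\<close> on the Whitney box of \<open>Q\<close>, a covering argument
  bounds \<open>W f(t, x)\<close> by some \<open>a\<^sub>Q\<close> with \<open>\<ell>(Q) \<approx> t\<close> and \<open>x \<in> 5Q\<close>; conversely, by the pigeonhole
  principle, each \<open>a\<^sub>Q\<close> is bounded by \<open>W f\<close> on \<open>T \<times> E\<close>, where \<open>T\<close> is a subinterval of the times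
  comparable to \<open>\<ell>(Q)\<close> and \<open>E \<subseteq> Q\<close> is a subcube of comparable size. Hence the tent norm
  lies between the norms of \<open>(\<Sum> 1\<^sub>E a\<^sub>Q\<^sup>q)\<^bsup>1/q\<^esup>\<close> and \<open>(\<Sum> 1\<^bsub>5Q\<^esub> a\<^sub>Q\<^sup>q)\<^bsup>1/q\<^esup>\<close>. On the other side,
  \<open>m(f)\<close> dominates the same sum over the sets \<open>{x \<in> Q. G\<^sub>Q(x) \<le> m\<^sub>Q}\<close>, each of which fills at
  least the fraction \<open>1 - c\<close> of \<open>Q\<close>, while Chebyshev's inequality bounds \<open>m(f)\<close> by \<open>G\<close>.

  All these sums are comparable. For \<open>p < \<infinity>\<close> this is the good-\<open>\<lambda>\<close> inequality
  \<open>|{S > 2\<lambda>}| \<le> \<kappa> |{S > \<lambda>}| + K |{H > \<gamma>\<lambda>}|\<close> for \<open>S = \<Sum> 1\<^bsub>5Q\<^esub> b\<^sub>Q\<close> and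
  \<open>H = \<Sum> 1\<^bsub>E(Q)\<^esub> b\<^sub>Q\<close> with \<open>|E(Q)| \<ge> \<delta> |Q|\<close>, where \<open>\<kappa>\<close> is as small as desired; it replaces the
  vector-valued maximal inequality. For \<open>p = \<infinity>\<close> it suffices to integrate over one cube.\<close>

section \<open>Powers of extended nonnegative reals and the layer cake formula\<close>


text \<open>With \<open>b = a^q\<close> the \<open>L^p\<close> norm of a \<open>q\<close>-sum is a
  power integral with exponent \<open>s = p / q\<close>, which may lie below 1, where duality and
  Minkowski's inequality fail; the good-lambda inequality serves all exponents at once. Its
  absorption step needs an a priori finite left side, so it is run on finitely many finite
  coefficients and extended by monotone convergence. Stopping at a scale works because the part of
  the sum over scales at least \<open>k\<close> is constant on cubes of scale \<open>k\<close>. The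
  sets \<open>E\<close> and \<open>T\<close> are forced by geometry: a ball of radius
  \<open>t\<close> around a point of a cube of side \<open>t\<close> need not contain the cube, and
  the times \<open>(t / 2, t]\<close> of a tent region cover those of the Whitney box only for
  \<open>t = \<ell>(Q)\<close>. So the box is cut into pieces that are seen from many
  \<open>(t, x)\<close>, and the piece with the largest mean is kept. Which piece this is depends on
  \<open>f\<close>; hence every estimate has to be uniform in \<open>E\<close> for given
  \<open>\<delta>\<close>. \<open>f\<close> is only Lebesgue measurable, so its means are compared
  through a Borel function that agrees with the weighted modulus of \<open>f\<close> almost
  everywhere.\<close>

lemma epowr_0 [simp]: "epowr 0 a = 0"
  by (simp add: epowr_def)

lemma epowr_top [simp]: "epowr top a = top"
  by (simp add: epowr_def infinity_ennreal_def)

lemma epowr_ennreal: "0 \<le> x \<Longrightarrow> epowr (ennreal x) a = ennreal (x powr a)"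
  by (simp add: epowr_def)

lemma epowr_1 [simp]: "epowr x 1 = x"
  by (cases x) (simp_all add: epowr_ennreal)

lemma epowr_epowr: "epowr (epowr x a) b = epowr x (a * b)"
  by (cases x) (simp_all add: epowr_ennreal powr_powr)

lemma epowr_inverse [simp]: "0 < a \<Longrightarrow> epowr (epowr x a) (1 / a) = x"
  "0 < a \<Longrightarrow> epowr (epowr x (1 / a)) a = x"
  by (simp_all add: epowr_epowr)

lemma epowr_eq_0_iff [simp]: "epowr x a = 0 \<longleftrightarrow> x = 0"
  by (cases x) (simp_all add: epowr_ennreal ennreal_eq_0_iff)

lemma epowr_eq_top_iff [simp]: "epowr x a = top \<longleftrightarrow> x = top"
  by (cases x) (simp_all add: epowr_ennreal)

lemma epowr_mult: "epowr (x * y) a = epowr x a * epowr y a"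
proof (cases x)
  case (real u)
  then show ?thesis
    by (cases y) (simp_all add: ennreal_mult_top epowr_ennreal powr_mult ennreal_mult[symmetric])
next
  case top
  then show ?thesis by (simp add: ennreal_top_mult)
qed

lemma epowr_mono: "0 \<le> a \<Longrightarrow> x \<le> y \<Longrightarrow> epowr x a \<le> epowr y a"
  by (cases x; cases y) (auto simp: epowr_ennreal top_unique intro: powr_mono2)

lemma epowr_le_iff: "0 < a \<Longrightarrow> epowr x a \<le> epowr y a \<longleftrightarrow> x \<le> y"
  using epowr_mono[of a x y] epowr_mono[of "1 / a" "epowr x a" "epowr y a"] by auto

lemma epowr_less_iff: "0 < a \<Longrightarrow> epowr x a < epowr y a \<longleftrightarrow> x < y"
  by (simp add: epowr_le_iff flip: not_le)

lemma measurable_epowr [measurable]: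
  assumes [measurable]: "f \<in> borel_measurable M"
  shows "(\<lambda>x. epowr (f x) a) \<in> borel_measurable M"
  unfolding epowr_def by measurable

text \<open>For \<open>a > 0\<close> the map is an order isomorphism of \<open>ennreal\<close> whose
  inverse has exponent \<open>1 / a\<close>, so it commutes with arbitrary suprema.\<close>

lemma epowr_SUP:
  assumes a: "0 < a"
  shows "epowr (SUP i\<in>I. f i) a = (SUP i\<in>I. epowr (f i) a)"
proof (rule antisym)
  have "(SUP i\<in>I. f i) \<le> epowr (SUP i\<in>I. epowr (f i) a) (1 / a)"
  proof (rule SUP_least)
    fix i assume "i \<in> I"
    then have "epowr (f i) a \<le> (SUP i\<in>I. epowr (f i) a)"
      by (rule SUP_upper)
    from epowr_mono[OF _ this, of "1/a"] a show "f i \<le> epowr (SUP i\<in>I. epowr (f i) a) (1 / a)"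
      by simp
  qed
  from epowr_mono[OF _ this, of a] a
  show "epowr (SUP i\<in>I. f i) a \<le> (SUP i\<in>I. epowr (f i) a)" by simp
  show "(SUP i\<in>I. epowr (f i) a) \<le> epowr (SUP i\<in>I. f i) a"
    using a by (intro SUP_least epowr_mono SUP_upper) auto
qed

lemma layer_cake_pointwise:
  assumes s: "0 < s"
  shows "epowr u s = (\<integral>\<^sup>+l. ennreal (s * l powr (s - 1)) * indicator {l. 0 < l \<and> ennreal l < u} l \<partial>lborel)"
proof -
  have fin: "(\<integral>\<^sup>+l. ennreal (s * l powr (s - 1)) * indicator {l. 0 < l \<and> l < v} l \<partial>lborel) = ennreal (v powr s)"
    if "0 \<le> v" for v :: real
  proof -
    have "((\<lambda>l. s * l powr (s - 1)) has_integral s * (v powr (s - 1 + 1) / (s - 1 + 1))) {0..v}"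
      using s that by (intro has_integral_mult_right has_integral_powr_from_0) auto
    then have 1: "((\<lambda>l. s * l powr (s - 1)) has_integral v powr s) {0..v}"
      using s by simp
    have "(\<integral>\<^sup>+l. ennreal (s * l powr (s - 1)) * indicator {l. 0 < l \<and> l < v} l \<partial>lborel)
       = (\<integral>\<^sup>+l. ennreal (indicator {0..v} l * (s * l powr (s - 1))) \<partial>lborel)"
    proof (rule nn_integral_cong_AE)
      have "AE l in lborel. l \<noteq> 0" "AE l in lborel. l \<noteq> v"
        by (rule AE_lborel_singleton)+
      then show "AE l in lborel. ennreal (s * l powr (s - 1)) * indicator {l. 0 < l \<and> l < v} l
          = ennreal (indicator {0..v} l * (s * l powr (s - 1)))"
        by eventually_elim (auto simp: indicator_def)
    qed
    also have "\<dots> = ennreal (v powr s)"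
    proof (rule nn_integral_has_integral_lborel)
      show "(\<lambda>x. indicator {0..v} x * (s * x powr (s - 1))) \<in> borel_measurable borel" by measurable
      show "0 \<le> indicator {0..v} x * (s * x powr (s - 1))" for x :: real using s by simp
      have "(\<lambda>l. indicator {0..v} l * (s * l powr (s - 1))) = (\<lambda>l. if l \<in> {0..v} then s * l powr (s - 1) else 0)"
        by (auto simp: indicator_def)
      with 1 show "((\<lambda>l. indicator {0..v} l * (s * l powr (s - 1))) has_integral v powr s) UNIV"
        by (simp only: has_integral_restrict_UNIV)
    qed
    finally show ?thesis .
  qed
  show ?thesis
  proof (cases u)
    case (real v)
    then have "{l. 0 < l \<and> ennreal l < u} = {l. 0 < l \<and> l < v}"
      by (auto simp: ennreal_less_iff)
    with fin[of v] real show ?thesis by (simp add: epowr_ennreal)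
  next
    \<comment> \<open>An infinite \<open>u\<close> dominates every finite level, so the integral is
      at least \<open>v powr s\<close> for all \<open>v\<close> and cannot be a real number.\<close>
    case top
    let ?I = "\<integral>\<^sup>+l. ennreal (s * l powr (s - 1)) * indicator {l. 0 < l \<and> ennreal l < u} l \<partial>lborel"
    have *: "ennreal (v powr s) \<le> ?I" if "0 \<le> v" for v
      unfolding fin[OF that, symmetric] using top
      by (intro nn_integral_mono) (auto simp: indicator_def)
    have "ennreal z \<le> ?I" if "0 \<le> z" for z
      using *[of "z powr (1/s)"] s that by (simp add: powr_powr)
    then have le: "\<And>z. 0 \<le> z \<Longrightarrow> ennreal z \<le> ?I" .
    have "?I = top"
    proof (rule ccontr)
      assume "?I \<noteq> top"
      then obtain y where y: "0 \<le> y" "?I = ennreal y" by (cases ?I) auto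
      with le[of "y + 1"] show False by simp
    qed
    then show ?thesis using top by simp
  qed
qed

section \<open>Distribution functions\<close>

lemma sets_subgraph:
  fixes X :: "'a::euclidean_space \<Rightarrow> ennreal"
  assumes [measurable]: "X \<in> borel_measurable borel"
  shows "{z::real \<times> 'a. ennreal (fst z) < X (snd z)} \<in> sets (borel \<Otimes>\<^sub>M borel)"
proof -
  have "Measurable.pred (borel \<Otimes>\<^sub>M borel) (\<lambda>z::real \<times> 'a. ennreal (fst z) < X (snd z))"
    by measurable
  then show ?thesis by (simp add: pred_def space_pair_measure)
qed

lemma measurable_distribution_function [measurable]:
  fixes X :: "'a::euclidean_space \<Rightarrow> ennreal"
  assumes "X \<in> borel_measurable borel"
  shows "(\<lambda>l. emeasure lborel {x. ennreal l < X x}) \<in> borel_measurable borel"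
proof -
  let ?Q = "{z::real \<times> 'a. ennreal (fst z) < X (snd z)}"
  have "sets (borel \<Otimes>\<^sub>M lborel) = sets (borel \<Otimes>\<^sub>M borel :: (real \<times> 'a) measure)"
    by (rule sets_pair_measure_cong) simp_all
  with sets_subgraph[OF assms] have "?Q \<in> sets (borel \<Otimes>\<^sub>M lborel)" by blast
  from lborel.measurable_emeasure_Pair[OF this]
  have "(\<lambda>l. emeasure lborel (Pair l -` ?Q)) \<in> borel_measurable borel" .
  moreover have "Pair l -` ?Q = {x. ennreal l < X x}" for l by auto
  ultimately show ?thesis by simp
qed

text \<open>Tonelli on the subgraph of \<open>X\<close>, whose Borel measurability permits the
  exchange of the integrals.\<close>

lemma layer_cake:
  fixes X :: "'a::euclidean_space \<Rightarrow> ennreal"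
  assumes s: "0 < s" and X[measurable]: "X \<in> borel_measurable borel"
  shows "(\<integral>\<^sup>+x. epowr (X x) s \<partial>lborel) =
    (\<integral>\<^sup>+l. ennreal (s * l powr (s - 1)) * (indicator {0<..} l * emeasure lborel {x. ennreal l < X x}) \<partial>lborel)"
proof -
  have [measurable]: "{z::real \<times> 'a. ennreal (fst z) < X (snd z)} \<in> sets (borel \<Otimes>\<^sub>M borel)"
    by (rule sets_subgraph[OF X])
  have "(\<integral>\<^sup>+x. epowr (X x) s \<partial>lborel) =
      (\<integral>\<^sup>+x. (\<integral>\<^sup>+l. ennreal (s * l powr (s - 1)) * indicator {0<..} l * indicator {z. ennreal (fst z) < X (snd z)} (l, x) \<partial>lborel) \<partial>lborel)"
    unfolding layer_cake_pointwise[OF s] by (intro nn_integral_cong) (auto simp: indicator_def)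
  also have "\<dots> = (\<integral>\<^sup>+l. (\<integral>\<^sup>+x. ennreal (s * l powr (s - 1)) * indicator {0<..} l * indicator {z. ennreal (fst z) < X (snd z)} (l, x) \<partial>lborel) \<partial>lborel)"
    by (rule lborel_pair.Fubini') measurable
  also have "\<dots> = (\<integral>\<^sup>+l. ennreal (s * l powr (s - 1)) * (indicator {0<..} l * emeasure lborel {x. ennreal l < X x}) \<partial>lborel)"
  proof (rule nn_integral_cong)
    fix l :: real
    have [measurable]: "{x. ennreal l < X x} \<in> sets borel" by measurable
    have "(\<integral>\<^sup>+x. ennreal (s * l powr (s - 1)) * indicator {0<..} l * indicator {z. ennreal (fst z) < X (snd z)} (l, x) \<partial>lborel)
      = (\<integral>\<^sup>+x. ennreal (s * l powr (s - 1)) * indicator {0<..} l * indicator {x. ennreal l < X x} x \<partial>lborel)"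
      by (intro nn_integral_cong) (auto simp: indicator_def)
    also have "\<dots> = ennreal (s * l powr (s - 1)) * indicator {0<..} l * emeasure lborel {x. ennreal l < X x}"
      by (subst nn_integral_cmult_indicator) auto
    finally show "(\<integral>\<^sup>+x. ennreal (s * l powr (s - 1)) * indicator {0<..} l * indicator {z. ennreal (fst z) < X (snd z)} (l, x) \<partial>lborel)
      = ennreal (s * l powr (s - 1)) * (indicator {0<..} l * emeasure lborel {x. ennreal l < X x})"
      by (simp add: mult.assoc)
  qed
  finally show ?thesis .
qed

text \<open>Integration against \<open>s * l powr (s - 1)\<close> keeps the form of the inequality.
  With two terms on the right it serves weak-type bounds as well as the good-lambda inequality,
  whose first right-hand term is the left side at a lower level.\<close>

lemma distribution_imp_power_integral_le:
  fixes X Y Z :: "'a::euclidean_space \<Rightarrow> ennreal"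
  assumes s: "0 < s"
    and [measurable]: "X \<in> borel_measurable borel" "Y \<in> borel_measurable borel" "Z \<in> borel_measurable borel"
    and le: "\<And>l. 0 < l \<Longrightarrow> emeasure lborel {x. ennreal l < X x} \<le>
       A * emeasure lborel {x. ennreal l < Y x} + B * emeasure lborel {x. ennreal l < Z x}"
  shows "(\<integral>\<^sup>+x. epowr (X x) s \<partial>lborel) \<le>
    A * (\<integral>\<^sup>+x. epowr (Y x) s \<partial>lborel) + B * (\<integral>\<^sup>+x. epowr (Z x) s \<partial>lborel)"
proof -
  let ?d = "\<lambda>X l. ennreal (s * l powr (s - 1)) * (indicator {0<..} l * emeasure lborel {x. ennreal l < X x})"
  have "(\<integral>\<^sup>+x. epowr (X x) s \<partial>lborel) = (\<integral>\<^sup>+l. ?d X l \<partial>lborel)"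
    by (rule layer_cake[OF s]) measurable
  also have "\<dots> \<le> (\<integral>\<^sup>+l. A * ?d Y l + B * ?d Z l \<partial>lborel)"
  proof (rule nn_integral_mono)
    fix l :: real
    show "?d X l \<le> A * ?d Y l + B * ?d Z l"
    proof (cases "0 < l")
      case True
      from mult_left_mono[OF le[OF True], of "ennreal (s * l powr (s - 1))"] True show ?thesis
        by (simp add: algebra_simps)
    qed auto
  qed
  also have "\<dots> = A * (\<integral>\<^sup>+l. ?d Y l \<partial>lborel) + B * (\<integral>\<^sup>+l. ?d Z l \<partial>lborel)"
    by (subst nn_integral_add) (auto simp: nn_integral_cmult)
  finally show ?thesis by (simp add: layer_cake[OF s])
qed

lemma weak_type_imp_power_integral_le:
  fixes X Y :: "'a::euclidean_space \<Rightarrow> ennreal"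
  assumes "0 < s" "X \<in> borel_measurable borel" "Y \<in> borel_measurable borel"
    and "\<And>l. 0 < l \<Longrightarrow> emeasure lborel {x. ennreal l < X x} \<le> K * emeasure lborel {x. ennreal l < Y x}"
  shows "(\<integral>\<^sup>+x. epowr (X x) s \<partial>lborel) \<le> K * (\<integral>\<^sup>+x. epowr (Y x) s \<partial>lborel)"
  using distribution_imp_power_integral_le[OF assms(1-3,3), of K 0] assms(4) by simp

lemma less_ennreal_scale:
  assumes "0 < c" "0 < l"
  shows "ennreal (c * l) < u \<longleftrightarrow> ennreal l < ennreal (1 / c) * u"
proof (cases u)
  case (real r)
  then show ?thesis using assms by (auto simp: ennreal_less_iff field_simps simp flip: ennreal_mult)
qed (use assms in \<open>simp add: ennreal_mult_top\<close>)

lemma power_integral_scale: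
  assumes "0 < c" "X \<in> borel_measurable M"
  shows "(\<integral>\<^sup>+x. epowr (ennreal (1 / c) * X x) s \<partial>M) = ennreal (c powr (-s)) * (\<integral>\<^sup>+x. epowr (X x) s \<partial>M)"
  using assms by (simp only: epowr_mult) (simp add: epowr_ennreal powr_divide powr_minus_divide nn_integral_cmult)

text \<open>Rescaling brings all superlevel sets to a common level; integration then gives
  \<open>2 powr (-s) * I X \<le> \<kappa> * I X + ...\<close>. As
  \<open>\<kappa> * 2 powr s \<le> 1 / 2\<close>, half of \<open>I X\<close> is absorbed on the
  left, which is legitimate because \<open>fin\<close> makes it finite.\<close>

lemma good_lambda_imp_power_integral_le:
  fixes X Y :: "'a::euclidean_space \<Rightarrow> ennreal"
  assumes s: "0 < s" and \<gamma>: "0 < \<gamma>" and \<kappa>: "0 \<le> \<kappa>" "\<kappa> * 2 powr s \<le> 1 / 2" and K: "0 \<le> K"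
    and X[measurable]: "X \<in> borel_measurable borel" and Y[measurable]: "Y \<in> borel_measurable borel"
    and fin: "(\<integral>\<^sup>+x. epowr (X x) s \<partial>lborel) < \<infinity>"
    and good: "\<And>l. 0 < l \<Longrightarrow> emeasure lborel {x. ennreal (2 * l) < X x} \<le>
       ennreal \<kappa> * emeasure lborel {x. ennreal l < X x} + ennreal K * emeasure lborel {x. ennreal (\<gamma> * l) < Y x}"
  shows "(\<integral>\<^sup>+x. epowr (X x) s \<partial>lborel) \<le> ennreal (2 * K * 2 powr s * \<gamma> powr (-s)) * (\<integral>\<^sup>+x. epowr (Y x) s \<partial>lborel)"
proof -
  let ?I = "\<lambda>Z. \<integral>\<^sup>+x. epowr (Z x) s \<partial>lborel"
  have "?I (\<lambda>x. ennreal (1 / 2) * X x) \<le> ennreal \<kappa> * ?I X + ennreal K * ?I (\<lambda>x. ennreal (1 / \<gamma>) * Y x)"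
  proof (rule distribution_imp_power_integral_le[OF s])
    show "emeasure lborel {x. ennreal l < ennreal (1 / 2) * X x} \<le> ennreal \<kappa> * emeasure lborel {x. ennreal l < X x}
        + ennreal K * emeasure lborel {x. ennreal l < ennreal (1 / \<gamma>) * Y x}" if l: "0 < l" for l
      using good[OF l] unfolding less_ennreal_scale[OF \<gamma> l] less_ennreal_scale[OF zero_less_numeral l] .
  qed measurable
  then have main: "ennreal (2 powr (-s)) * ?I X \<le> ennreal \<kappa> * ?I X + ennreal K * ennreal (\<gamma> powr (-s)) * ?I Y"
    using power_integral_scale[of 2 X lborel s] power_integral_scale[of \<gamma> Y lborel s] \<gamma> X Y
    by (simp only: mult.assoc) simp
  show ?thesis
  proof (cases "?I Y")
    case top
    show ?thesis
    \<comment> \<open>With \<open>0 * top = 0\<close> the right side vanishes for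
      \<open>K = 0\<close> even if \<open>Y\<close> has infinite integral; then absorption alone
      forces the left side to be 0.\<close>
    proof (cases "K = 0")
      case True
      from fin obtain i where i: "0 \<le> i" "?I X = ennreal i" by (cases "?I X") auto
      from main True i \<kappa>(1) have "2 powr (-s) * i \<le> \<kappa> * i" by (simp flip: ennreal_mult)
      moreover have "\<kappa> < 2 powr (-s)"
      proof -
        have "\<kappa> * 2 powr s < 1" using \<kappa>(2) by linarith
        then show ?thesis by (simp add: powr_minus field_simps)
      qed
      ultimately have "i = 0" using i
        by (metis mult_less_cancel_right_disj not_less order_le_less)
      then show ?thesis using i by simp
    next
      case False
      then show ?thesis using top K \<gamma> by (simp add: ennreal_mult_top)
    qed
  next
    case (real y)
    from fin obtain i where i: "0 \<le> i" "?I X = ennreal i" by (cases "?I X") auto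
    from main i real \<kappa>(1) K have 1: "2 powr (-s) * i \<le> \<kappa> * i + K * \<gamma> powr (-s) * y"
      by (simp flip: ennreal_mult ennreal_plus)
    have "2 powr s * (2 powr (-s) * i) \<le> 2 powr s * (\<kappa> * i + K * \<gamma> powr (-s) * y)"
      by (rule mult_left_mono[OF 1]) auto
    then have "i \<le> (\<kappa> * 2 powr s) * i + 2 powr s * K * \<gamma> powr (-s) * y"
      by (simp add: powr_minus algebra_simps)
    moreover have "(\<kappa> * 2 powr s) * i \<le> 1/2 * i"
      using \<kappa> i by (intro mult_right_mono) auto
    ultimately have "i \<le> 2 * K * 2 powr s * \<gamma> powr (-s) * y" by (simp add: algebra_simps)
    then show ?thesis using i real K by (simp flip: ennreal_mult)
  qed
qed

section \<open>Dyadic cubes\<close>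


text \<open>Cubes are encoded by rounding coordinates: lying in the same cube of scale
  \<open>k\<close> becomes equality of integer vectors, and nesting and adjacency become integer
  division.\<close>

definition grid_index :: "int \<Rightarrow> real ^ 'd \<Rightarrow> int ^ 'd" where
  "grid_index k x = (\<chi> i. \<lfloor>x $ i / 2 powi k\<rfloor>)"

definition cube :: "int \<Rightarrow> int ^ 'd \<Rightarrow> (real ^ 'd) set" where
  "cube k n = {x. grid_index k x = n}"

definition near :: "int ^ 'd \<Rightarrow> int ^ 'd \<Rightarrow> bool" where
  "near m n \<longleftrightarrow> (\<forall>i. \<bar>m $ i - n $ i\<bar> \<le> 2)"

text \<open>The cubes \<open>Q = cube k n\<close> are indexed by their scale \<open>2\<^sup>k\<close> and an integer vector; \<open>star k n\<close> is \<open>5Q\<close>.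
  Unlike \<open>3Q\<close>, it contains all cubes of this scale that meet a ball of radius \<open>2\<ell>(Q)\<close> around a point
  of \<open>Q\<close>.\<close>

definition star :: "int \<Rightarrow> int ^ 'd \<Rightarrow> (real ^ 'd) set" where
  "star k n = {x. near (grid_index k x) n}"

lemma near_commute: "near m n \<longleftrightarrow> near n m"
  by (simp add: near_def abs_minus_commute)

lemma near_refl [simp]: "near n n"
  by (simp add: near_def)

lemma cube_subset_star: "cube k n \<subseteq> star k n"
  by (auto simp: cube_def star_def)

text \<open>Rounding after division by a positive integer equals integer division after rounding.
  All nesting properties of the grids come from this formula.\<close>

lemma grid_index_coarser:
  assumes "k \<le> l"
  shows "grid_index l x $ i = grid_index k x $ i div 2 ^ nat (l - k)"
proof -
  have "(2::real) powi l = 2 powi k * 2 powi (l - k)"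
    by (simp flip: power_int_add)
  also have "(2::real) powi (l - k) = of_int (2 ^ nat (l - k))"
    using assms by (simp add: power_int_def)
  finally have eq: "x $ i / 2 powi l = (x $ i / 2 powi k) / of_int (2 ^ nat (l - k))"
    by simp
  have "grid_index l x $ i = \<lfloor>x $ i / 2 powi l\<rfloor>"
    by (simp add: grid_index_def)
  also have "\<dots> = \<lfloor>(x $ i / 2 powi k) / of_int (2 ^ nat (l - k))\<rfloor>"
    by (simp only: eq)
  also have "\<dots> = \<lfloor>x $ i / 2 powi k\<rfloor> div 2 ^ nat (l - k)"
    by (rule floor_divide_real_eq_div) simp
  finally show ?thesis by (simp add: grid_index_def)
qed

lemma grid_index_eq_mono:
  "k \<le> l \<Longrightarrow> grid_index k x = grid_index k y \<Longrightarrow> grid_index l x = grid_index l y"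
  by (simp add: vec_eq_iff grid_index_coarser)

text \<open>A shift by 2 is at most a shift by \<open>2 * M\<close>, which moves the quotient by
  \<open>M\<close> by exactly 2. Hence neighbours stay neighbours at coarser scales, with the same
  constant.\<close>

lemma near_grid_index_mono:
  assumes "k \<le> l" "near (grid_index k x) (grid_index k y)"
  shows "near (grid_index l x) (grid_index l y)"
proof -
  have *: "a div M \<le> b div M + 2" if "a \<le> b + 2" "1 \<le> M" for a b M :: int
  proof -
    have "a div M \<le> (b + 2 * M) div M"
      using that by (intro zdiv_mono1) auto
    also have "\<dots> = b div M + 2" using that by (simp add: add.commute)
    finally show ?thesis .
  qed
  have "\<bar>grid_index l x $ i - grid_index l y $ i\<bar> \<le> 2" for i
  proof -
    have "grid_index k x $ i \<le> grid_index k y $ i + 2" "grid_index k y $ i \<le> grid_index k x $ i + 2"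
      using assms(2) by (auto simp: near_def abs_le_iff dest!: spec[of _ i])
    from this[THEN *, of "2 ^ nat (l - k)"] show ?thesis
      by (simp add: grid_index_coarser[OF assms(1)] abs_le_iff)
  qed
  then show ?thesis by (simp add: near_def)
qed

lemma cube_nested:
  "x \<in> cube k n \<Longrightarrow> x \<in> cube l m \<Longrightarrow> k \<le> l \<Longrightarrow> cube k n \<subseteq> cube l m"
  unfolding cube_def using grid_index_eq_mono by fastforce

lemma star_nested: "cube k n \<subseteq> cube l m \<Longrightarrow> k \<le> l \<Longrightarrow> cube k n \<noteq> {} \<Longrightarrow> star k n \<subseteq> star l m"
  unfolding cube_def star_def using near_grid_index_mono by fastforce

lemma cube_altdef: "cube k n = {x. \<forall>i. 2 powi k * real_of_int (n $ i) \<le> x $ i \<and> x $ i < 2 powi k * (real_of_int (n $ i) + 1)}"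
  by (auto simp: cube_def grid_index_def vec_eq_iff floor_eq_iff field_simps)

lemma cube_nonempty: "cube k n \<noteq> {}"
proof -
  have "(\<chi> i. 2 powi k * real_of_int (n $ i)) \<in> cube k n" by (simp add: cube_altdef)
  then show ?thesis by blast
qed

lemma sets_cube [measurable]:
  fixes n :: "int ^ 'd"
  shows "cube k n \<in> sets borel"
proof -
  have "Measurable.pred borel (\<lambda>x::real^'d. \<forall>i. 2 powi k * real_of_int (n $ i) \<le> x $ i \<and> x $ i < 2 powi k * (real_of_int (n $ i) + 1))"
    by measurable
  then show ?thesis by (simp add: cube_altdef pred_def)
qed

text \<open>The half-open cube is squeezed between an open and a closed box of equal volume.\<close>

lemma emeasure_cube: "emeasure lborel (cube k n :: (real ^ 'd) set) = ennreal ((2 powi k) ^ CARD('d))"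
proof -
  define l u :: "real ^ 'd" where "l = (\<chi> i. 2 powi k * real_of_int (n $ i))" and "u = (\<chi> i. 2 powi k * (real_of_int (n $ i) + 1))"
  have ul: "(u - l) \<bullet> b = 2 powi k" if "b \<in> Basis" for b
  proof -
    from that obtain i where "b = axis i 1" by (auto simp: Basis_vec_def)
    then show ?thesis by (simp add: inner_axis u_def l_def algebra_simps)
  qed
  have le: "l \<bullet> b \<le> u \<bullet> b" if "b \<in> Basis" for b
    using ul[OF that] by (simp add: inner_diff_left) (smt (verit) zero_le_power_int)
  have pr: "(\<Prod>b\<in>Basis. (u - l) \<bullet> b) = (2 powi k) ^ CARD('d)"
    by (simp add: ul)
  have "box l u \<subseteq> cube k n" "cube k n \<subseteq> cbox l u"
    by (auto simp: cube_altdef mem_box_cart l_def u_def less_imp_le)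
  then have "emeasure lborel (box l u) \<le> emeasure lborel (cube k n)"
    "emeasure lborel (cube k n) \<le> emeasure lborel (cbox l u)"
    by (auto intro!: emeasure_mono)
  moreover have "emeasure lborel (box l u) = ennreal ((2 powi k) ^ CARD('d))"
    "emeasure lborel (cbox l u) = ennreal ((2 powi k) ^ CARD('d))"
    using le by (simp_all only: emeasure_lborel_box emeasure_lborel_cbox pr)
  ultimately show ?thesis by simp
qed

lemma card_vec_set: "card {v :: 'a ^ 'd. \<forall>i. v $ i \<in> A i} = (\<Prod>i\<in>UNIV. card (A i))"
proof -
  have "bij_betw vec_nth {v :: 'a ^ 'd. \<forall>i. v $ i \<in> A i} (PiE UNIV A)"
    by (rule bij_betw_byWitness[where f' = vec_lambda]) (auto simp: PiE_def)
  then have "card {v :: 'a ^ 'd. \<forall>i. v $ i \<in> A i} = card (PiE UNIV A)"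
    by (rule bij_betw_same_card)
  then show ?thesis by (simp add: card_PiE)
qed

lemma card_near: "card {m :: int ^ 'd. near m n} = 5 ^ CARD('d)"
proof -
  have "{m :: int ^ 'd. near m n} = {m. \<forall>i. m $ i \<in> {n $ i - 2..n $ i + 2}}"
    by (auto simp: near_def abs_le_iff algebra_simps)
  then show ?thesis by (simp only: card_vec_set) simp
qed

lemma finite_near [simp]: "finite {m :: int ^ 'd. near m n}"
  by (rule card_ge_0_finite) (simp add: card_near)

lemma star_eq_UN: "star k n = (\<Union>m\<in>{m. near m n}. cube k m)"
  by (auto simp: star_def cube_def)

lemma sets_star [measurable]: "star k n \<in> sets borel"
  unfolding star_eq_UN by (intro sets.finite_UN) auto

lemma emeasure_star_le: "emeasure lborel (star k n :: (real ^ 'd) set) \<le> ennreal (5 ^ CARD('d) * (2 powi k) ^ CARD('d))"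
proof -
  have "emeasure lborel (star k n :: (real ^ 'd) set) \<le> (\<Sum>m | near m n. emeasure lborel (cube k m :: (real ^ 'd) set))"
    unfolding star_eq_UN by (intro emeasure_subadditive_finite) auto
  also have "\<dots> = ennreal (5 ^ CARD('d) * (2 powi k) ^ CARD('d))"
    by (simp add: emeasure_cube card_near ennreal_mult flip: ennreal_power)
  finally show ?thesis .
qed

lemma emeasure_UN_le_count_space:
  assumes "countable I" and [measurable]: "\<And>i. i \<in> I \<Longrightarrow> A i \<in> sets M"
  shows "emeasure M (\<Union>i\<in>I. A i) \<le> (\<integral>\<^sup>+i. emeasure M (A i) \<partial>count_space I)"
proof -
  have [measurable]: "(\<Union>i\<in>I. A i) \<in> sets M"
    using assms by (rule sets.countable_UN'')
  have "emeasure M (\<Union>i\<in>I. A i) = (\<integral>\<^sup>+x. indicator (\<Union>i\<in>I. A i) x \<partial>M)"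
    by simp
  also have "\<dots> \<le> (\<integral>\<^sup>+x. (\<integral>\<^sup>+i. indicator (A i) x \<partial>count_space I) \<partial>M)"
  proof (rule nn_integral_mono)
    fix x show "indicator (\<Union>i\<in>I. A i) x \<le> (\<integral>\<^sup>+i. indicator (A i) x \<partial>count_space I :: ennreal)"
    proof (cases "x \<in> (\<Union>i\<in>I. A i)")
      case True
      then obtain i where i: "i \<in> I" "x \<in> A i" by auto
      have "indicator (\<Union>i\<in>I. A i) x = (indicator (A i) x :: ennreal)"
        using indicator_simps(1)[OF True, where 'b = ennreal] i(2) by simp
      also have "\<dots> \<le> (\<integral>\<^sup>+i. indicator (A i) x \<partial>count_space I)"
        by (rule nn_integral_ge_point[OF i(1), where p = "\<lambda>i. indicator (A i) x"])
      finally show ?thesis .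
    qed auto
  qed
  also have "\<dots> = (\<integral>\<^sup>+i. emeasure M (A i) \<partial>count_space I)"
    using assms by (subst nn_integral_count_space_nn_integral) (auto intro!: nn_integral_cong)
  finally show ?thesis .
qed

text \<open>Plays the role of a superlevel set of the maximal function of the indicator of \<open>\<Omega>\<close>.\<close>

definition dense_nbhd :: "(real ^ 'd) set \<Rightarrow> real \<Rightarrow> (real ^ 'd) set" where
  "dense_nbhd \<Omega> \<delta> = (\<Union>(k, n)\<in>{(k, n). ennreal (\<delta> * (2 powi k) ^ CARD('d)) \<le> emeasure lborel (cube k n \<inter> \<Omega>)}. star k n)"

lemma sets_dense_nbhd [measurable]: "dense_nbhd \<Omega> \<delta> \<in> sets borel"
  unfolding dense_nbhd_def by (intro sets.countable_UN'') auto

text \<open>The dyadic weak-type estimate. The maximal cubes of density at least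
  \<open>\<delta>\<close> are pairwise disjoint, and their stars contain all the other stars; so
  \<open>|star| \<le> 5^d |Q| \<le> (5^d / \<delta>) |Q \<inter> \<Omega>|\<close> can be summed
  over them.\<close>

lemma emeasure_dense_nbhd_le:
  fixes \<Omega> :: "(real ^ 'd) set"
  assumes \<delta>: "0 < \<delta>" and [measurable]: "\<Omega> \<in> sets borel"
  shows "emeasure lborel (dense_nbhd \<Omega> \<delta>) \<le> ennreal (5 ^ CARD('d) / \<delta>) * emeasure lborel \<Omega>"
proof (cases "emeasure lborel \<Omega>")
  case top
  then show ?thesis using \<delta> by (simp add: ennreal_mult_top)
next
  case (real \<omega>)
  let ?vol = "\<lambda>k::int. ((2::real) powi k) ^ CARD('d)"
  define S :: "(int \<times> (int ^ 'd)) set" where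
    "S = {(k, n). ennreal (\<delta> * ?vol k) \<le> emeasure lborel (cube k n \<inter> \<Omega>)}"
  obtain K :: nat where K: "\<omega> / \<delta> < 2 ^ K"
    using real_arch_pow[of 2 "\<omega> / \<delta>"] by auto
  \<comment> \<open>Finite measure of \<open>\<Omega>\<close> bounds the volume of a dense cube by
    \<open>\<omega> / \<delta>\<close>, hence its scale; otherwise an increasing chain of dense
    cubes might have no largest member.\<close>
  have bound: "k \<le> int K" if "(k, n) \<in> S" for k n
  proof (rule ccontr)
    assume "\<not> k \<le> int K"
    then have k: "int K \<le> k" by simp
    from that have "ennreal (\<delta> * ?vol k) \<le> emeasure lborel \<Omega>"
      using emeasure_mono[of "cube k n \<inter> \<Omega>" \<Omega> lborel] by (auto simp: S_def intro: order_trans)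
    with real \<delta> have "\<delta> * ?vol k \<le> \<omega>" by simp
    then have "?vol k \<le> \<omega> / \<delta>" using \<delta> by (simp add: field_simps)
    moreover have "(2::real) ^ K \<le> 2 powi k"
      using power_int_increasing[OF k, of "2::real"] by simp
    moreover have "(2::real) powi k \<le> ?vol k"
    proof -
      have "1 \<le> (2::real) ^ K" by simp
      then have "1 \<le> (2::real) powi k" using calculation(2) by linarith
      then show ?thesis by (simp add: self_le_power)
    qed
    ultimately show False using K by linarith
  qed
  define M where "M = {(l, m) \<in> S. \<forall>(l', m')\<in>S. cube l m \<subseteq> cube l' m' \<longrightarrow> l' \<le> l}"
  \<comment> \<open>The dense cubes containing \<open>cube k n\<close> have a largest scale. A cube
    attaining it is maximal among all dense cubes, since whatever contains it also contains
    \<open>cube k n\<close>.\<close>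
  have max: "\<exists>(l, m)\<in>M. star k n \<subseteq> star l m" if kn: "(k, n) \<in> S" for k n
  proof -
    define A where "A = {l. k \<le> l \<and> (\<exists>m. (l, m) \<in> S \<and> cube k n \<subseteq> cube l m)}"
    have "A \<subseteq> {k..int K}" using bound by (auto simp: A_def)
    then have fin: "finite A" by (rule finite_subset) simp
    have "k \<in> A" using kn by (auto simp: A_def)
    with fin have "Max A \<in> A" by (intro Max_in) auto
    then obtain m where m: "k \<le> Max A" "(Max A, m) \<in> S" "cube k n \<subseteq> cube (Max A) m" by (auto simp: A_def)
    have "(Max A, m) \<in> M"
      unfolding M_def
    proof (clarsimp simp: m(2), rule ccontr)
      fix l' m' assume *: "(l', m') \<in> S" "cube (Max A) m \<subseteq> cube l' m'" "\<not> l' \<le> Max A"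
      with m have "l' \<in> A" by (auto simp: A_def)
      with fin * show False by (auto dest: Max_ge)
    qed
    moreover have "star k n \<subseteq> star (Max A) m"
      by (rule star_nested[OF m(3,1) cube_nonempty])
    ultimately show ?thesis by auto
  qed
  have sub: "dense_nbhd \<Omega> \<delta> \<subseteq> (\<Union>(l, m)\<in>M. star l m)"
    using max unfolding dense_nbhd_def S_def by fast
  have "cube l m \<inter> cube l' m' = {}"
    if *: "(l, m) \<in> M" "(l', m') \<in> M" "(l, m) \<noteq> (l', m')" for l m l' m'
  proof (rule ccontr)
    assume "cube l m \<inter> cube l' m' \<noteq> {}"
    then obtain x where x: "x \<in> cube l m" "x \<in> cube l' m'" by auto
    have "l = l'"
    proof (cases "l \<le> l'")
      case True
      from cube_nested[OF x True] * show ?thesis using True by (fastforce simp: M_def)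
    next
      case False
      then have "l' \<le> l" by simp
      from cube_nested[OF x(2,1) this] * show ?thesis using False by (fastforce simp: M_def)
    qed
    with * x show False by (auto simp: cube_def)
  qed
  then have disj: "disjoint_family_on (\<lambda>(l, m). cube l m \<inter> \<Omega>) M"
    unfolding disjoint_family_on_def by fastforce
  have "emeasure lborel (dense_nbhd \<Omega> \<delta>) \<le> emeasure lborel (\<Union>(l, m)\<in>M. star l m)"
    by (intro emeasure_mono sub) (auto intro!: sets.countable_UN'')
  also have "\<dots> \<le> (\<integral>\<^sup>+p. emeasure lborel (star (fst p) (snd p) :: (real ^ 'd) set) \<partial>count_space M)"
    unfolding case_prod_beta by (rule emeasure_UN_le_count_space) auto
  also have "\<dots> \<le> (\<integral>\<^sup>+p. ennreal (5 ^ CARD('d) / \<delta>) * emeasure lborel (cube (fst p) (snd p) \<inter> \<Omega>) \<partial>count_space M)"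
  proof (rule nn_integral_mono, clarsimp)
    fix l m assume "(l, m) \<in> M"
    then have *: "ennreal (\<delta> * ?vol l) \<le> emeasure lborel (cube l m \<inter> \<Omega>)" by (auto simp: M_def S_def)
    have "emeasure lborel (star l m :: (real ^ 'd) set) \<le> ennreal (5 ^ CARD('d) * ?vol l)"
      by (rule emeasure_star_le)
    also have "\<dots> = ennreal (5 ^ CARD('d) / \<delta>) * ennreal (\<delta> * ?vol l)"
      using \<delta> by (simp flip: ennreal_mult)
    also have "\<dots> \<le> ennreal (5 ^ CARD('d) / \<delta>) * emeasure lborel (cube l m \<inter> \<Omega>)"
      by (rule mult_left_mono[OF *]) simp
    finally show "emeasure lborel (star l m) \<le> ennreal (5 ^ CARD('d) / \<delta>) * emeasure lborel (cube l m \<inter> \<Omega>)" .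
  qed
  also have "\<dots> = ennreal (5 ^ CARD('d) / \<delta>) * (\<integral>\<^sup>+p. emeasure lborel (cube (fst p) (snd p) \<inter> \<Omega>) \<partial>count_space M)"
    by (rule nn_integral_cmult) simp
  also have "(\<integral>\<^sup>+p. emeasure lborel (cube (fst p) (snd p) \<inter> \<Omega>) \<partial>count_space M) = emeasure lborel (\<Union>(l, m)\<in>M. cube l m \<inter> \<Omega>)"
    using disj unfolding case_prod_beta by (intro emeasure_UN_countable[symmetric]) auto
  also have "\<dots> \<le> emeasure lborel \<Omega>"
    by (intro emeasure_mono) auto
  finally show ?thesis by (simp add: mult_left_mono)
qed

section \<open>Sums over dyadic cubes and the good-lambda inequality\<close>


text \<open>As an integral over a counting measure, the sum inherits monotone convergence, Tonelli
  and linearity for values in \<open>ennreal\<close>.\<close>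

definition dyadic_sum :: "(int \<Rightarrow> int ^ 'd \<Rightarrow> (real ^ 'd) set) \<Rightarrow> (int \<Rightarrow> int ^ 'd \<Rightarrow> ennreal) \<Rightarrow> real ^ 'd \<Rightarrow> ennreal" where
  "dyadic_sum A b x = (\<integral>\<^sup>+(k, n). indicator (A k n) x * b k n \<partial>count_space UNIV)"

definition dyadic_sup :: "(int \<Rightarrow> int ^ 'd \<Rightarrow> (real ^ 'd) set) \<Rightarrow> (int \<Rightarrow> int ^ 'd \<Rightarrow> ennreal) \<Rightarrow> real ^ 'd \<Rightarrow> ennreal" where
  "dyadic_sup A b x = (SUP (k, n). indicator (A k n) x * b k n)"

lemma borel_measurable_nn_integral_count_space:
  fixes f :: "'i::countable \<Rightarrow> 'a \<Rightarrow> ennreal"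
  assumes "\<And>i. f i \<in> borel_measurable M"
  shows "(\<lambda>x. \<integral>\<^sup>+i. f i x \<partial>count_space UNIV) \<in> borel_measurable M"
proof (rule sigma_finite_measure.borel_measurable_nn_integral)
  show "sigma_finite_measure (count_space (UNIV :: 'i set))"
    by (rule sigma_finite_measure_count_space_countable) simp
  have "(\<lambda>(i, x). f i x) \<in> borel_measurable (count_space UNIV \<Otimes>\<^sub>M M)"
    by (rule measurable_pair_measure_countable1) (use assms in auto)
  from measurable_compose[OF measurable_pair_swap' this]
  show "(\<lambda>(x, i). f i x) \<in> borel_measurable (M \<Otimes>\<^sub>M count_space UNIV)"
    by (simp add: case_prod_beta)
qed

text \<open>It is applied to \<open>median_set\<close> with \<open>\<delta> = 1 - c\<close>, and to
  small subcubes on which a Whitney coefficient is dominated by \<open>W\<close>.\<close>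

definition ample :: "real \<Rightarrow> (int \<Rightarrow> int ^ 'd \<Rightarrow> (real ^ 'd) set) \<Rightarrow> bool" where
  "ample \<delta> E \<longleftrightarrow> (\<forall>k n. E k n \<in> sets borel \<and> E k n \<subseteq> cube k n \<and>
     ennreal (\<delta> * (2 powi k) ^ CARD('d)) \<le> emeasure lborel (E k n))"

lemma ampleD:
  fixes E :: "int \<Rightarrow> int ^ 'd \<Rightarrow> (real ^ 'd) set"
  assumes "ample \<delta> E"
  shows "E k n \<in> sets borel" "E k n \<subseteq> cube k n"
    "ennreal (\<delta> * (2 powi k) ^ CARD('d)) \<le> emeasure lborel (E k n)"
  using assms by (auto simp: ample_def)

lemma measurable_dyadic_sum [measurable]:
  assumes "\<And>k n. A k n \<in> sets borel"
  shows "dyadic_sum A b \<in> borel_measurable borel"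
  unfolding dyadic_sum_def[abs_def] case_prod_beta using assms
  by (intro borel_measurable_nn_integral_count_space) auto

lemma measurable_dyadic_sup [measurable]:
  assumes "\<And>k n. A k n \<in> sets borel"
  shows "dyadic_sup A b \<in> borel_measurable borel"
  unfolding dyadic_sup_def[abs_def] case_prod_beta using assms
  by (intro borel_measurable_SUP) auto

lemma nn_integral_dyadic_sum:
  assumes [measurable]: "\<And>k n. A k n \<in> sets borel" "D \<in> sets borel"
  shows "(\<integral>\<^sup>+x\<in>D. dyadic_sum A b x \<partial>lborel) = (\<integral>\<^sup>+(k, n). b k n * emeasure lborel (A k n \<inter> D) \<partial>count_space UNIV)"
proof -
  have "(\<integral>\<^sup>+x\<in>D. dyadic_sum A b x \<partial>lborel) =
      (\<integral>\<^sup>+x. (\<integral>\<^sup>+p. b (fst p) (snd p) * indicator (A (fst p) (snd p) \<inter> D) x \<partial>count_space UNIV) \<partial>lborel)"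
    unfolding dyadic_sum_def by (intro nn_integral_cong)
      (auto simp: case_prod_beta indicator_def nn_integral_multc[symmetric] intro!: nn_integral_cong)
  also have "\<dots> = (\<integral>\<^sup>+p. (\<integral>\<^sup>+x. b (fst p) (snd p) * indicator (A (fst p) (snd p) \<inter> D) x \<partial>lborel) \<partial>count_space UNIV)"
    by (rule nn_integral_count_space_nn_integral) auto
  also have "\<dots> = (\<integral>\<^sup>+(k, n). b k n * emeasure lborel (A k n \<inter> D) \<partial>count_space UNIV)"
    by (auto intro!: nn_integral_cong simp: nn_integral_cmult_indicator)
  finally show ?thesis .
qed

lemma dyadic_sum_mono:
  assumes "\<And>k n. A k n \<subseteq> B k n" "\<And>k n. b k n \<le> c k n"
  shows "dyadic_sum A b x \<le> dyadic_sum B c x"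
  unfolding dyadic_sum_def case_prod_beta
  using assms by (intro nn_integral_mono mult_mono) (auto simp: indicator_def dest: subsetD[OF assms(1)])

lemma dyadic_sum_add: "dyadic_sum A (\<lambda>k n. b k n + c k n) x = dyadic_sum A b x + dyadic_sum A c x"
  unfolding dyadic_sum_def case_prod_beta distrib_left by (rule nn_integral_add) auto

text \<open>If \<open>x\<close> lies in the star of a cube with \<open>b k n > t\<close>, then all
  of \<open>E k n\<close> lies in the superlevel set of the right-hand supremum, which thus has
  density \<open>\<delta>\<close> in that cube. For suprema this takes the place of the good-lambda
  inequality.\<close>

lemma subset_dense_nbhd:
  fixes b :: "int \<Rightarrow> int ^ 'd \<Rightarrow> ennreal"
  assumes E: "ample \<delta> E"
  shows "{x. t < dyadic_sup star b x} \<subseteq> dense_nbhd {x. t < dyadic_sup E b x} \<delta>"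
proof
  note [measurable] = ampleD(1)[OF E] and sub = ampleD(2)[OF E] and dense = ampleD(3)[OF E]
  fix x assume "x \<in> {x. t < dyadic_sup star b x}"
  then obtain k n where kn: "t < indicator (star k n) x * b k n"
    by (auto simp: dyadic_sup_def less_SUP_iff)
  then have x: "x \<in> star k n" and t: "t < b k n"
    by (cases "x \<in> star k n"; simp)+
  have "E k n \<subseteq> cube k n \<inter> {x. t < dyadic_sup E b x}"
  proof -
    have "t < dyadic_sup E b y" if "y \<in> E k n" for y
      using t that unfolding dyadic_sup_def less_SUP_iff by (intro bexI[of _ "(k, n)"]) auto
    then show ?thesis using sub by auto
  qed
  then have "emeasure lborel (E k n) \<le> emeasure lborel (cube k n \<inter> {x. t < dyadic_sup E b x})"
    by (intro emeasure_mono) auto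
  with dense[of k n] x show "x \<in> dense_nbhd {x. t < dyadic_sup E b x} \<delta>"
    unfolding dense_nbhd_def by (auto intro: order_trans)
qed

text \<open>Cubes of one scale are disjoint, so their volumes add up exactly, while subadditivity is
  enough for the stars.\<close>

lemma emeasure_star_nbhd_le:
  fixes Z :: "(int ^ 'd) set"
  shows "emeasure lborel (\<Union>n\<in>Z. star k n) \<le> ennreal (5 ^ CARD('d)) * emeasure lborel (\<Union>n\<in>Z. cube k n)"
proof -
  have disj: "disjoint_family_on (\<lambda>n. cube k n) Z"
    by (auto simp: disjoint_family_on_def cube_def)
  have "emeasure lborel (\<Union>n\<in>Z. star k n) \<le> (\<integral>\<^sup>+n. emeasure lborel (star k n :: (real ^ 'd) set) \<partial>count_space Z)"
    by (rule emeasure_UN_le_count_space) auto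
  also have "\<dots> \<le> (\<integral>\<^sup>+n. ennreal (5 ^ CARD('d)) * emeasure lborel (cube k n :: (real ^ 'd) set) \<partial>count_space Z)"
    by (intro nn_integral_mono order_trans[OF emeasure_star_le]) (simp add: emeasure_cube flip: ennreal_mult)
  also have "\<dots> = ennreal (5 ^ CARD('d)) * emeasure lborel (\<Union>n\<in>Z. cube k n)"
    by (subst nn_integral_cmult) (auto simp: emeasure_UN_countable[OF _ _ disj])
  finally show ?thesis .
qed

text \<open>Stopping the sum at the scale \<open>k\<close> where it first exceeds \<open>l\<close> yields the sets \<open>P k\<close>. Outside \<open>N\<close>,
  at least half of each \<open>E j n\<close> that matters lies where the right-hand sum is at most \<open>\<gamma> l\<close>, so that
  the integral of the remaining scales over \<open>P k\<close> is small.\<close>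

lemma good_lambda_dyadic_sum:
  fixes b :: "int \<Rightarrow> int ^ 'd \<Rightarrow> ennreal"
  assumes E: "ample \<delta> E"
    and fin: "finite F" "\<And>k n. (k, n) \<notin> F \<Longrightarrow> b k n = 0"
    and \<delta>: "0 < \<delta>" and \<gamma>: "0 < \<gamma>" and l: "0 < l"
  shows "emeasure lborel {x. ennreal (2 * l) < dyadic_sum star b x} \<le>
      ennreal (2 * 25 ^ CARD('d) * \<gamma> / \<delta>) * emeasure lborel {x. ennreal l < dyadic_sum star b x}
      + ennreal (2 * 5 ^ CARD('d) / \<delta>) * emeasure lborel {x. ennreal (\<gamma> * l) < dyadic_sum E b x}"
proof -
  note [measurable] = ampleD(1)[OF E] and sub = ampleD(2)[OF E] and dense = ampleD(3)[OF E]
  let ?d = "CARD('d)"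
  let ?S = "dyadic_sum star b" and ?H = "dyadic_sum E b"
  define \<Omega> where "\<Omega> = {x. ennreal (\<gamma> * l) < ?H x}"
  have [measurable]: "\<Omega> \<in> sets borel" unfolding \<Omega>_def by measurable
  \<comment> \<open>Half the density of \<open>E\<close>: if \<open>star j n\<close> has a point
    outside \<open>N\<close>, then \<open>\<Omega>\<close> fills less than half of what
    \<open>ample\<close> guarantees for \<open>E j n\<close>.\<close>
  define N where "N = dense_nbhd \<Omega> (\<delta> / 2)"
  have [measurable]: "N \<in> sets borel" unfolding N_def by (rule sets_dense_nbhd)
  \<comment> \<open>\<open>T k\<close> collects the coarse scales and grows as \<open>k\<close>
    decreases; \<open>L k\<close> collects the fine ones. Scale \<open>k\<close> belongs to both, so
    it is \<open>T (k + 1)\<close> that complements \<open>L k\<close>.\<close>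
  define T where "T k = dyadic_sum star (\<lambda>j n. if k \<le> j then b j n else 0)" for k
  define L where "L k = dyadic_sum star (\<lambda>j n. if j \<le> k then b j n else 0)" for k
  have [measurable]: "T k \<in> borel_measurable borel" "L k \<in> borel_measurable borel" for k
    unfolding T_def L_def by measurable
  have S_split: "?S x = T (k + 1) x + L k x" for k x
    unfolding T_def L_def dyadic_sum_add[symmetric] by (rule arg_cong[where f = "\<lambda>b. dyadic_sum star b x"]) (auto simp: fun_eq_iff)
  have T_antimono: "T k x \<le> T j x" if "j \<le> k" for j k x
    unfolding T_def using that by (intro dyadic_sum_mono) auto
  \<comment> \<open>For \<open>j \<ge> k\<close>, whether \<open>x\<close> lies in
    \<open>star j n\<close> depends only on the cube of scale \<open>k\<close> containing
    \<open>x\<close>. This makes \<open>P k\<close> a union of cubes of scale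
    \<open>k\<close>.\<close>
  have T_cong: "T k x = T k y" if xy: "grid_index k x = grid_index k y" for k x y
  proof -
    have "indicator (star j n) x * (if k \<le> j then b j n else 0) = indicator (star j n) y * (if k \<le> j then b j n else 0)" for j n
      using grid_index_eq_mono[OF _ xy, of j] by (auto simp: indicator_def star_def)
    then show ?thesis unfolding T_def dyadic_sum_def by simp
  qed
  define P where "P k = {x. ennreal l < T k x \<and> T (k + 1) x \<le> ennreal l}" for k
  have [measurable]: "P k \<in> sets borel" for k unfolding P_def by measurable
  have P_disj: "disjoint_family P"
  proof -
    have "P j \<inter> P k = {}" if "j < k" for j k
      using that T_antimono[of "j + 1" k] by (auto simp: P_def) (metis not_less order_trans add1_zle_eq)
    then show ?thesis unfolding disjoint_family_on_def by (metis Int_commute linorder_neqE)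
  qed
  have P_UN: "{x. ennreal l < ?S x} = (\<Union>k. P k)"
  proof (intro equalityI subsetI)
    fix x assume "x \<in> {x. ennreal l < ?S x}"
    then have x: "ennreal l < ?S x" by simp
    \<comment> \<open>Only finitely many scales carry coefficients, so \<open>T\<close> is the full
      sum for low \<open>k\<close> and vanishes for high \<open>k\<close>; hence there is a largest
      \<open>k\<close> with \<open>T k x > l\<close>.\<close>
    define K where "K = fst ` F"
    have "finite K" using fin(1) by (simp add: K_def)
    obtain u v where uv: "\<And>k. k \<in> K \<Longrightarrow> u \<le> k" "\<And>k. k \<in> K \<Longrightarrow> k < v"
    proof -
      have "\<forall>k\<in>K. Min (insert 0 K) \<le> k" "\<forall>k\<in>K. k < Max (insert 0 K) + 1"
        using \<open>finite K\<close> by (auto intro: Max_ge le_imp_less_Suc simp: less_add_one le_less_trans zle_add1_eq_le)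
      then show ?thesis using that by blast
    qed
    have b0: "b k n = 0" if "k \<notin> K" for k n
      using fin(2)[of k n] that by (force simp: K_def)
    have "(\<lambda>j n. if u \<le> j then b j n else 0) = b"
      using uv(1) b0 by (force simp: fun_eq_iff)
    then have "T u = ?S" by (simp add: T_def)
    have "T v x = 0" unfolding T_def dyadic_sum_def using uv(2) b0
      by (subst nn_integral_0_iff_AE) (auto simp: AE_count_space, meson not_less)
    define A where "A = {k. u \<le> k \<and> ennreal l < T k x}"
    have "A \<subseteq> {u..v}"
    proof
      fix k assume "k \<in> A"
      moreover have "k < v"
      proof (rule ccontr)
        assume "\<not> k < v"
        then have "T k x \<le> T v x" by (intro T_antimono) auto
        with \<open>T v x = 0\<close> \<open>k \<in> A\<close> show False by (simp add: A_def)
      qed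
      ultimately show "k \<in> {u..v}" by (simp add: A_def)
    qed
    then have "finite A" by (rule finite_subset) simp
    moreover have "u \<in> A" using x \<open>T u = ?S\<close> by (simp add: A_def)
    ultimately have "Max A \<in> A" "Max A + 1 \<notin> A"
      by (auto intro!: Max_in dest: Max_ge)
    then have "x \<in> P (Max A)" by (auto simp: A_def P_def)
    then show "x \<in> (\<Union>k. P k)" by blast
  next
    fix x assume "x \<in> (\<Union>k. P k)"
    then obtain k where "ennreal l < T k x" by (auto simp: P_def)
    also have "T k x \<le> ?S x" unfolding T_def by (intro dyadic_sum_mono) auto
    finally show "x \<in> {x. ennreal l < ?S x}" by simp
  qed
  define D where "D k = P k \<inter> {x. ennreal (2 * l) < ?S x} - N" for k
  have [measurable]: "D k \<in> sets borel" for k unfolding D_def by measurable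
  have level: "emeasure lborel (D k) \<le> ennreal (2 * 25 ^ ?d * \<gamma> / \<delta>) * emeasure lborel (P k)" for k
  proof -
    \<comment> \<open>If \<open>star j n\<close> with \<open>j \<le> k\<close> meets
      \<open>P k\<close>, then \<open>cube j n\<close> lies in \<open>U\<close>, whose measure is at
      most \<open>5^d |P k|\<close>.\<close>
    define U where "U = (\<Union>n\<in>grid_index k ` P k. star k n)"
    have [measurable]: "U \<in> sets borel" unfolding U_def by (intro sets.countable_UN'') auto
    have P_eq: "P k = (\<Union>n\<in>grid_index k ` P k. cube k n)"
    proof -
      have "y \<in> P k" if x: "x \<in> P k" and y: "grid_index k y = grid_index k x" for x y
      proof -
        have "T k y = T k x" using y by (rule T_cong)
        moreover have "T (k + 1) y = T (k + 1) x"
          by (rule T_cong, rule grid_index_eq_mono[OF _ y]) simp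
        ultimately show ?thesis using x by (simp add: P_def)
      qed
      then show ?thesis by (auto simp: cube_def)
    qed
    have U_le: "emeasure lborel U \<le> ennreal (5 ^ ?d) * emeasure lborel (P k)"
      using emeasure_star_nbhd_le[of k "grid_index k ` P k"] P_eq by (simp add: U_def)
    \<comment> \<open>The mass of \<open>star j n\<close> is transferred to the part of
      \<open>E j n\<close> outside \<open>\<Omega>\<close>, which fills at least the fraction
      \<open>\<delta> / 2\<close> of the cube; \<open>5^d\<close> is the volume ratio of star and
      cube.\<close>
    have term_le: "(if j \<le> k then b j n else 0) * emeasure lborel (star j n \<inter> D k)
      \<le> ennreal (2 * 5 ^ ?d / \<delta>) * (b j n * emeasure lborel (E j n \<inter> (U - \<Omega>)))" for j n
    proof (cases "j \<le> k \<and> star j n \<inter> D k \<noteq> {}")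
      case True
      then obtain x where x: "x \<in> star j n" "x \<in> P k" "x \<notin> N" "j \<le> k" by (auto simp: D_def)
      have "cube j n \<subseteq> U"
      proof
        fix y assume "y \<in> cube j n"
        with x have "near (grid_index j x) (grid_index j y)" by (auto simp: star_def cube_def)
        from near_grid_index_mono[OF x(4) this] x(2) show "y \<in> U"
          by (auto simp: U_def star_def near_commute)
      qed
      with sub[of j n] have EU: "E j n \<inter> (U - \<Omega>) = E j n - \<Omega>" by auto
      let ?v = "(2 powi j) ^ ?d :: real"
      have "emeasure lborel (cube j n \<inter> \<Omega>) < ennreal (\<delta> / 2 * ?v)"
        using x(1,3) by (auto simp: N_def dense_nbhd_def not_le[symmetric])
      moreover have "emeasure lborel (E j n) \<le> emeasure lborel (E j n - \<Omega>) + emeasure lborel (cube j n \<inter> \<Omega>)"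
      proof -
        have "emeasure lborel (E j n) \<le> emeasure lborel ((E j n - \<Omega>) \<union> (cube j n \<inter> \<Omega>))"
          using sub[of j n] by (intro emeasure_mono) auto
        also have "\<dots> \<le> emeasure lborel (E j n - \<Omega>) + emeasure lborel (cube j n \<inter> \<Omega>)"
          by (rule emeasure_subadditive) auto
        finally show ?thesis .
      qed
      ultimately have half: "ennreal (\<delta> / 2 * ?v) \<le> emeasure lborel (E j n - \<Omega>)"
      proof -
        assume 1: "emeasure lborel (cube j n \<inter> \<Omega>) < ennreal (\<delta> / 2 * ?v)"
          and 2: "emeasure lborel (E j n) \<le> emeasure lborel (E j n - \<Omega>) + emeasure lborel (cube j n \<inter> \<Omega>)"
        have 3: "ennreal (\<delta> * ?v) \<le> emeasure lborel (E j n - \<Omega>) + emeasure lborel (cube j n \<inter> \<Omega>)"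
          using dense[of j n] 2 by (rule order_trans)
        show ?thesis
        proof (cases "emeasure lborel (E j n - \<Omega>)")
          case (real e)
          from 1 obtain c where c: "0 \<le> c" "emeasure lborel (cube j n \<inter> \<Omega>) = ennreal c" "c < \<delta> / 2 * ?v"
            by (cases "emeasure lborel (cube j n \<inter> \<Omega>)") (auto simp: ennreal_less_iff)
          from 3 real c have "\<delta> * ?v \<le> e + c" by (simp flip: ennreal_plus)
          with c real show ?thesis by simp
        qed simp
      qed
      have "emeasure lborel (star j n \<inter> D k) \<le> ennreal (5 ^ ?d * ?v)"
        by (rule order_trans[OF emeasure_mono emeasure_star_le]) auto
      also have "\<dots> = ennreal (2 * 5 ^ ?d / \<delta>) * ennreal (\<delta> / 2 * ?v)"
        using \<delta> by (simp flip: ennreal_mult)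
      also have "\<dots> \<le> ennreal (2 * 5 ^ ?d / \<delta>) * emeasure lborel (E j n - \<Omega>)"
        by (rule mult_left_mono[OF half]) simp
      finally have "b j n * emeasure lborel (star j n \<inter> D k) \<le> b j n * (ennreal (2 * 5 ^ ?d / \<delta>) * emeasure lborel (E j n - \<Omega>))"
        by (rule mult_left_mono) simp
      then show ?thesis using x(4) EU by (simp add: mult_ac)
    qed auto
    have "ennreal l * emeasure lborel (D k) = (\<integral>\<^sup>+x. ennreal l * indicator (D k) x \<partial>lborel)"
      by (simp add: nn_integral_cmult_indicator)
    \<comment> \<open>On \<open>D k\<close> the coarse part \<open>T (k + 1)\<close> is at most
      \<open>l\<close> while the full sum exceeds \<open>2 * l\<close>, so the fine part is at least
      \<open>l\<close>.\<close>
    also have "\<dots> \<le> (\<integral>\<^sup>+x\<in>D k. L k x \<partial>lborel)"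
    proof (rule nn_integral_mono)
      fix x
      show "ennreal l * indicator (D k) x \<le> L k x * indicator (D k) x"
      proof (cases "x \<in> D k")
        case True
        then have "T (k + 1) x \<le> ennreal l" "ennreal (2 * l) < T (k + 1) x + L k x"
          by (auto simp: D_def P_def S_split[of x k])
        then have "ennreal l \<le> L k x"
        proof (cases "L k x")
          case (real r)
          assume *: "T (k + 1) x \<le> ennreal l" "ennreal (2 * l) < T (k + 1) x + L k x"
          then obtain t where t: "0 \<le> t" "T (k + 1) x = ennreal t" "t \<le> l"
            using l by (cases "T (k + 1) x") (auto simp: top_unique)
          from * real t have "2 * l < t + r" by (simp add: ennreal_less_iff flip: ennreal_plus)
          with t real show ?thesis by simp
        qed simp
        with True show ?thesis by simp
      qed simp
    qed
    also have "\<dots> = (\<integral>\<^sup>+(j, n). (if j \<le> k then b j n else 0) * emeasure lborel (star j n \<inter> D k) \<partial>count_space UNIV)"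
      unfolding L_def by (rule nn_integral_dyadic_sum) auto
    also have "\<dots> \<le> (\<integral>\<^sup>+(j, n). ennreal (2 * 5 ^ ?d / \<delta>) * (b j n * emeasure lborel (E j n \<inter> (U - \<Omega>))) \<partial>count_space UNIV)"
      by (intro nn_integral_mono) (simp only: case_prod_beta, rule term_le)
    also have "\<dots> = ennreal (2 * 5 ^ ?d / \<delta>) * (\<integral>\<^sup>+(j, n). b j n * emeasure lborel (E j n \<inter> (U - \<Omega>)) \<partial>count_space UNIV)"
      unfolding case_prod_beta by (rule nn_integral_cmult) simp
    also have "(\<integral>\<^sup>+(j, n). b j n * emeasure lborel (E j n \<inter> (U - \<Omega>)) \<partial>count_space UNIV) = (\<integral>\<^sup>+x\<in>U - \<Omega>. ?H x \<partial>lborel)"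
      by (rule nn_integral_dyadic_sum[symmetric]) auto
    \<comment> \<open>Outside \<open>\<Omega>\<close> the sum over \<open>E\<close> is at most
      \<open>\<gamma> * l\<close>, so only the measure of \<open>U\<close> enters.\<close>
    also have "\<dots> \<le> (\<integral>\<^sup>+x. ennreal (\<gamma> * l) * indicator U x \<partial>lborel)"
      by (intro nn_integral_mono) (auto simp: \<Omega>_def indicator_def)
    also have "\<dots> = ennreal (\<gamma> * l) * emeasure lborel U"
      by (simp add: nn_integral_cmult_indicator)
    also have "\<dots> \<le> ennreal (\<gamma> * l) * (ennreal (5 ^ ?d) * emeasure lborel (P k))"
      by (rule mult_left_mono[OF U_le]) simp
    finally have main: "ennreal l * emeasure lborel (D k) \<le>
        ennreal (2 * 5 ^ ?d / \<delta>) * (ennreal (\<gamma> * l) * (ennreal (5 ^ ?d) * emeasure lborel (P k)))"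
      by (simp add: mult_left_mono)
    also have "\<dots> = ennreal l * (ennreal (2 * 25 ^ ?d * \<gamma> / \<delta>) * emeasure lborel (P k))"
    proof -
      have "(25::real) ^ ?d = 5 ^ ?d * 5 ^ ?d" by (simp flip: power_mult_distrib)
      then have "2 * 5 ^ ?d / \<delta> * (\<gamma> * l) * 5 ^ ?d = l * (2 * 25 ^ ?d * \<gamma> / \<delta>)" by simp
      then have eq: "ennreal (2 * 5 ^ ?d / \<delta>) * ennreal (\<gamma> * l) * ennreal (5 ^ ?d) = ennreal l * ennreal (2 * 25 ^ ?d * \<gamma> / \<delta>)"
        using \<delta> \<gamma> l by (simp flip: ennreal_mult)
      from arg_cong[OF eq, of "\<lambda>z. z * emeasure lborel (P k)"] show ?thesis
        by (simp only: mult.assoc)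
    qed
    finally show ?thesis
      using l by (subst (asm) ennreal_mult_le_mult_iff) auto
  qed
  have "emeasure lborel {x. ennreal (2 * l) < ?S x} \<le> emeasure lborel ((\<Union>k. D k) \<union> N)"
  proof (rule emeasure_mono)
    show "{x. ennreal (2 * l) < ?S x} \<subseteq> (\<Union>k. D k) \<union> N"
    proof
      fix x assume x: "x \<in> {x. ennreal (2 * l) < ?S x}"
      have "ennreal l \<le> ennreal (2 * l)" using l by simp
      with x have "x \<in> (\<Union>k. P k)" unfolding P_UN[symmetric] by (auto intro: le_less_trans)
      with x show "x \<in> (\<Union>k. D k) \<union> N" by (auto simp: D_def)
    qed
  qed auto
  also have "\<dots> \<le> emeasure lborel (\<Union>k. D k) + emeasure lborel N"
    by (rule emeasure_subadditive) auto
  also have "emeasure lborel (\<Union>k. D k) \<le> (\<integral>\<^sup>+k. emeasure lborel (D k) \<partial>count_space UNIV)"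
    by (rule emeasure_UN_le_count_space) auto
  also have "\<dots> \<le> (\<integral>\<^sup>+k. ennreal (2 * 25 ^ ?d * \<gamma> / \<delta>) * emeasure lborel (P k) \<partial>count_space UNIV)"
    by (intro nn_integral_mono level)
  also have "\<dots> = ennreal (2 * 25 ^ ?d * \<gamma> / \<delta>) * emeasure lborel {x. ennreal l < ?S x}"
    unfolding P_UN using P_disj by (subst nn_integral_cmult) (auto simp: emeasure_UN_countable)
  also have "emeasure lborel N \<le> ennreal (5 ^ ?d / (\<delta> / 2)) * emeasure lborel \<Omega>"
    unfolding N_def using \<delta> by (intro emeasure_dense_nbhd_le) auto
  finally show ?thesis by (simp add: \<Omega>_def add_mono mult.commute)
qed

text \<open>\<open>\<gamma>\<close> makes the factor in the good-lambda inequality exactly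
  \<open>2 powr (-s) / 2\<close>. Finitely many finite coefficients give a bounded sum supported in
  a set of finite measure, whence the finiteness required for absorption.\<close>

lemma dyadic_sum_star_power_le_aux:
  fixes b :: "int \<Rightarrow> int ^ 'd \<Rightarrow> ennreal"
  assumes E: "ample \<delta> E"
    and fin: "finite F" "\<And>k n. (k, n) \<notin> F \<Longrightarrow> b k n = 0" and b: "\<And>k n. b k n < \<infinity>"
    and \<delta>: "0 < \<delta>" and \<gamma>: "\<gamma> = \<delta> / (4 * 25 ^ CARD('d) * 2 powr s)" and s: "0 < s"
  shows "(\<integral>\<^sup>+x. epowr (dyadic_sum star b x) s \<partial>lborel)
    \<le> ennreal (2 * (2 * 5 ^ CARD('d) / \<delta>) * 2 powr s * \<gamma> powr (-s)) * (\<integral>\<^sup>+x. epowr (dyadic_sum E b x) s \<partial>lborel)"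
proof (rule good_lambda_imp_power_integral_le[OF s])
  note [measurable] = ampleD(1)[OF E]
  show \<gamma>0: "0 < \<gamma>" using \<gamma> \<delta> by simp
  show "0 \<le> 2 * 25 ^ CARD('d) * \<gamma> / \<delta>" using \<gamma>0 \<delta> by simp
  show "2 * 25 ^ CARD('d) * \<gamma> / \<delta> * 2 powr s \<le> 1 / 2" using \<delta> by (simp add: \<gamma>)
  show "0 \<le> 2 * 5 ^ CARD('d) / \<delta>" using \<delta> by simp
  show "dyadic_sum star b \<in> borel_measurable borel" by measurable
  show "dyadic_sum E b \<in> borel_measurable borel" by measurable
  show "emeasure lborel {x. ennreal (2 * l) < dyadic_sum star b x} \<le>
      ennreal (2 * 25 ^ CARD('d) * \<gamma> / \<delta>) * emeasure lborel {x. ennreal l < dyadic_sum star b x}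
      + ennreal (2 * 5 ^ CARD('d) / \<delta>) * emeasure lborel {x. ennreal (\<gamma> * l) < dyadic_sum E b x}" if "0 < l" for l
    by (rule good_lambda_dyadic_sum[OF E fin \<delta> \<gamma>0 that])
  define B where "B = (\<Sum>(k, n)\<in>F. b k n)"
  have B: "B < \<infinity>" using fin(1) b by (auto simp: B_def case_prod_beta)
  define Q where "Q = (\<Union>(k, n)\<in>F. star k n)"
  have Qm[measurable]: "Q \<in> sets borel" unfolding Q_def using fin(1) by (intro sets.finite_UN) auto
  have Q: "emeasure lborel Q < \<infinity>"
  proof -
    have "emeasure lborel Q \<le> (\<Sum>p\<in>F. emeasure lborel (star (fst p) (snd p)))"
      unfolding Q_def case_prod_beta using fin(1) by (intro emeasure_subadditive_finite) auto
    also have "\<dots> < \<infinity>"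
      using fin(1) le_less_trans[OF emeasure_star_le ennreal_less_top] by (auto simp: less_top)
    finally show ?thesis .
  qed
  have dyadic_sum_le: "dyadic_sum star b x \<le> B * indicator Q x" for x
  proof -
    have "dyadic_sum star b x = (\<Sum>p\<in>F. indicator (star (fst p) (snd p)) x * b (fst p) (snd p))"
      unfolding dyadic_sum_def case_prod_beta using fin by (intro nn_integral_count_space') auto
    also have "\<dots> \<le> (\<Sum>p\<in>F. b (fst p) (snd p) * indicator Q x)"
      by (intro sum_mono) (auto simp: Q_def indicator_def)
    also have "\<dots> = B * indicator Q x" by (simp add: B_def case_prod_beta sum_distrib_right)
    finally show ?thesis .
  qed
  have "(\<integral>\<^sup>+x. epowr (dyadic_sum star b x) s \<partial>lborel) \<le> (\<integral>\<^sup>+x. epowr B s * indicator Q x \<partial>lborel)"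
  proof (rule nn_integral_mono)
    fix x
    have "epowr (dyadic_sum star b x) s \<le> epowr (B * indicator Q x) s"
      using s by (intro epowr_mono dyadic_sum_le) auto
    then show "epowr (dyadic_sum star b x) s \<le> epowr B s * indicator Q x"
      by (cases "x \<in> Q") auto
  qed
  also have "\<dots> = epowr B s * emeasure lborel Q" by (simp add: nn_integral_cmult_indicator)
  also have "\<dots> < \<infinity>" using B Q by (auto simp: ennreal_mult_eq_top_iff less_top[symmetric])
  finally show "(\<integral>\<^sup>+x. epowr (dyadic_sum star b x) s \<partial>lborel) < \<infinity>" .
qed

text \<open>The finiteness assumptions are removed. An infinite coefficient makes the right side
  infinite because \<open>E k n\<close> has positive measure; otherwise the family is exhausted by
  finite subfamilies along an enumeration of all cubes, with the same constant throughout.\<close>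

lemma dyadic_sum_star_power_le:
  assumes \<delta>: "0 < \<delta>" and s: "0 < s"
  shows "\<exists>C>0. \<forall>(b :: int \<Rightarrow> int ^ 'd \<Rightarrow> ennreal) E.
    ample \<delta> E \<longrightarrow>
    (\<integral>\<^sup>+x. epowr (dyadic_sum star b x) s \<partial>lborel) \<le> ennreal C * (\<integral>\<^sup>+x. epowr (dyadic_sum E b x) s \<partial>lborel)"
proof -
  define \<gamma> where "\<gamma> = \<delta> / (4 * 25 ^ CARD('d) * 2 powr s)"
  define C where "C = 2 * (2 * 5 ^ CARD('d) / \<delta>) * 2 powr s * \<gamma> powr (-s)"
  have "0 < C" using \<delta> by (simp add: C_def \<gamma>_def)
  moreover have "(\<integral>\<^sup>+x. epowr (dyadic_sum star b x) s \<partial>lborel) \<le> ennreal C * (\<integral>\<^sup>+x. epowr (dyadic_sum E b x) s \<partial>lborel)"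
    if *: "ample \<delta> E"
    for b :: "int \<Rightarrow> int ^ 'd \<Rightarrow> ennreal" and E
  proof (cases "\<exists>k n. b k n = \<infinity>")
    case True
    then obtain k n where kn: "b k n = \<infinity>" by auto
    note E = ampleD(1,3)[OF *, of k n]
    have "0 < ennreal (\<delta> * (2 powi k) ^ CARD('d))" using \<delta> by simp
    with E(2) have "emeasure lborel (E k n) \<noteq> 0" by (metis not_less)
    have "\<infinity> = \<infinity> * emeasure lborel (E k n)"
      using \<open>emeasure lborel (E k n) \<noteq> 0\<close> by (simp add: ennreal_top_mult)
    also have "\<dots> = (\<integral>\<^sup>+x. \<infinity> * indicator (E k n) x \<partial>lborel)"
      using E(1) by (subst nn_integral_cmult_indicator) auto
    also have "\<dots> \<le> (\<integral>\<^sup>+x. epowr (dyadic_sum E b x) s \<partial>lborel)"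
    proof (rule nn_integral_mono)
      fix x
      show "\<infinity> * indicator (E k n) x \<le> epowr (dyadic_sum E b x) s"
      proof (cases "x \<in> E k n")
        case True
        have "indicator (E k n) x * b k n \<le> dyadic_sum E b x"
          unfolding dyadic_sum_def using nn_integral_ge_point[of "(k, n)" UNIV "\<lambda>(k, n). indicator (E k n) x * b k n"] by simp
        with True kn have "dyadic_sum E b x = \<infinity>" by (simp add: top_unique)
        then show ?thesis by simp
      qed simp
    qed
    finally have "(\<integral>\<^sup>+x. epowr (dyadic_sum E b x) s \<partial>lborel) = \<infinity>" by (simp add: top_unique)
    then show ?thesis using \<open>0 < C\<close> by (simp add: ennreal_mult_top)
  next
    case False
    define F where "F m = (from_nat :: nat \<Rightarrow> int \<times> (int ^ 'd)) ` {..m}" for m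
    define b' where "b' m k n = (if (k, n) \<in> F m then b k n else 0)" for m k n
    have F_mono: "F m \<subseteq> F m'" if "m \<le> m'" for m m' using that by (auto simp: F_def)
    have b'_mono: "b' m k n \<le> b' m' k n" if "m \<le> m'" for m m' k n
      using F_mono[OF that] by (auto simp: b'_def)
    have F_ex: "p \<in> F (to_nat p)" for p by (auto simp: F_def image_iff intro!: bexI[of _ "to_nat p"])
    have b_SUP: "(SUP m. b' m k n) = b k n" for k n
    proof (rule antisym)
      show "(SUP m. b' m k n) \<le> b k n" by (intro SUP_least) (simp add: b'_def)
      show "b k n \<le> (SUP m. b' m k n)"
        by (rule SUP_upper2[of "to_nat (k, n)"]) (auto simp: b'_def F_ex)
    qed
    have dyadic_sum_SUP: "dyadic_sum star b x = (SUP m. dyadic_sum star (b' m) x)" for x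
    proof -
      have "dyadic_sum star b x = (\<integral>\<^sup>+p. (SUP m. indicator (star (fst p) (snd p)) x * b' m (fst p) (snd p)) \<partial>count_space UNIV)"
        unfolding dyadic_sum_def case_prod_beta by (simp add: b_SUP flip: SUP_mult_left_ennreal)
      also have "\<dots> = (SUP m. \<integral>\<^sup>+p. indicator (star (fst p) (snd p)) x * b' m (fst p) (snd p) \<partial>count_space UNIV)"
        by (intro nn_integral_monotone_convergence_SUP)
          (auto simp: incseq_def le_fun_def intro!: mult_left_mono b'_mono)
      finally show ?thesis unfolding dyadic_sum_def case_prod_beta .
    qed
    have "(\<integral>\<^sup>+x. epowr (dyadic_sum star b x) s \<partial>lborel) = (\<integral>\<^sup>+x. (SUP m. epowr (dyadic_sum star (b' m) x) s) \<partial>lborel)"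
      by (simp add: dyadic_sum_SUP epowr_SUP[OF s])
    also have "\<dots> = (SUP m. \<integral>\<^sup>+x. epowr (dyadic_sum star (b' m) x) s \<partial>lborel)"
      by (intro nn_integral_monotone_convergence_SUP)
        (auto simp: incseq_def le_fun_def intro!: epowr_mono dyadic_sum_mono b'_mono less_imp_le[OF s])
    also have "\<dots> \<le> ennreal C * (\<integral>\<^sup>+x. epowr (dyadic_sum E b x) s \<partial>lborel)"
    proof (rule SUP_least)
      fix m
      have "(\<integral>\<^sup>+x. epowr (dyadic_sum star (b' m) x) s \<partial>lborel) \<le> ennreal C * (\<integral>\<^sup>+x. epowr (dyadic_sum E (b' m) x) s \<partial>lborel)"
        unfolding C_def
        by (rule dyadic_sum_star_power_le_aux[where F = "F m", OF * _ _ _ \<delta> \<gamma>_def s])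
          (use False in \<open>auto simp: F_def b'_def less_top\<close>)
      also have "\<dots> \<le> ennreal C * (\<integral>\<^sup>+x. epowr (dyadic_sum E b x) s \<partial>lborel)"
        by (intro mult_left_mono nn_integral_mono epowr_mono dyadic_sum_mono less_imp_le[OF s]) (auto simp: b'_def)
      finally show "(\<integral>\<^sup>+x. epowr (dyadic_sum star (b' m) x) s \<partial>lborel) \<le> ennreal C * (\<integral>\<^sup>+x. epowr (dyadic_sum E b x) s \<partial>lborel)" .
    qed
    finally show ?thesis .
  qed
  ultimately show ?thesis by blast
qed

section \<open>Dyadic medians\<close>


lemma sum_le_nn_integral_count_space:
  assumes "finite F"
  shows "(\<Sum>p\<in>F. f p) \<le> (\<integral>\<^sup>+p. f p \<partial>count_space UNIV)"
proof -
  have "(\<Sum>p\<in>F. f p) = (\<Sum>p\<in>F. f p * indicator F p)" by (intro sum.cong) auto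
  also have "\<dots> = (\<integral>\<^sup>+p. f p * indicator F p \<partial>count_space UNIV)"
    using assms by (intro nn_integral_count_space'[symmetric]) auto
  also have "\<dots> \<le> (\<integral>\<^sup>+p. f p \<partial>count_space UNIV)"
    by (intro nn_integral_mono) (auto simp: indicator_def)
  finally show ?thesis .
qed

text \<open>The integral is the supremum of the finite subsums, so a bound may be checked on finite
  families, in which a largest cube exists.\<close>

lemma nn_integral_count_space_least:
  fixes f :: "'i::countable \<Rightarrow> ennreal"
  assumes "\<And>F. finite F \<Longrightarrow> (\<Sum>p\<in>F. f p) \<le> c"
  shows "(\<integral>\<^sup>+p. f p \<partial>count_space UNIV) \<le> c"
proof -
  define F where "F m = (from_nat :: nat \<Rightarrow> 'i) ` {..m}" for m
  have F_mono: "F m \<subseteq> F m'" if "m \<le> m'" for m m' using that by (auto simp: F_def)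
  have F_ex: "p \<in> F (to_nat p)" for p by (auto simp: F_def image_iff intro!: bexI[of _ "to_nat p"])
  have "f p = (SUP m. f p * indicator (F m) p)" for p
  proof (rule antisym)
    show "f p \<le> (SUP m. f p * indicator (F m) p)"
      using F_ex[of p] by (intro SUP_upper2[of "to_nat p"]) auto
    show "(SUP m. f p * indicator (F m) p) \<le> f p"
      by (intro SUP_least) (auto simp: indicator_def)
  qed
  then have "(\<integral>\<^sup>+p. f p \<partial>count_space UNIV) = (\<integral>\<^sup>+p. (SUP m. f p * indicator (F m) p) \<partial>count_space UNIV)"
    by simp
  also have "\<dots> = (SUP m. \<integral>\<^sup>+p. f p * indicator (F m) p \<partial>count_space UNIV)"
    using F_mono by (intro nn_integral_monotone_convergence_SUP)
      (auto simp: incseq_def le_fun_def indicator_def dest: subsetD)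
  also have "\<dots> \<le> c"
  proof (rule SUP_least)
    fix m
    have "(\<integral>\<^sup>+p. f p * indicator (F m) p \<partial>count_space UNIV) = (\<Sum>p\<in>F m. f p * indicator (F m) p)"
      by (intro nn_integral_count_space') (auto simp: F_def)
    also have "\<dots> = (\<Sum>p\<in>F m. f p)" by (intro sum.cong) auto
    also have "\<dots> \<le> c" by (rule assms) (simp add: F_def)
    finally show "(\<integral>\<^sup>+p. f p * indicator (F m) p \<partial>count_space UNIV) \<le> c" .
  qed
  finally show ?thesis .
qed

definition dyadic_lq :: "ennreal \<Rightarrow> (int \<Rightarrow> int ^ 'd \<Rightarrow> (real ^ 'd) set) \<Rightarrow> (int \<Rightarrow> int ^ 'd \<Rightarrow> ennreal) \<Rightarrow> real ^ 'd \<Rightarrow> ennreal" where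
  "dyadic_lq q A a x = (if q = \<infinity> then dyadic_sup A a x
     else epowr (dyadic_sum A (\<lambda>k n. epowr (a k n) (enn2real q)) x) (1 / enn2real q))"

lemma enn2real_pos: "0 < q \<Longrightarrow> q \<noteq> \<infinity> \<Longrightarrow> 0 < enn2real q"
  by (simp add: enn2real_positive_iff less_top)

lemma measurable_dyadic_lq [measurable]:
  assumes [measurable]: "\<And>k n. A k n \<in> sets borel"
  shows "dyadic_lq q A a \<in> borel_measurable borel"
  unfolding dyadic_lq_def[abs_def] by (cases "q = \<infinity>") (auto intro!: measurable_epowr)

lemma dyadic_sup_mono:
  assumes "\<And>k n. A k n \<subseteq> B k n" "\<And>k n. a k n \<le> b k n"
  shows "dyadic_sup A a x \<le> dyadic_sup B b x"
  unfolding dyadic_sup_def case_prod_beta using assms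
  by (intro SUP_mono' mult_mono) (auto simp: indicator_def dest: subsetD[OF assms(1)])

lemma dyadic_lq_mono:
  assumes "0 < q" "\<And>k n. A k n \<subseteq> B k n" "\<And>k n. a k n \<le> b k n"
  shows "dyadic_lq q A a x \<le> dyadic_lq q B b x"
  unfolding dyadic_lq_def using assms
  by (auto intro!: dyadic_sup_mono dyadic_sum_mono epowr_mono)

lemma le_dyadic_sum: "x \<in> A k n \<Longrightarrow> b k n \<le> dyadic_sum A b x"
  unfolding dyadic_sum_def using nn_integral_ge_point[of "(k, n)" UNIV "\<lambda>(k, n). indicator (A k n) x * b k n"] by simp

lemma le_dyadic_sup: "x \<in> A k n \<Longrightarrow> b k n \<le> dyadic_sup A b x"
  unfolding dyadic_sup_def by (rule SUP_upper2[of "(k, n)"]) auto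

lemma le_dyadic_lq:
  assumes "0 < q" "x \<in> A k n"
  shows "a k n \<le> dyadic_lq q A a x"
proof (cases "q = \<infinity>")
  case False
  have "epowr (a k n) (enn2real q) \<le> dyadic_sum A (\<lambda>k n. epowr (a k n) (enn2real q)) x"
    using assms(2) by (rule le_dyadic_sum)
  from epowr_mono[OF _ this, of "1 / enn2real q"] show ?thesis
    using False enn2real_pos[OF assms(1) False] by (simp add: dyadic_lq_def)
qed (use assms(2) in \<open>simp add: dyadic_lq_def le_dyadic_sup\<close>)

text \<open>For finite \<open>q\<close> the estimate for sums is applied to \<open>a^q\<close> with
  exponent \<open>p / q\<close>. For \<open>q = \<infinity>\<close> the inclusion of superlevel sets
  and the weak-type bound for \<open>dense_nbhd\<close> are combined.\<close>

lemma dyadic_lq_star_power_le: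
  assumes p: "0 < p" and q: "0 < q" and \<delta>: "0 < \<delta>"
  shows "\<exists>C>0. \<forall>(a :: int \<Rightarrow> int ^ 'd \<Rightarrow> ennreal) E.
    ample \<delta> E \<longrightarrow>
    (\<integral>\<^sup>+x. epowr (dyadic_lq q star a x) p \<partial>lborel) \<le> ennreal C * (\<integral>\<^sup>+x. epowr (dyadic_lq q E a x) p \<partial>lborel)"
proof (cases "q = \<infinity>")
  case True
  let ?C = "5 ^ CARD('d) / \<delta>"
  have "(\<integral>\<^sup>+x. epowr (dyadic_sup star a x) p \<partial>lborel) \<le> ennreal ?C * (\<integral>\<^sup>+x. epowr (dyadic_sup E a x) p \<partial>lborel)"
    if *: "ample \<delta> E"
    for a :: "int \<Rightarrow> int ^ 'd \<Rightarrow> ennreal" and E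
  proof -
    note [measurable] = ampleD(1)[OF *]
    have "emeasure lborel {x. ennreal l < dyadic_sup star a x} \<le> ennreal ?C * emeasure lborel {x. ennreal l < dyadic_sup E a x}" for l
    proof -
      have "emeasure lborel {x. ennreal l < dyadic_sup star a x} \<le> emeasure lborel (dense_nbhd {x. ennreal l < dyadic_sup E a x} \<delta>)"
        by (intro emeasure_mono subset_dense_nbhd[OF *]) (auto simp: sets_dense_nbhd)
      also have "\<dots> \<le> ennreal ?C * emeasure lborel {x. ennreal l < dyadic_sup E a x}"
        by (rule emeasure_dense_nbhd_le[OF \<delta>]) measurable
      finally show ?thesis by simp
    qed
    then show ?thesis
      using weak_type_imp_power_integral_le[OF p, of "dyadic_sup star a" "dyadic_sup E a" "ennreal ?C"] by simp
  qed
  moreover have "0 < ?C" using \<delta> by simp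
  ultimately show ?thesis using True unfolding dyadic_lq_def by (intro exI[of _ ?C]) simp
next
  case False
  from enn2real_pos[OF q False] have q': "0 < enn2real q" .
  have "0 < p / enn2real q" using p q' by simp
  from dyadic_sum_star_power_le[OF \<delta> this, where 'd = 'd] show ?thesis
    using False by (simp add: dyadic_lq_def epowr_epowr) blast
qed

text \<open>Cutting off the coefficients instead of the index set makes the sum over the subcubes of
  one cube a \<open>dyadic_lq\<close> over all cubes.\<close>

definition sub_fam :: "int \<Rightarrow> int ^ 'd \<Rightarrow> (int \<Rightarrow> int ^ 'd \<Rightarrow> ennreal) \<Rightarrow> int \<Rightarrow> int ^ 'd \<Rightarrow> ennreal" where
  "sub_fam K N a k n = (if cube k n \<subseteq> cube K N then a k n else 0)"

definition median :: "ennreal \<Rightarrow> real \<Rightarrow> (int \<Rightarrow> int ^ 'd \<Rightarrow> ennreal) \<Rightarrow> int \<Rightarrow> int ^ 'd \<Rightarrow> ennreal" where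
  "median q c a K N = Inf {t. emeasure lborel {x \<in> cube K N. dyadic_lq q cube (sub_fam K N a) x > t} < ennreal c * emeasure lborel (cube K N)}"

definition median_fun :: "ennreal \<Rightarrow> real \<Rightarrow> (int \<Rightarrow> int ^ 'd \<Rightarrow> ennreal) \<Rightarrow> real ^ 'd \<Rightarrow> ennreal" where
  "median_fun q c a x = (SUP (K, N). median q c a K N * indicator (cube K N) x)"

definition median_set :: "ennreal \<Rightarrow> real \<Rightarrow> (int \<Rightarrow> int ^ 'd \<Rightarrow> ennreal) \<Rightarrow> int \<Rightarrow> int ^ 'd \<Rightarrow> (real ^ 'd) set" where
  "median_set q c a K N = {x \<in> cube K N. dyadic_lq q cube (sub_fam K N a) x \<le> median q c a K N}"

lemma measurable_median_fun [measurable]: "median_fun q c a \<in> borel_measurable borel"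
  unfolding median_fun_def[abs_def] case_prod_beta by (intro borel_measurable_SUP) auto

lemma sets_median_set [measurable]:
  fixes a :: "int \<Rightarrow> int ^ 'd \<Rightarrow> ennreal"
  shows "median_set q c a K N \<in> sets borel"
proof -
  have "median_set q c a K N = cube K N \<inter> {x. dyadic_lq q cube (sub_fam K N a) x \<le> median q c a K N}"
    by (auto simp: median_set_def)
  then show ?thesis by simp
qed

lemma median_set_subset: "median_set q c a K N \<subseteq> cube K N"
  by (auto simp: median_set_def)

lemma median_le_median_fun: "x \<in> cube K N \<Longrightarrow> median q c a K N \<le> median_fun q c a x"
  unfolding median_fun_def by (rule SUP_upper2[of "(K, N)"]) auto

text \<open>Superlevel sets at levels above the median have measure at most \<open>c |Q|\<close>.
  The strict superlevel set at the median itself is the increasing union of those at levels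
  decreasing to it, so continuity from below preserves the bound, and the rest of the cube has
  measure at least \<open>(1 - c) |Q|\<close>.\<close>

lemma emeasure_median_set_ge:
  fixes N :: "int ^ 'd"
  assumes c: "0 < c" "c < 1"
  shows "ennreal ((1 - c) * (2 powi K) ^ CARD('d)) \<le> emeasure lborel (median_set q c a K N)"
proof -
  let ?G = "dyadic_lq q cube (sub_fam K N a)" and ?v = "(2 powi K) ^ CARD('d) :: real"
  define D where "D t = {x \<in> cube K N. ?G x > t}" for t
  have [measurable]: "D t \<in> sets borel" for t
  proof -
    have "D t = cube K N \<inter> {x. ?G x > t}" by (auto simp: D_def)
    then show ?thesis by simp
  qed
  define m where "m = median q c a K N"
  have v: "emeasure lborel (cube K N) = ennreal ?v" by (rule emeasure_cube)
  have m: "m = Inf {t. emeasure lborel (D t) < ennreal c * ennreal ?v}"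
    by (simp add: m_def median_def D_def v)
  have D_anti: "D t \<subseteq> D s" if "s \<le> t" for s t using that by (auto simp: D_def)
  have D_le: "emeasure lborel (D t) \<le> ennreal c * ennreal ?v" if t: "m < t" for t
  proof -
    from t obtain s where s: "s < t" "emeasure lborel (D s) < ennreal c * ennreal ?v"
      unfolding m by (auto simp: Inf_less_iff)
    have "emeasure lborel (D t) \<le> emeasure lborel (D s)"
      using s(1) by (intro emeasure_mono D_anti) auto
    with s(2) show ?thesis by simp
  qed
  have "emeasure lborel (D m) \<le> ennreal c * ennreal ?v"
  proof (cases "m = \<infinity>")
    case True
    then have "D m = {}" by (auto simp: D_def)
    then show ?thesis by simp
  next
    case False
    then obtain r where r: "m = ennreal r" "0 \<le> r" by (cases m) auto
    \<comment> \<open>These levels lie strictly above \<open>m\<close>, because the infimum itself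
      need not be admissible.\<close>
    let ?t = "\<lambda>j::nat. ennreal (r + 1 / Suc j)"
    have "D m = (\<Union>j. D (?t j))"
    proof (intro equalityI subsetI)
      fix x assume x: "x \<in> D m"
      have "\<exists>j. ?t j < ?G x"
      proof (cases "?G x")
        case (real g)
        with x r have "r < g" by (auto simp: D_def ennreal_less_iff)
        then obtain j where "inverse (real (Suc j)) < g - r"
          using reals_Archimedean[of "g - r"] by auto
        then have "r + 1 / Suc j < g" by (simp add: inverse_eq_divide)
        with real r have "?t j < ?G x" by (simp add: ennreal_less_iff del: ennreal_plus)
        then show ?thesis by blast
      qed auto
      with x show "x \<in> (\<Union>j. D (?t j))" by (auto simp: D_def)
    next
      fix x assume "x \<in> (\<Union>j. D (?t j))"
      then obtain j where "x \<in> D (?t j)" by blast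
      moreover have "m \<le> ?t j" using r by (auto intro: ennreal_leI)
      ultimately show "x \<in> D m" using D_anti by blast
    qed
    also have "emeasure lborel \<dots> = (SUP j. emeasure lborel (D (?t j)))"
    proof (rule SUP_emeasure_incseq[symmetric])
      show "incseq (\<lambda>j. D (?t j))"
        using r by (intro incseq_SucI D_anti ennreal_leI) (simp add: frac_le)
    qed auto
    also have "\<dots> \<le> ennreal c * ennreal ?v"
      using r by (intro SUP_least D_le) (simp add: ennreal_less_iff)
    finally show ?thesis .
  qed
  moreover have "ennreal ?v \<le> emeasure lborel (median_set q c a K N) + emeasure lborel (D m)"
  proof -
    have "cube K N \<subseteq> median_set q c a K N \<union> D m"
      by (auto simp: median_set_def D_def m_def)
    then have "emeasure lborel (cube K N) \<le> emeasure lborel (median_set q c a K N \<union> D m)"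
      by (intro emeasure_mono) auto
    also have "\<dots> \<le> emeasure lborel (median_set q c a K N) + emeasure lborel (D m)"
      by (rule emeasure_subadditive) auto
    finally show ?thesis by (simp add: v)
  qed
  ultimately have *: "ennreal ?v \<le> emeasure lborel (median_set q c a K N) + ennreal c * ennreal ?v"
    using add_left_mono order_trans by blast
  show ?thesis
  proof (cases "emeasure lborel (median_set q c a K N)")
    case (real e)
    with * c have "?v \<le> e + c * ?v" by (simp flip: ennreal_mult ennreal_plus)
    with real show ?thesis by (simp add: algebra_simps)
  qed simp
qed

lemma ample_median_set:
  assumes "0 < c" "c < 1"
  shows "ample (1 - c) (median_set q c a)"
  by (simp add: ample_def median_set_subset sets_median_set emeasure_median_set_ge[OF assms])

lemma median_set_nonempty:
  assumes c: "0 < c" "c < 1"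
  shows "median_set q c a K N \<noteq> {}"
proof
  assume "median_set q c a K N = {}"
  with emeasure_median_set_ge[OF c, of K q a N] c show False by simp
qed

text \<open>Of finitely many cubes containing \<open>x\<close>, the largest one has all others as subcubes.\<close>

lemma dyadic_lq_median_set_le_median_fun:
  fixes a :: "int \<Rightarrow> int ^ 'd \<Rightarrow> ennreal"
  assumes q: "0 < q"
  shows "dyadic_lq q (median_set q c a) a x \<le> median_fun q c a x"
proof (cases "q = \<infinity>")
  case True
  have "a k n \<le> median_fun q c a x" if x: "x \<in> median_set q c a k n" for k n
  proof -
    from x have xc: "x \<in> cube k n" and le: "dyadic_lq q cube (sub_fam k n a) x \<le> median q c a k n" by (auto simp: median_set_def)
    have "a k n = sub_fam k n a k n" by (simp add: sub_fam_def)
    also have "\<dots> \<le> dyadic_lq q cube (sub_fam k n a) x" using q xc by (rule le_dyadic_lq)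
    also note le
    also note median_le_median_fun[OF xc]
    finally show ?thesis .
  qed
  then show ?thesis unfolding dyadic_lq_def dyadic_sup_def using True
    by (auto intro!: SUP_least simp: indicator_def)
next
  case False
  from enn2real_pos[OF q False] have q': "0 < enn2real q" .
  let ?b = "\<lambda>k n. epowr (a k n) (enn2real q)"
  have "dyadic_sum (median_set q c a) ?b x \<le> epowr (median_fun q c a x) (enn2real q)"
    unfolding dyadic_sum_def
  \<comment> \<open>The reduction to finite \<open>F\<close> matters: infinitely many cubes
    containing \<open>x\<close> need not have a largest one.\<close>
  proof (rule nn_integral_count_space_least)
    fix F :: "(int \<times> (int ^ 'd)) set" assume F: "finite F"
    define F' where "F' = {(k, n) \<in> F. x \<in> median_set q c a k n}"
    have "finite F'" using F by (rule rev_finite_subset) (auto simp: F'_def)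
    have eq: "(\<Sum>(k, n)\<in>F. indicator (median_set q c a k n) x * ?b k n) = (\<Sum>(k, n)\<in>F'. ?b k n)"
      by (intro sum.mono_neutral_cong_right F) (auto simp: F'_def indicator_def split: if_splits)
    show "(\<Sum>(k, n)\<in>F. indicator (median_set q c a k n) x * ?b k n) \<le> epowr (median_fun q c a x) (enn2real q)"
    proof (cases "F' = {}")
      case True
      then show ?thesis unfolding eq by simp
    next
      case False': False
      have "Max (fst ` F') \<in> fst ` F'" using \<open>finite F'\<close> False' by (intro Max_in) auto
      then obtain K N where KN: "(K, N) \<in> F'" "K = Max (fst ` F')" by auto
      have KN_max: "k \<le> K" if "(k, n) \<in> F'" for k n
        using \<open>finite F'\<close> that unfolding KN(2) by (intro Max_ge) (auto simp: image_iff intro!: bexI)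
      \<comment> \<open>As \<open>x\<close> lies in the median set of the largest cube, a single
        median bounds the whole local sum at \<open>x\<close>.\<close>
      from KN have x: "x \<in> cube K N" "dyadic_lq q cube (sub_fam K N a) x \<le> median q c a K N"
        by (auto simp: F'_def median_set_def)
      have "(\<Sum>(k, n)\<in>F'. ?b k n) = (\<Sum>(k, n)\<in>F'. indicator (cube k n) x * epowr (sub_fam K N a k n) (enn2real q))"
      proof (rule sum.cong, simp, clarify)
        fix k n assume kn: "(k, n) \<in> F'"
        then have "x \<in> cube k n" by (auto simp: F'_def median_set_def)
        with cube_nested[OF this x(1) KN_max[OF kn]]
        show "?b k n = indicator (cube k n) x * epowr (sub_fam K N a k n) (enn2real q)"
          by (simp add: sub_fam_def)
      qed
      also have "\<dots> \<le> dyadic_sum cube (\<lambda>k n. epowr (sub_fam K N a k n) (enn2real q)) x"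
        unfolding dyadic_sum_def using \<open>finite F'\<close> by (rule sum_le_nn_integral_count_space)
      also have "\<dots> = epowr (dyadic_lq q cube (sub_fam K N a) x) (enn2real q)"
        using False q' by (simp add: dyadic_lq_def)
      also have "\<dots> \<le> epowr (median_fun q c a x) (enn2real q)"
        using q' by (intro epowr_mono order_trans[OF x(2) median_le_median_fun[OF x(1)]]) auto
      finally show ?thesis unfolding eq .
    qed
  qed
  from epowr_mono[OF _ this, of "1 / enn2real q"] q' False show ?thesis
    by (simp add: dyadic_lq_def)
qed

text \<open>A level below the median is not admissible in the infimum, so the local superlevel set
  occupies at least the fraction \<open>c\<close> of the cube.\<close>

lemma median_fun_superlevel_subset:
  fixes a :: "int \<Rightarrow> int ^ 'd \<Rightarrow> ennreal"
  assumes q: "0 < q" and c: "0 < c"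
  shows "{x. t < median_fun q c a x} \<subseteq> dense_nbhd {x. t < dyadic_lq q cube a x} c"
proof
  fix x assume "x \<in> {x. t < median_fun q c a x}"
  then obtain K N where KN: "t < median q c a K N * indicator (cube K N) x"
    by (auto simp: median_fun_def less_SUP_iff)
  then have x: "x \<in> cube K N" and t: "t < median q c a K N"
    by (cases "x \<in> cube K N"; simp)+
  have "ennreal c * emeasure lborel (cube K N) \<le> emeasure lborel {x \<in> cube K N. dyadic_lq q cube (sub_fam K N a) x > t}"
  proof (rule ccontr)
    assume "\<not> ?thesis"
    then have "median q c a K N \<le> t" unfolding median_def by (intro Inf_lower) (simp add: not_le)
    with t show False by simp
  qed
  also have "\<dots> \<le> emeasure lborel (cube K N \<inter> {x. t < dyadic_lq q cube a x})"
  proof (rule emeasure_mono)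
    have "dyadic_lq q cube (sub_fam K N a) y \<le> dyadic_lq q cube a y" for y
      using q by (rule dyadic_lq_mono) (auto simp: sub_fam_def)
    then show "{x \<in> cube K N. dyadic_lq q cube (sub_fam K N a) x > t} \<subseteq> cube K N \<inter> {x. t < dyadic_lq q cube a x}"
      by (auto intro: less_le_trans)
  qed auto
  finally have "ennreal (c * (2 powi K) ^ CARD('d)) \<le> emeasure lborel (cube K N \<inter> {x. t < dyadic_lq q cube a x})"
    using c by (simp add: emeasure_cube ennreal_mult)
  with x cube_subset_star[of K N] show "x \<in> dense_nbhd {x. t < dyadic_lq q cube a x} c"
    unfolding dense_nbhd_def by blast
qed

text \<open>Superlevel sets are compared at equal levels, so the weak-type bound integrates to every
  exponent \<open>p > 0\<close>.\<close>

lemma median_fun_power_le: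
  fixes a :: "int \<Rightarrow> int ^ 'd \<Rightarrow> ennreal"
  assumes p: "0 < p" and q: "0 < q" and c: "0 < c"
  shows "(\<integral>\<^sup>+x. epowr (median_fun q c a x) p \<partial>lborel) \<le> ennreal (5 ^ CARD('d) / c) * (\<integral>\<^sup>+x. epowr (dyadic_lq q cube a x) p \<partial>lborel)"
proof -
  have "emeasure lborel {x. ennreal l < median_fun q c a x} \<le> ennreal (5 ^ CARD('d) / c) * emeasure lborel {x. ennreal l < dyadic_lq q cube a x}" for l
  proof -
    have "emeasure lborel {x. ennreal l < median_fun q c a x} \<le> emeasure lborel (dense_nbhd {x. ennreal l < dyadic_lq q cube a x} c)"
      using q c by (intro emeasure_mono median_fun_superlevel_subset) (auto simp: sets_dense_nbhd)
    also have "\<dots> \<le> ennreal (5 ^ CARD('d) / c) * emeasure lborel {x. ennreal l < dyadic_lq q cube a x}"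
      by (rule emeasure_dense_nbhd_le[OF c]) measurable
    finally show ?thesis by simp
  qed
  then show ?thesis
    using weak_type_imp_power_integral_le[OF p, of "median_fun q c a" "dyadic_lq q cube a" "ennreal (5 ^ CARD('d) / c)"] by simp
qed

text \<open>Since \<open>c < 1\<close>, the median set is nonempty, and at each of its points the
  local sum is at least the coefficient of the cube itself.\<close>

lemma le_median:
  assumes q: "0 < q" and c: "0 < c" "c < 1"
  shows "a k n \<le> median q c a k n"
proof -
  obtain x where x: "x \<in> median_set q c a k n" using median_set_nonempty[OF c] by blast
  then have xc: "x \<in> cube k n" and le: "dyadic_lq q cube (sub_fam k n a) x \<le> median q c a k n" by (auto simp: median_set_def)
  have "a k n = sub_fam k n a k n" by (simp add: sub_fam_def)
  also have "\<dots> \<le> dyadic_lq q cube (sub_fam k n a) x" using q xc by (rule le_dyadic_lq)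
  also note le
  finally show ?thesis .
qed

text \<open>Cubes have positive measure, so the essential supremum sees every median; the case
  \<open>p = \<infinity>\<close> thereby becomes a supremum over cubes.\<close>

lemma esssup_median_fun: "esssup lebesgue (median_fun q c a) = (SUP (K, N). median q c a K N)"
proof (rule antisym)
  have [measurable]: "median_fun q c a \<in> borel_measurable lebesgue"
    by (intro measurable_completion) simp
  show "esssup lebesgue (median_fun q c a) \<le> (SUP (K, N). median q c a K N)"
  proof (rule esssup_I)
    show "AE x in lebesgue. median_fun q c a x \<le> (SUP (K, N). median q c a K N)"
      by (auto simp: median_fun_def case_prod_beta indicator_def intro!: AE_I2 SUP_mono')
  qed simp
  show "(SUP (K, N). median q c a K N) \<le> esssup lebesgue (median_fun q c a)"
  proof (rule SUP_least, clarify)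
    fix K and N :: "int ^ 'a"
    show "median q c a K N \<le> esssup lebesgue (median_fun q c a)"
    proof (rule ccontr)
      assume *: "\<not> ?thesis"
      have "AE x in lebesgue. x \<notin> cube K N"
        using esssup_AE[of "median_fun q c a" lebesgue]
        by eventually_elim (use * median_le_median_fun[of _ K N q c a] in \<open>auto dest: order_trans\<close>)
      then have "AE x in lborel. x \<notin> cube K N" by (simp add: AE_completion_iff)
      then have "emeasure lborel (cube K N) = 0"
        by (subst (asm) AE_iff_measurable[OF _ refl]) auto
      then show False by (simp add: emeasure_cube)
    qed
  qed
qed

text \<open>The counterpart of the good-lambda inequality for \<open>p = \<infinity>\<close>: in an
  integrated sum, \<open>|Q|\<close> may be replaced by \<open>|E(Q)| / \<delta>\<close> term by
  term, and \<open>U\<close> contains the sets that contribute.\<close>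

lemma dyadic_sum_cube_integral_le:
  fixes b :: "int \<Rightarrow> int ^ 'd \<Rightarrow> ennreal"
  assumes E: "ample \<delta> E" and [measurable]: "U \<in> sets borel" and \<delta>: "0 < \<delta>"
    and U: "\<And>k n. b k n \<noteq> 0 \<Longrightarrow> E k n \<subseteq> U"
  shows "(\<integral>\<^sup>+(k, n). b k n * ennreal ((2 powi k) ^ CARD('d)) \<partial>count_space UNIV)
    \<le> ennreal (1 / \<delta>) * (\<integral>\<^sup>+x\<in>U. dyadic_sum E b x \<partial>lborel)"
proof -
  note [measurable] = ampleD(1)[OF E] and dense = ampleD(3)[OF E]
  have "(\<integral>\<^sup>+(k, n). b k n * ennreal ((2 powi k) ^ CARD('d)) \<partial>count_space UNIV)
     \<le> (\<integral>\<^sup>+(k, n). ennreal (1 / \<delta>) * (b k n * emeasure lborel (E k n \<inter> U)) \<partial>count_space UNIV)"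
  proof (rule nn_integral_mono, clarsimp)
    fix k n
    show "b k n * ennreal ((2 powi k) ^ CARD('d)) \<le> ennreal (1 / \<delta>) * (b k n * emeasure lborel (E k n \<inter> U))"
    proof (cases "b k n = 0")
      case False
      then have EU: "E k n \<inter> U = E k n" using U by blast
      have "ennreal ((2 powi k) ^ CARD('d)) = ennreal (1 / \<delta>) * ennreal (\<delta> * (2 powi k) ^ CARD('d))"
        using \<delta> by (simp flip: ennreal_mult)
      also have "\<dots> \<le> ennreal (1 / \<delta>) * emeasure lborel (E k n)"
        by (rule mult_left_mono[OF dense]) simp
      finally have "b k n * ennreal ((2 powi k) ^ CARD('d)) \<le> b k n * (ennreal (1 / \<delta>) * emeasure lborel (E k n))"
        by (rule mult_left_mono) simp
      then show ?thesis by (simp add: EU mult_ac)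
    qed simp
  qed
  also have "\<dots> = ennreal (1 / \<delta>) * (\<integral>\<^sup>+(k, n). b k n * emeasure lborel (E k n \<inter> U) \<partial>count_space UNIV)"
    unfolding case_prod_beta by (rule nn_integral_cmult) simp
  also have "(\<integral>\<^sup>+(k, n). b k n * emeasure lborel (E k n \<inter> U) \<partial>count_space UNIV) = (\<integral>\<^sup>+x\<in>U. dyadic_sum E b x \<partial>lborel)"
    by (rule nn_integral_dyadic_sum[symmetric]) auto
  finally show ?thesis .
qed

text \<open>Chebyshev's inequality for the local sum: it exceeds each level below the median on a
  set of measure at least \<open>c |P|\<close>, and its \<open>q\<close>-th power integrates to the
  sum of \<open>a^q |Q|\<close>.\<close>

lemma median_power_le:
  fixes a :: "int \<Rightarrow> int ^ 'd \<Rightarrow> ennreal"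
  assumes q: "0 < q" "q \<noteq> \<infinity>" and c: "0 < c" 
  shows "epowr (median q c a K N) (enn2real q) * ennreal (c * (2 powi K) ^ CARD('d))
    \<le> (\<integral>\<^sup>+(k, n). epowr (sub_fam K N a k n) (enn2real q) * ennreal ((2 powi k) ^ CARD('d)) \<partial>count_space UNIV)"
    (is "_ \<le> ?R")
proof -
  let ?q = "enn2real q" and ?v = "c * (2 powi K) ^ CARD('d)"
  have q': "0 < ?q" using q by (rule enn2real_pos)
  have v: "0 < ?v" using c by simp
  have R: "?R = (\<integral>\<^sup>+x. dyadic_sum cube (\<lambda>k n. epowr (sub_fam K N a k n) ?q) x \<partial>lborel)"
    using nn_integral_dyadic_sum[of cube UNIV "\<lambda>k n. epowr (sub_fam K N a k n) ?q"] by (simp add: emeasure_cube)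
  \<comment> \<open>The bound is shown for \<open>t\<close> strictly below, where the superlevel set
    is certainly large; \<open>dense_le\<close> then passes to the limit, also for an infinite
    median.\<close>
  have *: "t * ennreal ?v \<le> ?R" if t: "t < epowr (median q c a K N) ?q" for t
  proof -
    define s where "s = epowr t (1 / ?q)"
    have ts: "t = epowr s ?q" using q' by (simp add: s_def)
    with t q' have s: "s < median q c a K N" by (simp add: epowr_less_iff)
    let ?D = "{x \<in> cube K N. dyadic_lq q cube (sub_fam K N a) x > s}"
    have "?D = cube K N \<inter> {x. dyadic_lq q cube (sub_fam K N a) x > s}" by auto
    then have [measurable]: "?D \<in> sets borel" by simp
    have D: "ennreal ?v \<le> emeasure lborel ?D"
    proof (rule ccontr)
      assume "\<not> ?thesis"
      then have "median q c a K N \<le> s" unfolding median_def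
        using c by (intro Inf_lower) (simp add: not_le emeasure_cube ennreal_mult)
      with s show False by simp
    qed
    have "t * ennreal ?v \<le> t * emeasure lborel ?D"
      by (rule mult_left_mono[OF D]) simp
    also have "\<dots> = (\<integral>\<^sup>+x. t * indicator ?D x \<partial>lborel)"
      by (simp add: nn_integral_cmult_indicator)
    also have "\<dots> \<le> ?R" unfolding R
    proof (rule nn_integral_mono)
      fix x
      show "t * indicator ?D x \<le> dyadic_sum cube (\<lambda>k n. epowr (sub_fam K N a k n) ?q) x"
      proof (cases "x \<in> ?D")
        case True
        then have "s \<le> dyadic_lq q cube (sub_fam K N a) x" by (simp add: less_imp_le)
        from epowr_mono[OF _ this, of ?q] q' q True show ?thesis by (simp add: ts dyadic_lq_def)
      qed auto
    qed
    finally show ?thesis .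
  qed
  have cancel: "z * ennreal ?v * ennreal (1 / ?v) = z" for z
    using v c by (simp add: mult.assoc ennreal_mult[symmetric])
  have "epowr (median q c a K N) ?q \<le> ?R * ennreal (1 / ?v)"
  proof (rule dense_le)
    fix t assume "t < epowr (median q c a K N) ?q"
    from mult_right_mono[OF *[OF this], of "ennreal (1 / ?v)"] show "t \<le> ?R * ennreal (1 / ?v)"
      unfolding cancel by simp
  qed
  from mult_right_mono[OF this, of "ennreal ?v"]
  have "epowr (median q c a K N) ?q * ennreal ?v \<le> ?R * ennreal (1 / ?v) * ennreal ?v" by simp
  also have "\<dots> = ?R * ennreal ?v * ennreal (1 / ?v)" by (simp only: mult_ac)
  also have "\<dots> = ?R" by (rule cancel)
  finally show ?thesis .
qed

section \<open>Abstract tent functions\<close>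


text \<open>The windows containing the \<open>T k n\<close> have endpoints of ratio 2 and are
  disjoint for different \<open>k\<close>, so each time is charged to one scale only. The bound
  \<open>1 / 4\<close> measures \<open>T k n\<close> in \<open>dt / t\<close>.\<close>

definition dominated :: "real \<Rightarrow> (int \<Rightarrow> int ^ 'd \<Rightarrow> ennreal) \<Rightarrow> (real \<Rightarrow> real ^ 'd \<Rightarrow> ennreal) \<Rightarrow>
    (int \<Rightarrow> int ^ 'd \<Rightarrow> (real ^ 'd) set) \<Rightarrow> (int \<Rightarrow> int ^ 'd \<Rightarrow> real set) \<Rightarrow> bool" where
  "dominated C a W E T \<longleftrightarrow> (\<forall>k n. T k n \<in> sets borel \<and> T k n \<subseteq> {3 / 4 * 2 powi k<..3 / 2 * 2 powi k} \<and>
      ennreal (1 / 4) \<le> (\<integral>\<^sup>+t\<in>T k n. ennreal (1 / t) \<partial>lborel) \<and>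
      (\<forall>t\<in>T k n. \<forall>x\<in>E k n. a k n \<le> ennreal C * W t x))"

text \<open>All that the comparison of norms uses about \<open>W\<close> and the coefficients.
  \<open>C\<close> and \<open>\<delta>\<close> will be uniform in \<open>f\<close>, whereas
  \<open>E\<close> and \<open>T\<close> may depend on it. The indicator discards times
  \<open>t \<le> 0\<close>, where \<open>W\<close> carries no meaning.\<close>

definition comparable :: "real \<Rightarrow> real \<Rightarrow> (int \<Rightarrow> int ^ 'd \<Rightarrow> ennreal) \<Rightarrow> (real \<Rightarrow> real ^ 'd \<Rightarrow> ennreal) \<Rightarrow> bool" where
  "comparable C \<delta> a W \<longleftrightarrow>
    (\<lambda>z. W (fst z) (snd z) * indicator {0<..} (fst z)) \<in> borel_measurable (borel \<Otimes>\<^sub>M borel) \<and>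
    (\<forall>t>0. \<forall>x. \<exists>l n. 2 powi l / 2 < t \<and> t \<le> 2 * 2 powi l \<and> x \<in> star l n \<and> W t x \<le> ennreal C * a l n) \<and>
    (\<exists>E T. ample \<delta> E \<and> dominated C a W E T)"

lemma dominatedD:
  assumes "dominated C a W E T"
  shows "T k n \<in> sets borel" "T k n \<subseteq> {3 / 4 * 2 powi k<..3 / 2 * 2 powi k}"
    "ennreal (1 / 4) \<le> (\<integral>\<^sup>+t\<in>T k n. ennreal (1 / t) \<partial>lborel)"
    "t \<in> T k n \<Longrightarrow> x \<in> E k n \<Longrightarrow> a k n \<le> ennreal C * W t x"
  using assms unfolding dominated_def by blast+

lemma dominated_pos:
  assumes "dominated C a W E T" "t \<in> T k n"
  shows "0 < t"
proof -
  have "(0::real) < 3 / 4 * 2 powi k" by simp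
  also have "\<dots> < t" using dominatedD(2)[OF assms(1), of k n] assms(2) by auto
  finally show ?thesis .
qed

definition tent_fun :: "ennreal \<Rightarrow> (real \<Rightarrow> real ^ 'd \<Rightarrow> ennreal) \<Rightarrow> real ^ 'd \<Rightarrow> ennreal" where
  "tent_fun q W x = (if q = \<infinity> then esssup (lebesgue_on {0<..}) (\<lambda>t. W t x)
     else epowr (\<integral>\<^sup>+t\<in>{0<..}. epowr (W t x) (enn2real q) * ennreal (1 / t) \<partial>lebesgue) (1 / enn2real q))"

lemma epowr_root_le:
  assumes "X \<le> ennreal K * Y" "0 \<le> K" "0 < p"
  shows "epowr X (1 / p) \<le> ennreal (K powr (1 / p)) * epowr Y (1 / p)"
  using epowr_mono[OF _ assms(1), of "1 / p"] assms(2,3) by (simp add: epowr_mult epowr_ennreal)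

lemma emeasure_lebesgue_borel: "A \<in> sets borel \<Longrightarrow> emeasure lebesgue A = emeasure lborel A"
  by simp

lemma ex_dyadic_scale:
  assumes "0 < t"
  shows "\<exists>k::int. 2 powi k / 2 < t \<and> t \<le> (2::real) powi k"
proof -
  let ?k = "\<lceil>log 2 t\<rceil>"
  have p: "(2::real) powi k = 2 powr k" for k by (simp add: powr_real_of_int')
  have "t = 2 powr log 2 t" using assms by simp
  also have "\<dots> \<le> 2 powr ?k" by (intro powr_mono) auto
  finally have "t \<le> 2 powi ?k" by (simp add: p)
  moreover have "2 powi ?k / 2 = 2 powr (?k - 1)" by (simp add: p powr_diff)
  moreover have "2 powr (?k - 1) < 2 powr log 2 t" by (intro powr_less_mono) linarith+
  ultimately show ?thesis using assms by (intro exI[of _ ?k]) auto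
qed

lemma comparable_measurable:
  assumes "comparable C \<delta> a W"
  shows "(\<lambda>z. W (fst z) (snd z) * indicator {0<..} (fst z)) \<in> borel_measurable (borel \<Otimes>\<^sub>M borel)"
  using assms by (simp add: comparable_def)

lemma comparable_measurable_section:
  assumes "comparable C \<delta> a W"
  shows "(\<lambda>t. W t x * indicator {0<..} t) \<in> borel_measurable borel"
  using measurable_compose[OF _ comparable_measurable[OF assms], of "\<lambda>t. (t, x)" borel] by simp

lemma comparable_measurable_slice:
  assumes "comparable C \<delta> a W" "0 < t"
  shows "W t \<in> borel_measurable borel"
  using measurable_compose[OF _ comparable_measurable[OF assms(1)], of "\<lambda>x. (t, x)" borel] assms(2) by simp

text \<open>The integrand is at most \<open>2 / 2^l\<close> on an interval of length
  \<open>3/2 * 2^l\<close>; this is the origin of the 3 in later constants.\<close>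

lemma nn_integral_dyadic_window_le:
  "(\<integral>\<^sup>+t\<in>{2 powi l / 2<..2 * 2 powi l}. ennreal (1 / t) \<partial>lborel) \<le> ennreal 3"
proof -
  let ?s = "2 powi l :: real"
  have s: "0 < ?s" by simp
  have "(\<integral>\<^sup>+t\<in>{?s / 2<..2 * ?s}. ennreal (1 / t) \<partial>lborel) \<le> (\<integral>\<^sup>+t. ennreal (2 / ?s) * indicator {?s / 2<..2 * ?s} t \<partial>lborel)"
  proof (rule nn_integral_mono)
    fix t
    have "1 / t \<le> 2 / ?s" if "?s / 2 < t"
      using that s less_trans[of 0 "?s/2" t] by (simp add: field_simps)
    then show "ennreal (1 / t) * indicator {?s / 2<..2 * ?s} t \<le> ennreal (2 / ?s) * indicator {?s / 2<..2 * ?s} t"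
      by (auto simp: indicator_def intro: ennreal_leI)
  qed
  also have "\<dots> = ennreal (2 / ?s) * ennreal (2 * ?s - ?s / 2)"
    by (subst nn_integral_cmult_indicator) auto
  also have "\<dots> = ennreal 3" using s by (simp add: field_simps flip: ennreal_mult)
  finally show ?thesis .
qed

lemma measurable_window_sum:
  "(\<lambda>t. \<integral>\<^sup>+p. w p * (indicator {2 powi fst p / 2<..2 * 2 powi fst p} t * ennreal (1 / t)) \<partial>count_space UNIV)
     \<in> borel_measurable borel" for w :: "int \<times> 'i::countable \<Rightarrow> ennreal"
  by (intro borel_measurable_nn_integral_count_space) measurable

lemma nn_integral_window_sum_le:
  fixes w :: "int \<times> 'i::countable \<Rightarrow> ennreal"
  shows "(\<integral>\<^sup>+t. (\<integral>\<^sup>+p. w p * (indicator {2 powi fst p / 2<..2 * 2 powi fst p} t * ennreal (1 / t)) \<partial>count_space UNIV) \<partial>lborel)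
    \<le> ennreal 3 * (\<integral>\<^sup>+p. w p \<partial>count_space UNIV)"
proof -
  let ?f = "\<lambda>p t. indicator {2 powi fst p / 2<..2 * 2 powi fst p} t * ennreal (1 / t)"
  have f: "?f p \<in> borel_measurable lborel" for p :: "int \<times> 'i" by measurable
  have "(\<integral>\<^sup>+t. (\<integral>\<^sup>+p. w p * ?f p t \<partial>count_space UNIV) \<partial>lborel) = (\<integral>\<^sup>+p. w p * (\<integral>\<^sup>+t. ?f p t \<partial>lborel) \<partial>count_space UNIV)"
    using f by (subst nn_integral_count_space_nn_integral) (auto simp: nn_integral_cmult)
  also have "\<dots> \<le> (\<integral>\<^sup>+p. ennreal 3 * w p \<partial>count_space UNIV)"
    using nn_integral_dyadic_window_le by (intro nn_integral_mono) (simp add: mult.commute mult_left_mono)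
  also have "\<dots> = ennreal 3 * (\<integral>\<^sup>+p. w p \<partial>count_space UNIV)"
    by (rule nn_integral_cmult) simp
  finally show ?thesis .
qed

text \<open>\<open>W t x\<close> is controlled by one coefficient, which is one term of the sum. The
  window indicator is kept so that integration in \<open>dt / t\<close> costs only a factor 3, and
  \<open>S\<close> records which scales can occur: all of them, or those compatible with
  \<open>t < \<tau>\<close>.\<close>

lemma comparable_pointwise:
  assumes W: "comparable C \<delta> a W" and C: "0 < C" and q: "0 < q" and t: "0 < t"
    and S: "\<And>l. 2 powi l / 2 < t \<Longrightarrow> t \<le> 2 * 2 powi l \<Longrightarrow> l \<in> S"
  shows "epowr (W t x) q * ennreal (1 / t) \<le>
    ennreal (C powr q) * dyadic_sum star (\<lambda>l n. (if l \<in> S then epowr (a l n) q else 0) *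
      (indicator {2 powi l / 2<..2 * 2 powi l} t * ennreal (1 / t))) x"
    (is "_ \<le> _ * dyadic_sum star ?b x")
proof -
  from W t obtain l n where ln: "2 powi l / 2 < t" "t \<le> 2 * 2 powi l" "x \<in> star l n" "W t x \<le> ennreal C * a l n"
    unfolding comparable_def by meson
  have "epowr (W t x) q \<le> ennreal (C powr q) * epowr (a l n) q"
    using epowr_mono[OF _ ln(4), of q] q C by (simp add: epowr_mult epowr_ennreal)
  then have "epowr (W t x) q * ennreal (1 / t) \<le> ennreal (C powr q) * (epowr (a l n) q * ennreal (1 / t))"
    by (simp add: mult_right_mono flip: mult.assoc)
  also have "epowr (a l n) q * ennreal (1 / t) = ?b l n"
    using ln S[OF ln(1,2)] by simp
  also have "\<dots> \<le> dyadic_sum star ?b x"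
    by (rule le_dyadic_sum[of x star l n ?b, OF ln(3)])
  finally show ?thesis by (simp add: mult_left_mono)
qed

lemma tent_fun_le_dyadic_lq_star:
  assumes W: "comparable C \<delta> a W" and C: "0 < C" and q: "0 < q"
  shows "tent_fun q W x \<le> ennreal (if q = \<infinity> then C else C * 3 powr (1 / enn2real q)) * dyadic_lq q star a x"
proof (cases "q = \<infinity>")
  case True
  have "(\<lambda>t. W t x) \<in> borel_measurable (lebesgue_on {0<..})"
  proof (subst measurable_cong)
    show "W t x = W t x * indicator {0<..} t" if "t \<in> space (lebesgue_on {0<..})" for t
      using that by simp
    show "(\<lambda>t. W t x * indicator {0<..} t) \<in> borel_measurable (lebesgue_on {0<..})"
      by (intro measurable_restrict_space1 measurable_completion) (simp add: comparable_measurable_section[OF W])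
  qed
  moreover have "W t x \<le> ennreal C * dyadic_sup star a x" if t: "0 < t" for t
  proof -
    from W t obtain l n where ln: "x \<in> star l n" "W t x \<le> ennreal C * a l n"
      unfolding comparable_def by meson
    note ln(2)
    also have "ennreal C * a l n \<le> ennreal C * dyadic_sup star a x"
      by (intro mult_left_mono le_dyadic_sup ln(1)) simp
    finally show ?thesis .
  qed
  ultimately have "esssup (lebesgue_on {0<..}) (\<lambda>t. W t x) \<le> ennreal C * dyadic_sup star a x"
    by (intro esssup_I) (auto intro!: AE_I2)
  then show ?thesis using True by (simp add: tent_fun_def dyadic_lq_def)
next
  case False
  let ?q = "enn2real q"
  have q': "0 < ?q" using q False by (rule enn2real_pos)
  let ?b = "\<lambda>k n. epowr (a k n) ?q"
  let ?w = "\<lambda>l t. indicator {2 powi l / 2<..2 * 2 powi l} t * ennreal (1 / t)"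
  let ?s = "\<lambda>p. indicator (star (fst p) (snd p)) x * ?b (fst p) (snd p)"
  have "(\<integral>\<^sup>+t\<in>{0<..}. epowr (W t x) ?q * ennreal (1 / t) \<partial>lborel)
    \<le> (\<integral>\<^sup>+t. ennreal (C powr ?q) * (\<integral>\<^sup>+p. ?s p * ?w (fst p) t \<partial>count_space UNIV) \<partial>lborel)"
  proof (rule nn_integral_mono)
    fix t :: real
    show "epowr (W t x) ?q * ennreal (1 / t) * indicator {0<..} t \<le>
      ennreal (C powr ?q) * (\<integral>\<^sup>+p. ?s p * ?w (fst p) t \<partial>count_space UNIV)"
      using comparable_pointwise[OF W C q', of t UNIV x]
      by (cases "0 < t") (simp_all add: dyadic_sum_def case_prod_beta' mult.assoc)
  qed
  also have "\<dots> = ennreal (C powr ?q) * (\<integral>\<^sup>+t. (\<integral>\<^sup>+p. ?s p * ?w (fst p) t \<partial>count_space UNIV) \<partial>lborel)"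
    by (rule nn_integral_cmult) (simp add: measurable_window_sum)
  also have "\<dots> \<le> ennreal (C powr ?q) * (ennreal 3 * dyadic_sum star ?b x)"
    unfolding dyadic_sum_def case_prod_beta by (intro mult_left_mono nn_integral_window_sum_le) simp
  finally have "(\<integral>\<^sup>+t\<in>{0<..}. epowr (W t x) ?q * ennreal (1 / t) \<partial>lborel) \<le> ennreal (C powr ?q * 3) * dyadic_sum star ?b x"
    by (simp add: ennreal_mult mult.assoc)
  from epowr_root_le[OF this _ q'] C show ?thesis
    using False q' by (simp add: tent_fun_def dyadic_lq_def nn_integral_completion powr_mult powr_powr)
qed

text \<open>As \<open>T k n\<close> has mass at least \<open>1 / 4\<close> in \<open>dt / t\<close>,
  a coefficient is at most 4 times its integral over \<open>T k n\<close>, where \<open>W\<close>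
  dominates it. For given \<open>x\<close> and \<open>t\<close> at most one cube contains
  \<open>x\<close> and has \<open>t\<close> in its window, so the sum of the integrals does not
  exceed the integral over \<open>J\<close>.\<close>

lemma dyadic_sum_selection_le:
  fixes a :: "int \<Rightarrow> int ^ 'd \<Rightarrow> ennreal"
  assumes W: "comparable C \<delta> a W" and C: "0 < C" and q: "0 < q"
    and sub: "\<And>k n. E k n \<subseteq> cube k n" and dom: "dominated C a W E T"
    and b: "\<And>k n. b k n \<le> epowr (a k n) q"
    and J: "J \<in> sets borel" "J \<subseteq> {0<..}" "\<And>k n. b k n \<noteq> 0 \<Longrightarrow> {3 / 4 * 2 powi k<..3 / 2 * 2 powi k} \<subseteq> J"
  shows "dyadic_sum E b x \<le> ennreal (4 * C powr q) * (\<integral>\<^sup>+t\<in>J. epowr (W t x) q * ennreal (1 / t) \<partial>lborel)"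
proof -
  note T = dominatedD(1-3)[OF dom] and le = dominatedD(4)[OF dom]
  note [measurable] = T(1) J(1) comparable_measurable_section[OF W, of x]
  let ?I = "\<lambda>k::int. {3 / 4 * 2 powi k<..3 / 2 * 2 powi k} :: real set"
  define g where "g t = epowr (W t x * indicator {0<..} t) q * (ennreal (1 / t) * indicator J t)" for t
  have [measurable]: "g \<in> borel_measurable borel" unfolding g_def by measurable
  have g_eq: "g t = epowr (W t x) q * ennreal (1 / t) * indicator J t" for t
    using J(2) by (cases "t \<in> J") (auto simp: g_def)
  have term_le: "indicator (E k n) x * b k n \<le> ennreal (4 * C powr q) * (\<integral>\<^sup>+t. indicator (cube k n) x * indicator (?I k) t * g t \<partial>lborel)" for k n
  proof (cases "x \<in> E k n \<and> b k n \<noteq> 0")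
    case True
    have "ennreal 4 * ennreal (1 / 4) = 1" by (subst ennreal_mult[symmetric]) auto
    then have "b k n = ennreal 4 * (b k n * ennreal (1 / 4))"
      by (metis mult.left_commute mult_1_right)
    also have "b k n * ennreal (1 / 4) \<le> b k n * (\<integral>\<^sup>+t\<in>T k n. ennreal (1 / t) \<partial>lborel)"
      by (intro mult_left_mono T) simp
    also have "\<dots> = (\<integral>\<^sup>+t. b k n * (ennreal (1 / t) * indicator (T k n) t) \<partial>lborel)"
      by (rule nn_integral_cmult[symmetric]) measurable
    also have "\<dots> \<le> (\<integral>\<^sup>+t. ennreal (C powr q) * (indicator (cube k n) x * indicator (?I k) t * g t) \<partial>lborel)"
    proof (rule nn_integral_mono)
      fix t
      show "b k n * (ennreal (1 / t) * indicator (T k n) t) \<le> ennreal (C powr q) * (indicator (cube k n) x * indicator (?I k) t * g t)"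
      proof (cases "t \<in> T k n")
        case t: True
        with T(2)[of k n] have tI: "t \<in> ?I k" by blast
        with J(3)[of k n] True have "t \<in> J" by blast
        have "b k n \<le> epowr (ennreal C * W t x) q"
          using le[OF t, of x] True q by (intro order_trans[OF b] epowr_mono) auto
        also have "\<dots> = ennreal (C powr q) * epowr (W t x) q" using C by (simp add: epowr_mult epowr_ennreal)
        finally have "b k n * ennreal (1 / t) \<le> ennreal (C powr q) * epowr (W t x) q * ennreal (1 / t)"
          by (rule mult_right_mono) simp
        moreover have "indicator (cube k n) x = (1 :: ennreal)" "indicator (?I k) t = (1 :: ennreal)"
          using True sub[of k n] tI by auto
        ultimately show ?thesis using t \<open>t \<in> J\<close> by (simp only: g_eq) (simp add: mult.assoc)
      qed simp
    qed
    also have "\<dots> = ennreal (C powr q) * (\<integral>\<^sup>+t. indicator (cube k n) x * indicator (?I k) t * g t \<partial>lborel)"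
      by (rule nn_integral_cmult) measurable
    finally have "b k n \<le> ennreal 4 * (ennreal (C powr q) * (\<integral>\<^sup>+t. indicator (cube k n) x * indicator (?I k) t * g t \<partial>lborel))"
      by (simp add: mult_left_mono)
    then show ?thesis using True by (simp add: ennreal_mult mult.assoc)
  qed auto
  have "dyadic_sum E b x \<le> (\<integral>\<^sup>+p. ennreal (4 * C powr q) * (\<integral>\<^sup>+t. indicator (cube (fst p) (snd p)) x * indicator (?I (fst p)) t * g t \<partial>lborel) \<partial>count_space UNIV)"
    unfolding dyadic_sum_def case_prod_beta by (intro nn_integral_mono term_le)
  also have "\<dots> = ennreal (4 * C powr q) * (\<integral>\<^sup>+p. (\<integral>\<^sup>+t. indicator (cube (fst p) (snd p)) x * indicator (?I (fst p)) t * g t \<partial>lborel) \<partial>count_space UNIV)"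
    by (rule nn_integral_cmult) simp
  also have "(\<integral>\<^sup>+p. (\<integral>\<^sup>+t. indicator (cube (fst p) (snd p)) x * indicator (?I (fst p)) t * g t \<partial>lborel) \<partial>count_space UNIV)
     = (\<integral>\<^sup>+t. (\<integral>\<^sup>+p. indicator (cube (fst p) (snd p)) x * indicator (?I (fst p)) t * g t \<partial>count_space UNIV) \<partial>lborel)"
    by (intro nn_integral_count_space_nn_integral[symmetric]) auto
  also have "\<dots> \<le> (\<integral>\<^sup>+t. g t \<partial>lborel)"
  proof (rule nn_integral_mono)
    fix t
    \<comment> \<open>Windows of different scales are disjoint, since
      \<open>3 / 2 * 2^k = 3 / 4 * 2^(k + 1)\<close>.\<close>
    have uniq: "k = k'" if "t \<in> ?I k" "t \<in> ?I k'" for k k'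
    proof -
      have "k \<le> k'" if "t \<in> ?I k" "t \<in> ?I k'" for k k'
      proof (rule ccontr)
        assume "\<not> k \<le> k'"
        then have "(2::real) powi (k' + 1) \<le> 2 powi k" by (intro power_int_increasing) auto
        then have "2 * (2::real) powi k' \<le> 2 powi k" by (simp add: power_int_add)
        with that show False by auto
      qed
      with that show ?thesis by (metis order_antisym)
    qed
    show "(\<integral>\<^sup>+p. indicator (cube (fst p) (snd p)) x * indicator (?I (fst p)) t * g t \<partial>count_space UNIV) \<le> g t"
    proof (cases "\<exists>k n. x \<in> cube k n \<and> t \<in> ?I k")
      case True
      then obtain k n where kn: "x \<in> cube k n" "t \<in> ?I k" by blast
      have "(\<integral>\<^sup>+p. indicator (cube (fst p) (snd p)) x * indicator (?I (fst p)) t * g t \<partial>count_space UNIV)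
        = (\<Sum>p\<in>{(k, n)}. indicator (cube (fst p) (snd p)) x * indicator (?I (fst p)) t * g t)"
      proof (rule nn_integral_count_space')
        fix p :: "int \<times> (int ^ 'd)" assume p: "p \<notin> {(k, n)}"
        have "\<not> (x \<in> cube (fst p) (snd p) \<and> t \<in> ?I (fst p))"
        proof
          assume *: "x \<in> cube (fst p) (snd p) \<and> t \<in> ?I (fst p)"
          then have "fst p = k" using uniq kn(2) by blast
          with * kn(1) p show False by (cases p) (auto simp: cube_def)
        qed
        then show "indicator (cube (fst p) (snd p)) x * indicator (?I (fst p)) t * g t = 0"
          by (auto simp: indicator_def)
      qed auto
      also have "\<dots> = g t" using kn by simp
      finally show ?thesis by simp
    next
      case False
      then have "indicator (cube (fst p) (snd p)) x * indicator (?I (fst p)) t * g t = 0" for p :: "int \<times> (int ^ 'd)"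
        by (auto simp: indicator_def)
      then show ?thesis by (simp only: nn_integral_const) simp
    qed
  qed
  finally show ?thesis by (simp add: g_eq mult_left_mono)
qed

lemma dyadic_lq_selection_le_tent_fun:
  fixes a :: "int \<Rightarrow> int ^ 'd \<Rightarrow> ennreal"
  assumes W: "comparable C \<delta> a W" and C: "0 < C" and q: "0 < q"
    and sub: "\<And>k n. E k n \<subseteq> cube k n" and dom: "dominated C a W E T"
  shows "dyadic_lq q E a x \<le> ennreal (if q = \<infinity> then C else C * 4 powr (1 / enn2real q)) * tent_fun q W x"
proof (cases "q = \<infinity>")
  case True
  note T = dominatedD(1-3)[OF dom] and le = dominatedD(4)[OF dom]
  let ?A = "esssup (lebesgue_on {0<..}) (\<lambda>t. W t x)"
  have "a k n \<le> ennreal C * ?A" if x: "x \<in> E k n" for k n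
  proof -
    \<comment> \<open>\<open>T k n\<close> is not a null set, so some time in it obeys the almost
      everywhere bound by the essential supremum.\<close>
    have "\<exists>t\<in>T k n. W t x \<le> ?A"
    proof (rule ccontr)
      assume *: "\<not> (\<exists>t\<in>T k n. W t x \<le> ?A)"
      have "AE t in lebesgue_on {0<..}. W t x \<le> ?A" by (rule esssup_AE)
      then have "AE t in lebesgue. 0 < t \<longrightarrow> W t x \<le> ?A" by (simp add: AE_restrict_space_iff)
      then have "AE t in lebesgue. t \<notin> T k n"
      proof eventually_elim
        case (elim t)
        with * show ?case using dominated_pos[OF dom] by blast
      qed
      then have "AE t in lborel. t \<notin> T k n" by (simp add: AE_completion_iff)
      then have "AE t in lborel. ennreal (1 / t) * indicator (T k n) t = 0"
        by eventually_elim simp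
      then have "(\<integral>\<^sup>+t\<in>T k n. ennreal (1 / t) \<partial>lborel) = (\<integral>\<^sup>+t. 0 \<partial>(lborel :: real measure))"
        by (rule nn_integral_cong_AE)
      with T(3)[of k n] show False by simp
    qed
    then obtain t where t: "t \<in> T k n" "W t x \<le> ?A" by blast
    have "a k n \<le> ennreal C * W t x" by (rule le[OF t(1) x])
    also have "\<dots> \<le> ennreal C * ?A" by (intro mult_left_mono t(2)) simp
    finally show ?thesis .
  qed
  then have "dyadic_sup E a x \<le> ennreal C * ?A"
    unfolding dyadic_sup_def by (auto intro!: SUP_least simp: indicator_def)
  then show ?thesis using True by (simp add: dyadic_lq_def tent_fun_def)
next
  case False
  let ?q = "enn2real q"
  have q': "0 < ?q" using q False by (rule enn2real_pos)
  have "dyadic_sum E (\<lambda>k n. epowr (a k n) ?q) x \<le> ennreal (4 * C powr ?q) * (\<integral>\<^sup>+t\<in>{0<..}. epowr (W t x) ?q * ennreal (1 / t) \<partial>lborel)"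
    by (rule dyadic_sum_selection_le[OF W C q' sub dom]) (auto intro: less_trans[rotated])
  from epowr_root_le[OF this _ q'] C show ?thesis
    using False q' by (simp add: tent_fun_def dyadic_lq_def nn_integral_completion powr_mult powr_powr mult.commute)
qed

section \<open>Abstract tent norms\<close>


text \<open>The tent norm as a function of the averages alone, so that the comparison can be stated
  for abstract \<open>W\<close> and \<open>a\<close>.\<close>

definition scale_tent_norm :: "ennreal \<Rightarrow> ennreal \<Rightarrow> (real \<Rightarrow> real ^ 'd \<Rightarrow> ennreal) \<Rightarrow> ennreal" where
  "scale_tent_norm p q W =
     (if p \<noteq> \<infinity> then Lp_norm lebesgue p (tent_fun q W)
      else if q \<noteq> \<infinity> then
        (SUP \<tau>\<in>{0<..}. SUP y.
          epowr (\<integral>\<^sup>+t\<in>{0<..<\<tau>}. mean_integral (ball y \<tau>) (\<lambda>x. epowr (W t x) (enn2real q))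
                   * ennreal (1 / t) \<partial>lebesgue) (1 / enn2real q))
      else (SUP t\<in>{0<..}. SUP x. W t x))"

definition norms_equivalent :: "real \<Rightarrow> ennreal \<Rightarrow> ennreal \<Rightarrow> bool" where
  "norms_equivalent K x y \<longleftrightarrow> x \<le> ennreal K * y \<and> y \<le> ennreal K * x"

lemma norms_equivalentI:
  assumes "x \<le> ennreal K1 * y" "y \<le> ennreal K2 * x" 
  shows "norms_equivalent (max K1 K2) x y"
proof -
  have "ennreal K1 * y \<le> ennreal (max K1 K2) * y" "ennreal K2 * x \<le> ennreal (max K1 K2) * x"
    by (intro mult_right_mono ennreal_leI; simp)+
  with assms show ?thesis unfolding norms_equivalent_def by (blast intro: order_trans)
qed

text \<open>One chain in each direction: from \<open>W\<close> to the star sum, the sum over median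
  sets and \<open>median_fun\<close>; and from \<open>median_fun\<close> to the cube sum, the star
  sum, the sum over \<open>E\<close> and \<open>W\<close>. The passage from stars to smaller sets is
  made with \<open>1 - c\<close> in the first chain and with \<open>\<delta>\<close> in the
  second.\<close>

lemma scale_tent_norm_equiv_finite:
  assumes p: "0 < p" "p \<noteq> \<infinity>" and q: "0 < q" and c: "0 < c" "c < 1" and C: "0 < C" and \<delta>: "0 < \<delta>"
  shows "\<exists>K>0. \<forall>(a :: int \<Rightarrow> int ^ 'd \<Rightarrow> ennreal) W. comparable C \<delta> a W \<longrightarrow>
    norms_equivalent K (scale_tent_norm p q W) (Lp_norm lebesgue p (median_fun q c a))"
proof -
  let ?p = "enn2real p"
  have p': "0 < ?p" using p by (rule enn2real_pos)
  define Ku where "Ku = (if q = \<infinity> then C else C * 3 powr (1 / enn2real q))"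
  define Kl where "Kl = (if q = \<infinity> then C else C * 4 powr (1 / enn2real q))"
  have Ku: "0 < Ku" and Kl: "0 < Kl" using C by (auto simp: Ku_def Kl_def)
  have "0 < 1 - c" using c by simp
  from dyadic_lq_star_power_le[OF p' q this, where 'd = 'd] obtain C1 where C1: "0 < C1"
    "\<And>(a :: int \<Rightarrow> int ^ 'd \<Rightarrow> ennreal) E. ample (1 - c) E \<Longrightarrow>
    (\<integral>\<^sup>+x. epowr (dyadic_lq q star a x) ?p \<partial>lborel) \<le> ennreal C1 * (\<integral>\<^sup>+x. epowr (dyadic_lq q E a x) ?p \<partial>lborel)"
    by blast
  from dyadic_lq_star_power_le[OF p' q \<delta>, where 'd = 'd] obtain C2 where C2: "0 < C2"
    "\<And>(a :: int \<Rightarrow> int ^ 'd \<Rightarrow> ennreal) E. ample \<delta> E \<Longrightarrow>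
    (\<integral>\<^sup>+x. epowr (dyadic_lq q star a x) ?p \<partial>lborel) \<le> ennreal C2 * (\<integral>\<^sup>+x. epowr (dyadic_lq q E a x) ?p \<partial>lborel)"
    by blast
  define A1 where "A1 = Ku powr ?p * C1"
  define A2 where "A2 = 5 ^ CARD('d) / c * C2 * Kl powr ?p"
  have A: "0 < A1" "0 < A2" using Ku Kl C1(1) C2(1) c by (simp_all add: A1_def A2_def)
  have "norms_equivalent (max (A1 powr (1 / ?p)) (A2 powr (1 / ?p))) (scale_tent_norm p q W) (Lp_norm lebesgue p (median_fun q c a))"
    if W: "comparable C \<delta> a W" for a :: "int \<Rightarrow> int ^ 'd \<Rightarrow> ennreal" and W
  proof -
    let ?T = "\<integral>\<^sup>+x. epowr (tent_fun q W x) ?p \<partial>lborel"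
    let ?M = "\<integral>\<^sup>+x. epowr (median_fun q c a x) ?p \<partial>lborel"
    let ?S = "\<integral>\<^sup>+x. epowr (dyadic_lq q star a x) ?p \<partial>lborel"
    have "?T \<le> (\<integral>\<^sup>+x. ennreal (Ku powr ?p) * epowr (dyadic_lq q star a x) ?p \<partial>lborel)"
    proof (rule nn_integral_mono)
      fix x
      have "tent_fun q W x \<le> ennreal Ku * dyadic_lq q star a x"
        unfolding Ku_def by (rule tent_fun_le_dyadic_lq_star[OF W C q])
      from epowr_mono[OF _ this, of ?p] p' Ku
      show "epowr (tent_fun q W x) ?p \<le> ennreal (Ku powr ?p) * epowr (dyadic_lq q star a x) ?p"
        by (simp add: epowr_mult epowr_ennreal)
    qed
    also have "\<dots> = ennreal (Ku powr ?p) * ?S"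
      by (rule nn_integral_cmult) simp
    also have "?S \<le> ennreal C1 * (\<integral>\<^sup>+x. epowr (dyadic_lq q (median_set q c a) a x) ?p \<partial>lborel)"
      by (rule C1(2)[OF ample_median_set[OF c]])
    also have "(\<integral>\<^sup>+x. epowr (dyadic_lq q (median_set q c a) a x) ?p \<partial>lborel) \<le> ?M"
      using p' by (intro nn_integral_mono epowr_mono dyadic_lq_median_set_le_median_fun[OF q]) simp
    finally have 1: "?T \<le> ennreal A1 * ?M"
      using Ku C1(1) by (simp add: A1_def ennreal_mult mult.assoc mult_left_mono)
    obtain E T where E: "ample \<delta> E" and dom: "dominated C a W E T"
      using W unfolding comparable_def by blast
    have lqE: "dyadic_lq q E a x \<le> ennreal Kl * tent_fun q W x" for x
      unfolding Kl_def by (rule dyadic_lq_selection_le_tent_fun[OF W C q ampleD(2)[OF E] dom])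
    have "?M \<le> ennreal (5 ^ CARD('d) / c) * (\<integral>\<^sup>+x. epowr (dyadic_lq q cube a x) ?p \<partial>lborel)"
      by (rule median_fun_power_le[OF p' q c(1)])
    also have "(\<integral>\<^sup>+x. epowr (dyadic_lq q cube a x) ?p \<partial>lborel) \<le> ?S"
      using p' by (intro nn_integral_mono epowr_mono dyadic_lq_mono[OF q] cube_subset_star) auto
    also have "?S \<le> ennreal C2 * (\<integral>\<^sup>+x. epowr (dyadic_lq q E a x) ?p \<partial>lborel)"
      by (rule C2(2)[OF E])
    \<comment> \<open>The constant is moved into the integral of the Borel function
      \<open>dyadic_lq q E a\<close>; then monotonicity alone leads to
      \<open>tent_fun\<close>.\<close>
    also have "(\<integral>\<^sup>+x. epowr (dyadic_lq q E a x) ?p \<partial>lborel) = ennreal (Kl powr ?p) * (\<integral>\<^sup>+x. epowr (ennreal (1 / Kl) * dyadic_lq q E a x) ?p \<partial>lborel)"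
    proof -
      have "dyadic_lq q E a \<in> borel_measurable lborel"
        using measurable_dyadic_lq[OF ampleD(1)[OF E]] by simp
      from power_integral_scale[OF Kl this, of ?p] Kl show ?thesis
        by (simp add: mult.assoc[symmetric] flip: ennreal_mult powr_add)
    qed
    also have "(\<integral>\<^sup>+x. epowr (ennreal (1 / Kl) * dyadic_lq q E a x) ?p \<partial>lborel) \<le> ?T"
    proof (intro nn_integral_mono epowr_mono)
      fix x
      have "ennreal (1 / Kl) * ennreal Kl = 1" using Kl by (simp flip: ennreal_mult)
      then show "ennreal (1 / Kl) * dyadic_lq q E a x \<le> tent_fun q W x"
        using mult_left_mono[OF lqE, of "ennreal (1 / Kl)" x] by (simp add: mult.assoc[symmetric])
    qed (use p' in auto)
    finally have 2: "?M \<le> ennreal (5 ^ CARD('d) / c) * (ennreal C2 * (ennreal (Kl powr ?p) * ?T))"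
      by (simp add: mult_left_mono)
    have "ennreal A2 = ennreal (5 ^ CARD('d) / c) * (ennreal C2 * ennreal (Kl powr ?p))"
      using Kl C2(1) c by (simp add: A2_def mult.assoc flip: ennreal_mult)
    with 2 have 2: "?M \<le> ennreal A2 * ?T" by (simp only: mult.assoc)
    show ?thesis
      using epowr_root_le[OF 1 _ p'] epowr_root_le[OF 2 _ p'] A p
      by (intro norms_equivalentI) (simp_all add: scale_tent_norm_def Lp_norm_def nn_integral_completion)
  qed
  then show ?thesis using A
    by (intro exI[of _ "max (A1 powr (1 / ?p)) (A2 powr (1 / ?p))"]) (auto simp: less_max_iff_disj)
qed

text \<open>Both sides are compared with the supremum of all coefficients: \<open>le_median\<close>
  bounds it by the medians, and it is bounded by \<open>W\<close> because the sets
  \<open>T k n\<close> and \<open>E k n\<close> are nonempty.\<close>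

lemma scale_tent_norm_equiv_infinite_infinite:
  assumes c: "0 < c" "c < 1" and C: "0 < C" and \<delta>: "0 < \<delta>" and W: "comparable C \<delta> a W"
  shows "norms_equivalent C (scale_tent_norm \<infinity> \<infinity> W) (Lp_norm lebesgue \<infinity> (median_fun \<infinity> c (a :: int \<Rightarrow> int ^ 'd \<Rightarrow> ennreal)))"
proof -
  let ?M = "SUP (K, N). median \<infinity> c a K N"
  let ?W = "SUP t\<in>{0<..}. SUP x. W t x"
  have a_le: "a k n \<le> ?M" for k n
    by (rule order_trans[OF le_median[OF _ c, of \<infinity>]]) (auto intro!: SUP_upper2[of "(k, n)"])
  have "?W \<le> ennreal C * ?M"
  proof (intro SUP_least)
    fix t :: real and x assume "t \<in> {0<..}"
    with W obtain l n where ln: "W t x \<le> ennreal C * a l n"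
      unfolding comparable_def by (metis greaterThan_iff)
    also have "\<dots> \<le> ennreal C * ?M" by (intro mult_left_mono a_le) simp
    finally show "W t x \<le> ennreal C * ?M" .
  qed
  moreover have "?M \<le> ennreal C * ?W"
  proof (rule SUP_least, clarify)
    fix K and N :: "int ^ 'd"
    obtain E T where E: "ample \<delta> E" and dom: "dominated C a W E T"
      using W unfolding comparable_def by blast
    have le: "a k n \<le> ennreal C * ?W" for k n
    proof -
      have "E k n \<noteq> {}" using ampleD(3)[OF E, of k n] \<delta> by auto
      moreover have "T k n \<noteq> {}" using dominatedD(3)[OF dom, of k n] by auto
      ultimately obtain t x where tx: "t \<in> T k n" "x \<in> E k n" by auto
      have "0 < t" by (rule dominated_pos[OF dom tx(1)])
      have "a k n \<le> ennreal C * W t x" by (rule dominatedD(4)[OF dom tx])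
      also have "\<dots> \<le> ennreal C * ?W"
        using \<open>0 < t\<close> by (intro mult_left_mono SUP_upper2[of t] SUP_upper) auto
      finally show ?thesis .
    qed
    \<comment> \<open>An empty superlevel set has measure less than \<open>c |P|\<close>, so this
      level is admissible in the infimum.\<close>
    have empty: "{x \<in> cube K N. dyadic_lq \<infinity> cube (sub_fam K N a) x > ennreal C * ?W} = {}"
    proof -
      have "dyadic_lq \<infinity> cube (sub_fam K N a) x \<le> ennreal C * ?W" for x
        unfolding dyadic_lq_def dyadic_sup_def using le by (auto intro!: SUP_least simp: sub_fam_def indicator_def)
      then show ?thesis by (auto simp: not_less)
    qed
    have "emeasure lborel {x \<in> cube K N. dyadic_lq \<infinity> cube (sub_fam K N a) x > ennreal C * ?W} < ennreal c * emeasure lborel (cube K N)"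
      unfolding empty using c by (simp add: emeasure_cube ennreal_zero_less_mult_iff)
    then show "median \<infinity> c a K N \<le> ennreal C * ?W"
      unfolding median_def by (intro Inf_lower) blast
  qed
  ultimately show ?thesis
    by (simp add: norms_equivalent_def scale_tent_norm_def Lp_norm_def esssup_median_fun)
qed

section \<open>Balls and cubes for \<open>p = \<infinity>\<close> and finite
  \<open>q\<close>\<close>

lemma mean_integral_ball:
  assumes "0 < \<tau>"
  shows "mean_integral (ball (y :: real ^ 'd) \<tau>) g =
    (\<integral>\<^sup>+x\<in>ball y \<tau>. g x \<partial>lborel) * ennreal (1 / (unit_ball_vol CARD('d) * \<tau> ^ CARD('d)))"
proof -
  have "0 < unit_ball_vol CARD('d) * \<tau> ^ CARD('d)" using assms by simp
  moreover have "emeasure lebesgue (ball y \<tau>) = ennreal (unit_ball_vol CARD('d) * \<tau> ^ CARD('d))"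
    using assms by (simp add: emeasure_ball)
  ultimately show ?thesis
    by (simp add: mean_integral_def nn_integral_completion divide_ennreal_def inverse_ennreal inverse_eq_divide)
qed

lemma cube_subset_imp_le:
  assumes "cube k (n :: int ^ 'd) \<subseteq> cube K N"
  shows "k \<le> K"
proof (rule ccontr)
  assume "\<not> k \<le> K"
  then have "(2::real) powi K < 2 powi k" by (intro power_int_strict_increasing) auto
  moreover have "emeasure lborel (cube k n) \<le> emeasure lborel (cube K N)"
    using assms by (intro emeasure_mono) auto
  ultimately show False by (simp add: emeasure_cube)
qed

text \<open>The sum norm bounds the distance by \<open>d\<close> times the side; the further factor
  2 makes the inequality strict, as open balls require.\<close>

lemma cube_dist_less:
  assumes "x \<in> cube k n" "y \<in> cube k (n :: int ^ 'd)"
  shows "dist x y < 2 * CARD('d) * 2 powi k"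
proof -
  have s: "(0::real) < 2 powi k" by simp
  have "\<bar>(x - y) $ i\<bar> \<le> 2 powi k" for i
  proof -
    have "2 powi k * real_of_int (n $ i) \<le> x $ i" "x $ i < 2 powi k * (real_of_int (n $ i) + 1)"
      "2 powi k * real_of_int (n $ i) \<le> y $ i" "y $ i < 2 powi k * (real_of_int (n $ i) + 1)"
      using assms by (auto simp: cube_altdef)
    then show ?thesis by (simp add: algebra_simps abs_le_iff)
  qed
  then have "(\<Sum>i\<in>UNIV. \<bar>(x - y) $ i\<bar>) \<le> of_nat CARD('d) * 2 powi k"
    by (intro sum_bounded_above) auto
  then have "dist x y \<le> CARD('d) * 2 powi k"
    using norm_le_l1_cart[of "x - y"] by (simp add: dist_norm)
  also have "\<dots> < 2 * CARD('d) * 2 powi k" using s by simp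
  finally show ?thesis .
qed

text \<open>Quotients at distance less than 2 have floors at distance at most 2; the radius of two
  side lengths and the 2 in \<open>near\<close> belong together.\<close>

lemma near_of_dist_less:
  assumes "dist x y < 2 * 2 powi k"
  shows "near (grid_index k x) (grid_index k y)"
proof -
  have "\<bar>grid_index k x $ i - grid_index k y $ i\<bar> \<le> 2" for i
  proof -
    have "\<bar>x $ i - y $ i\<bar> < 2 * 2 powi k"
      using component_le_norm_cart[of "x - y" i] assms by (simp add: dist_norm)
    then have "\<bar>x $ i / 2 powi k - y $ i / 2 powi k\<bar> < 2"
      by (simp add: abs_mult divide_less_eq flip: diff_divide_distrib)
    then show ?thesis by (simp add: grid_index_def) linarith
  qed
  then show ?thesis by (simp add: near_def)
qed

text \<open>A ball of radius \<open>\<tau> \<approx> 2^K\<close> sees only cubes of scale at most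
  \<open>K\<close>, all inside a union \<open>U\<close> of boundedly many cubes of scale
  \<open>K\<close>. There the sum over median sets is at most the \<open>q\<close>-th power of the
  supremum of the medians. In \<open>K1\<close>, 3 comes from the windows, \<open>5^d\<close> from
  star against cube, \<open>25^d\<close> from \<open>U\<close>, \<open>2^d\<close> from
  \<open>2^K < 2 * \<tau>\<close>, and \<open>1 - c\<close> from the median sets.\<close>

lemma scale_tent_norm_equiv_infinite_finite_le:
  fixes a :: "int \<Rightarrow> int ^ 'd \<Rightarrow> ennreal"
  assumes q: "0 < q" "q \<noteq> \<infinity>" and c: "0 < c" "c < 1" and C: "0 < C" and W: "comparable C \<delta> a W"
    and K1: "K1 = 3 * C powr enn2real q * 5 ^ CARD('d) * 25 ^ CARD('d) * 2 ^ CARD('d) / ((1 - c) * unit_ball_vol CARD('d))"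
  shows "scale_tent_norm \<infinity> q W \<le> ennreal (K1 powr (1 / enn2real q)) * (SUP (K, N). median q c a K N)"
proof -
  let ?q = "enn2real q"
  have q': "0 < ?q" using q by (rule enn2real_pos)
  let ?M = "SUP (K, N). median q c a K N"
  let ?vol = "\<lambda>k::int. ((2::real) powi k) ^ CARD('d)"
  have K1_nonneg: "0 \<le> K1" using c by (simp add: K1)
  have "(\<integral>\<^sup>+t\<in>{0<..<\<tau>}. mean_integral (ball y \<tau>) (\<lambda>x. epowr (W t x) ?q) * ennreal (1 / t) \<partial>lborel) \<le> ennreal K1 * epowr ?M ?q"
    if \<tau>: "0 < \<tau>" for \<tau> and y :: "real ^ 'd"
  proof -
    obtain K :: int where K: "2 powi K / 2 < \<tau>" "\<tau> \<le> 2 powi K" using ex_dyadic_scale[OF \<tau>] by blast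
    let ?B = "unit_ball_vol CARD('d) * \<tau> ^ CARD('d)"
    have B: "0 < ?B" using \<tau> by simp
    \<comment> \<open>These are the scales whose windows can contain a time
      \<open>t < \<tau>\<close>; all of them are at most \<open>K\<close>.\<close>
    define S where "S = {l::int. 2 powi l / 2 < \<tau>}"
    have S_le: "l \<le> K" if "l \<in> S" for l
    proof (rule ccontr)
      assume "\<not> l \<le> K"
      then have "(2::real) powi (K + 1) \<le> 2 powi l" by (intro power_int_increasing) auto
      with that K show False by (simp add: S_def power_int_add)
    qed
    let ?b = "\<lambda>l n. if l \<in> S then epowr (a l n) ?q else 0"
    \<comment> \<open>Cubes whose star misses the ball are dropped, so that the remaining ones lie
      in \<open>U\<close>.\<close>
    define b' where "b' l n = (if star l n \<inter> ball y \<tau> \<noteq> {} then ?b l n else 0)" for l n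
    let ?w = "\<lambda>l t. indicator {2 powi l / 2<..2 * 2 powi l} t * ennreal (1 / t)"
    let ?m = "\<lambda>l n. emeasure lborel (star l n \<inter> ball y \<tau>)"
    let ?s = "\<lambda>p. ?b (fst p) (snd p) * ?m (fst p) (snd p)"
    let ?k = "ennreal (1 / ?B) * ennreal (C powr ?q)"
    define U where "U = (\<Union>n\<in>{n. near n (grid_index K y)}. star K n)"
    have [measurable]: "U \<in> sets borel" unfolding U_def by (intro sets.countable_UN'') auto
    have U_le: "emeasure lborel U \<le> ennreal (25 ^ CARD('d) * ?vol K)"
    proof -
      have "emeasure lborel U \<le> ennreal (5 ^ CARD('d)) * emeasure lborel (star K (grid_index K y))"
        unfolding U_def star_eq_UN[of K "grid_index K y"] by (rule emeasure_star_nbhd_le)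
      also have "\<dots> \<le> ennreal (5 ^ CARD('d)) * ennreal (5 ^ CARD('d) * ?vol K)"
        by (intro mult_left_mono emeasure_star_le) simp
      also have "\<dots> = ennreal (25 ^ CARD('d) * ?vol K)"
      proof -
        have "(25::real) ^ CARD('d) = 5 ^ CARD('d) * 5 ^ CARD('d)" by (simp flip: power_mult_distrib)
        then show ?thesis by (simp add: mult.assoc flip: ennreal_mult)
      qed
      finally show ?thesis .
    qed
    have cube_U: "cube l n \<subseteq> U" if "b' l n \<noteq> 0" for l n
    proof
      fix z assume z: "z \<in> cube l n"
      from that obtain x where x: "x \<in> star l n" "dist y x < \<tau>" and l: "l \<in> S"
        by (auto simp: b'_def split: if_splits)
      have "near (grid_index l z) (grid_index l x)"
        using z x(1) by (simp add: star_def cube_def near_commute)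
      then have "near (grid_index K z) (grid_index K x)"
        by (rule near_grid_index_mono[OF S_le[OF l]])
      moreover have "near (grid_index K x) (grid_index K y)"
        by (rule near_of_dist_less) (use x(2) K(2) \<tau> dist_commute[of x y] in linarith)
      ultimately show "z \<in> U" by (auto simp: U_def star_def)
    qed
    have "(\<integral>\<^sup>+t\<in>{0<..<\<tau>}. mean_integral (ball y \<tau>) (\<lambda>x. epowr (W t x) ?q) * ennreal (1 / t) \<partial>lborel)
      \<le> (\<integral>\<^sup>+t. ?k * (\<integral>\<^sup>+p. ?s p * ?w (fst p) t \<partial>count_space UNIV) \<partial>lborel)"
    proof (rule nn_integral_mono)
      fix t :: real
      show "mean_integral (ball y \<tau>) (\<lambda>x. epowr (W t x) ?q) * ennreal (1 / t) * indicator {0<..<\<tau>} t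
         \<le> ?k * (\<integral>\<^sup>+p. ?s p * ?w (fst p) t \<partial>count_space UNIV)"
      proof (cases "t \<in> {0<..<\<tau>}")
        case True
        then have t: "0 < t" "t < \<tau>" by auto
        have [measurable]: "ball y \<tau> \<in> sets borel" by simp
        have [measurable]: "W t \<in> borel_measurable borel"
          by (rule comparable_measurable_slice[OF W t(1)])
        let ?S = "dyadic_sum star (\<lambda>l n. ?b l n * ?w l t)"
        have "mean_integral (ball y \<tau>) (\<lambda>x. epowr (W t x) ?q) * ennreal (1 / t) * indicator {0<..<\<tau>} t
          = (ennreal (1 / ?B) * ennreal (1 / t)) * (\<integral>\<^sup>+x. epowr (W t x) ?q * indicator (ball y \<tau>) x \<partial>lborel)"
          unfolding mean_integral_ball[OF \<tau>] using True by (simp add: mult_ac)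
        also have "\<dots> = (\<integral>\<^sup>+x. (ennreal (1 / ?B) * ennreal (1 / t)) * (epowr (W t x) ?q * indicator (ball y \<tau>) x) \<partial>lborel)"
          by (rule nn_integral_cmult[symmetric]) measurable
        also have "\<dots> \<le> (\<integral>\<^sup>+x. ?k * (?S x * indicator (ball y \<tau>) x) \<partial>lborel)"
        proof (rule nn_integral_mono)
          fix x
          have "epowr (W t x) ?q * ennreal (1 / t) \<le> ennreal (C powr ?q) * ?S x"
            by (rule comparable_pointwise[OF W C q' t(1)]) (use t in \<open>auto simp: S_def\<close>)
          from mult_left_mono[OF this, of "ennreal (1 / ?B)"]
          show "(ennreal (1 / ?B) * ennreal (1 / t)) * (epowr (W t x) ?q * indicator (ball y \<tau>) x)
            \<le> ?k * (?S x * indicator (ball y \<tau>) x)"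
            by (cases "x \<in> ball y \<tau>") (simp_all add: mult_ac)
        qed
        also have "\<dots> = ?k * (\<integral>\<^sup>+x\<in>ball y \<tau>. ?S x \<partial>lborel)"
          by (rule nn_integral_cmult) measurable
        also have "(\<integral>\<^sup>+x\<in>ball y \<tau>. ?S x \<partial>lborel) = (\<integral>\<^sup>+p. ?s p * ?w (fst p) t \<partial>count_space UNIV)"
          by (subst nn_integral_dyadic_sum) (auto intro!: nn_integral_cong simp: mult_ac)
        finally show ?thesis .
      qed simp
    qed
    also have "\<dots> = ?k * (\<integral>\<^sup>+t. (\<integral>\<^sup>+p. ?s p * ?w (fst p) t \<partial>count_space UNIV) \<partial>lborel)"
      by (rule nn_integral_cmult) (simp add: measurable_window_sum)
    also have "\<dots> \<le> ?k * (ennreal 3 * (\<integral>\<^sup>+p. ?s p \<partial>count_space UNIV))"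
      by (intro mult_left_mono nn_integral_window_sum_le) simp
    also have "(\<integral>\<^sup>+p. ?s p \<partial>count_space UNIV) \<le> (\<integral>\<^sup>+p. ennreal (5 ^ CARD('d)) * (b' (fst p) (snd p) * ennreal (?vol (fst p))) \<partial>count_space UNIV)"
    proof (rule nn_integral_mono)
      fix p :: "int \<times> (int ^ 'd)"
      show "?s p \<le> ennreal (5 ^ CARD('d)) * (b' (fst p) (snd p) * ennreal (?vol (fst p)))"
      proof (cases "star (fst p) (snd p) \<inter> ball y \<tau> = {}")
        case False
        have "?s p \<le> ?b (fst p) (snd p) * ennreal (5 ^ CARD('d) * ?vol (fst p))"
          by (intro mult_left_mono order_trans[OF emeasure_mono emeasure_star_le]) auto
        also have "\<dots> = ennreal (5 ^ CARD('d)) * (b' (fst p) (snd p) * ennreal (?vol (fst p)))"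
          using False by (simp add: b'_def ennreal_mult mult_ac)
        finally show ?thesis .
      qed simp
    qed
    also have "\<dots> = ennreal (5 ^ CARD('d)) * (\<integral>\<^sup>+p. b' (fst p) (snd p) * ennreal (?vol (fst p)) \<partial>count_space UNIV)"
      by (rule nn_integral_cmult) simp
    also have "(\<integral>\<^sup>+p. b' (fst p) (snd p) * ennreal (?vol (fst p)) \<partial>count_space UNIV)
       \<le> ennreal (1 / (1 - c)) * (\<integral>\<^sup>+x\<in>U. dyadic_sum (median_set q c a) b' x \<partial>lborel)"
      using dyadic_sum_cube_integral_le[OF ample_median_set[OF c, of q a], of U b'] c cube_U median_set_subset[of q c a]
      unfolding case_prod_beta by force
    also have "(\<integral>\<^sup>+x\<in>U. dyadic_sum (median_set q c a) b' x \<partial>lborel) \<le> (\<integral>\<^sup>+x. epowr ?M ?q * indicator U x \<partial>lborel)"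
    proof (rule nn_integral_mono)
      fix x
      have "dyadic_sum (median_set q c a) b' x \<le> dyadic_sum (median_set q c a) (\<lambda>k n. epowr (a k n) ?q) x"
        by (rule dyadic_sum_mono) (auto simp: b'_def)
      also have "\<dots> = epowr (dyadic_lq q (median_set q c a) a x) ?q" using q q' by (simp add: dyadic_lq_def)
      also have "\<dots> \<le> epowr ?M ?q"
      proof (intro epowr_mono order_trans[OF dyadic_lq_median_set_le_median_fun[OF q(1)]])
        show "median_fun q c a x \<le> ?M"
          unfolding median_fun_def by (rule SUP_mono') (auto simp: indicator_def)
      qed (use q' in auto)
      finally show "dyadic_sum (median_set q c a) b' x * indicator U x \<le> epowr ?M ?q * indicator U x"
        by (rule mult_right_mono) simp
    qed
    also have "\<dots> = epowr ?M ?q * emeasure lborel U"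
      by (rule nn_integral_cmult_indicator) simp
    also have "\<dots> \<le> epowr ?M ?q * ennreal (25 ^ CARD('d) * ?vol K)"
      by (rule mult_left_mono[OF U_le]) simp
    finally have "(\<integral>\<^sup>+t\<in>{0<..<\<tau>}. mean_integral (ball y \<tau>) (\<lambda>x. epowr (W t x) ?q) * ennreal (1 / t) \<partial>lborel)
      \<le> ?k * (ennreal 3 * (ennreal (5 ^ CARD('d)) * (ennreal (1 / (1 - c)) * (epowr ?M ?q * ennreal (25 ^ CARD('d) * ?vol K)))))"
      by (simp add: mult_left_mono)
    also have "\<dots> = ennreal (1 / ?B * C powr ?q * 3 * 5 ^ CARD('d) * (1 / (1 - c)) * (25 ^ CARD('d) * ?vol K)) * epowr ?M ?q"
      using B c by (subst ennreal_mult, simp, simp)+ (simp only: mult_ac)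
    also have "\<dots> \<le> ennreal K1 * epowr ?M ?q"
    proof (intro mult_right_mono ennreal_leI)
      have "?vol K \<le> (2 * \<tau>) ^ CARD('d)" using K(1) by (intro power_mono) auto
      then have "?vol K / \<tau> ^ CARD('d) \<le> 2 ^ CARD('d)" using \<tau> by (simp add: power_mult_distrib divide_le_eq)
      then have "(3 * C powr ?q * 5 ^ CARD('d) * 25 ^ CARD('d) / ((1 - c) * unit_ball_vol CARD('d))) * (?vol K / \<tau> ^ CARD('d)) \<le>
        (3 * C powr ?q * 5 ^ CARD('d) * 25 ^ CARD('d) / ((1 - c) * unit_ball_vol CARD('d))) * 2 ^ CARD('d)"
        using c by (intro mult_left_mono) auto
      then show "1 / ?B * C powr ?q * 3 * 5 ^ CARD('d) * (1 / (1 - c)) * (25 ^ CARD('d) * ?vol K) \<le> K1"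
        unfolding K1 by (simp add: field_simps)
    qed simp
    finally show ?thesis .
  qed
  from epowr_root_le[OF this K1_nonneg q'] q q' show ?thesis
    by (auto simp: scale_tent_norm_def nn_integral_completion intro!: SUP_least)
qed

text \<open>The cube is enclosed in a ball of comparable radius. The sum of \<open>a^q |Q|\<close>
  over its subcubes is bounded from below by \<open>median_power_le\<close> and from above through
  the sets \<open>E\<close> and the times in \<open>{0<..<\<tau>}\<close>. In \<open>K2\<close>, 4
  comes from the mass of \<open>T k n\<close>, and the volume ratio of ball and cube gives the power
  of \<open>2 * CARD('d)\<close>.\<close>

lemma scale_tent_norm_equiv_infinite_finite_ge:
  fixes a :: "int \<Rightarrow> int ^ 'd \<Rightarrow> ennreal"
  assumes q: "0 < q" "q \<noteq> \<infinity>" and c: "0 < c" "c < 1" and C: "0 < C" and \<delta>: "0 < \<delta>" and W: "comparable C \<delta> a W"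
    and K2: "K2 = 4 * C powr enn2real q * unit_ball_vol CARD('d) * (2 * CARD('d)) ^ CARD('d) / (\<delta> * c)"
  shows "median q c a K N \<le> ennreal (K2 powr (1 / enn2real q)) * scale_tent_norm \<infinity> q W"
proof -
  let ?q = "enn2real q"
  have q': "0 < ?q" using q by (rule enn2real_pos)
  let ?vol = "\<lambda>k::int. ((2::real) powi k) ^ CARD('d)"
  have K2_nonneg: "0 \<le> K2" using c \<delta> by (simp add: K2)
  \<comment> \<open>Large enough for \<open>cube_dist_less\<close>, and also for the time windows of
    all subcubes, which end at or before \<open>3 / 2 * 2^K\<close>.\<close>
  define \<tau> where "\<tau> = 2 * CARD('d) * 2 powi K"
  have \<tau>: "0 < \<tau>" by (simp add: \<tau>_def)
  let ?B = "unit_ball_vol CARD('d) * \<tau> ^ CARD('d)"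
  have B: "0 < ?B" using \<tau> by simp
  obtain y where y: "y \<in> cube K N" using cube_nonempty by blast
  have cube_ball: "cube K N \<subseteq> ball y \<tau>"
    using cube_dist_less[OF y] by (auto simp: \<tau>_def)
  define Z where "Z = (\<integral>\<^sup>+t\<in>{0<..<\<tau>}. mean_integral (ball y \<tau>) (\<lambda>x. epowr (W t x) ?q) * ennreal (1 / t) \<partial>lborel)"
  have Z: "epowr Z (1 / ?q) \<le> scale_tent_norm \<infinity> q W"
    using q \<tau> unfolding scale_tent_norm_def Z_def by (simp add: nn_integral_completion) (intro SUP_upper2[of \<tau>] SUP_upper2[of y], auto)
  obtain E T where E: "ample \<delta> E" and dom: "dominated C a W E T"
    using W unfolding comparable_def by blast
  let ?b = "\<lambda>k n. epowr (sub_fam K N a k n) ?q"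
  have b_nz: "cube k n \<subseteq> cube K N" if "?b k n \<noteq> 0" for k n
    using that by (auto simp: sub_fam_def split: if_splits)
  have J: "{3 / 4 * 2 powi k<..3 / 2 * 2 powi k} \<subseteq> {0<..<\<tau>}" if "?b k n \<noteq> 0" for k n
  proof -
    have "(2::real) powi k \<le> 2 powi K"
      using cube_subset_imp_le[OF b_nz[OF that]] by (intro power_int_increasing) auto
    moreover have "2 * (2 powi K :: real) \<le> \<tau>" unfolding \<tau>_def by simp
    moreover have "(0::real) < 2 powi k" by simp
    ultimately have "0 < t \<and> t < \<tau>" if "3 / 4 * 2 powi k < t" "t \<le> 3 / 2 * 2 powi k" for t
      using that by linarith
    then show ?thesis by auto
  qed
  have dyadic_sum_le: "dyadic_sum E ?b x \<le> ennreal (4 * C powr ?q) * (\<integral>\<^sup>+t\<in>{0<..<\<tau>}. epowr (W t x) ?q * ennreal (1 / t) \<partial>lborel)" for x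
    by (rule dyadic_sum_selection_le[OF W C q' ampleD(2)[OF E] dom]) (use J q' in \<open>auto simp: sub_fam_def\<close>)
  have [measurable]: "ball y \<tau> \<in> sets borel" by simp
  have Wm[measurable]: "(\<lambda>z. W (fst z) (snd z) * indicator {0<..} (fst z)) \<in> borel_measurable (borel \<Otimes>\<^sub>M borel)"
    using W by (simp add: comparable_def)
  \<comment> \<open>The indicators make the integrand jointly Borel measurable, as Tonelli requires;
    for times in \<open>{0<..<\<tau>}\<close> it is the original one.\<close>
  define g where "g z = epowr (W (fst z) (snd z) * indicator {0<..} (fst z)) ?q * ennreal (1 / fst z) * indicator {0<..<\<tau>} (fst z)" for z :: "real \<times> (real ^ 'd)"
  have gm[measurable]: "g \<in> borel_measurable (borel \<Otimes>\<^sub>M borel)" unfolding g_def by measurable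
  have gm': "(\<lambda>(t, x). g (t, x) * indicator (ball y \<tau>) x) \<in> borel_measurable (borel \<Otimes>\<^sub>M borel)"
    by measurable
  have g_eq: "g (t, x) = epowr (W t x) ?q * ennreal (1 / t) * indicator {0<..<\<tau>} t" for t x
    by (auto simp: g_def indicator_def)
  have gx[measurable]: "(\<lambda>t. g (t, x)) \<in> borel_measurable borel" "(\<lambda>x. g (t, x)) \<in> borel_measurable borel" for t x
    by measurable
  have "(\<integral>\<^sup>+x\<in>cube K N. dyadic_sum E ?b x \<partial>lborel) \<le> (\<integral>\<^sup>+x. ennreal (4 * C powr ?q) * (\<integral>\<^sup>+t. g (t, x) * indicator (ball y \<tau>) x \<partial>lborel) \<partial>lborel)"
  proof (rule nn_integral_mono)
    fix x
    show "dyadic_sum E ?b x * indicator (cube K N) x \<le> ennreal (4 * C powr ?q) * (\<integral>\<^sup>+t. g (t, x) * indicator (ball y \<tau>) x \<partial>lborel)"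
    proof (cases "x \<in> cube K N")
      case True
      with cube_ball have "x \<in> ball y \<tau>" by blast
      with dyadic_sum_le[of x] True show ?thesis by (simp add: g_eq)
    qed simp
  qed
  also have "\<dots> = ennreal (4 * C powr ?q) * (\<integral>\<^sup>+x. (\<integral>\<^sup>+t. g (t, x) * indicator (ball y \<tau>) x \<partial>lborel) \<partial>lborel)"
  proof (rule nn_integral_cmult)
    have "(\<lambda>(x, t). g (t, x) * indicator (ball y \<tau>) x) \<in> borel_measurable (borel \<Otimes>\<^sub>M lborel)"
      by measurable
    from lborel.borel_measurable_nn_integral[OF this]
    show "(\<lambda>x. \<integral>\<^sup>+t. g (t, x) * indicator (ball y \<tau>) x \<partial>lborel) \<in> borel_measurable lborel" by simp
  qed
  also have "(\<integral>\<^sup>+x. (\<integral>\<^sup>+t. g (t, x) * indicator (ball y \<tau>) x \<partial>lborel) \<partial>lborel)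
     = (\<integral>\<^sup>+t. (\<integral>\<^sup>+x. g (t, x) * indicator (ball y \<tau>) x \<partial>lborel) \<partial>lborel)"
    by (rule lborel_pair.Fubini') measurable
  also have "\<dots> = ennreal ?B * Z"
  proof -
    let ?\<phi> = "\<lambda>t. \<integral>\<^sup>+x. g (t, x) * indicator (ball y \<tau>) x \<partial>lborel"
    have "(\<lambda>(t, x). g (t, x) * indicator (ball y \<tau>) x) \<in> borel_measurable (borel \<Otimes>\<^sub>M lborel)"
      using gm' by simp
    from lborel.borel_measurable_nn_integral[OF this]
    have [measurable]: "?\<phi> \<in> borel_measurable borel" by simp
    have "mean_integral (ball y \<tau>) (\<lambda>x. epowr (W t x) ?q) * ennreal (1 / t) * indicator {0<..<\<tau>} t = ?\<phi> t * ennreal (1 / ?B)" for t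
    proof (cases "t \<in> {0<..<\<tau>}")
      case True
      have [measurable]: "W t \<in> borel_measurable borel"
        using comparable_measurable_slice[OF W] True by simp
      have "?\<phi> t = (\<integral>\<^sup>+x. ennreal (1 / t) * (epowr (W t x) ?q * indicator (ball y \<tau>) x) \<partial>lborel)"
        using True by (intro nn_integral_cong) (auto simp: g_eq mult_ac)
      also have "\<dots> = ennreal (1 / t) * (\<integral>\<^sup>+x. epowr (W t x) ?q * indicator (ball y \<tau>) x \<partial>lborel)"
        by (rule nn_integral_cmult) measurable
      finally show ?thesis using True unfolding mean_integral_ball[OF \<tau>] by (simp add: mult_ac)
    qed (simp add: g_eq)
    then have "Z = (\<integral>\<^sup>+t. ?\<phi> t \<partial>lborel) * ennreal (1 / ?B)"
      unfolding Z_def by (simp only: nn_integral_multc) (rule nn_integral_multc, measurable)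
    moreover have "ennreal ?B * ennreal (1 / ?B) = ennreal (?B * (1 / ?B))"
      by (rule ennreal_mult[symmetric]) (use B in \<open>simp_all add: less_imp_le\<close>)
    moreover have "?B * (1 / ?B) = 1" using B by (metis less_irrefl nonzero_mult_div_cancel_left times_divide_eq_right mult_1_right)
    ultimately show ?thesis by (simp only: mult.left_commute[of "ennreal ?B"]) simp
  qed
  finally have main: "(\<integral>\<^sup>+x\<in>cube K N. dyadic_sum E ?b x \<partial>lborel) \<le> ennreal (4 * C powr ?q) * (ennreal ?B * Z)"
    by (simp add: mult_left_mono)
  have "epowr (median q c a K N) ?q * ennreal (c * ?vol K) \<le> (\<integral>\<^sup>+(k, n). ?b k n * ennreal (?vol k) \<partial>count_space UNIV)"
    by (rule median_power_le[OF q c(1)])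
  also have "\<dots> \<le> ennreal (1 / \<delta>) * (\<integral>\<^sup>+x\<in>cube K N. dyadic_sum E ?b x \<partial>lborel)"
  proof (rule dyadic_sum_cube_integral_le[OF E _ \<delta>])
    show "E k n \<subseteq> cube K N" if "?b k n \<noteq> 0" for k n
      using ampleD(2)[OF E, of k n] b_nz[OF that] by blast
  qed simp
  also have "\<dots> \<le> ennreal (1 / \<delta>) * (ennreal (4 * C powr ?q) * (ennreal ?B * Z))"
    by (rule mult_left_mono[OF main]) simp
  also have "\<dots> = ennreal (1 / \<delta> * (4 * C powr ?q) * ?B) * Z"
  proof -
    have "ennreal u * (ennreal v * (ennreal w * Z)) = ennreal (u * v * w) * Z" if "0 \<le> u" "0 \<le> v" "0 \<le> w" for u v w
      using that by (simp add: ennreal_mult mult.assoc)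
    then show ?thesis using \<delta> B by (metis less_imp_le zero_le_divide_1_iff zero_le_mult_iff powr_ge_zero zero_le_numeral)
  qed
  also have "1 / \<delta> * (4 * C powr ?q) * ?B = K2 * (c * ?vol K)"
    using c \<delta> by (simp add: K2 \<tau>_def power_mult_distrib field_simps)
  also have "ennreal (K2 * (c * ?vol K)) * Z = ennreal K2 * Z * ennreal (c * ?vol K)"
    using K2_nonneg c by (subst ennreal_mult) (simp_all add: mult_ac)
  finally have "epowr (median q c a K N) ?q * ennreal (c * ?vol K) \<le> ennreal K2 * Z * ennreal (c * ?vol K)" .
  then have "epowr (median q c a K N) ?q \<le> ennreal K2 * Z"
    using c by (subst (asm) (1 2) mult.commute, subst (asm) ennreal_mult_le_mult_iff) auto
  from epowr_root_le[OF this K2_nonneg q'] q'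
  have "median q c a K N \<le> ennreal (K2 powr (1 / ?q)) * epowr Z (1 / ?q)" by simp
  also have "\<dots> \<le> ennreal (K2 powr (1 / ?q)) * scale_tent_norm \<infinity> q W"
    by (rule mult_left_mono[OF Z]) simp
  finally show ?thesis .
qed

lemma scale_tent_norm_equiv:
  assumes p: "0 < p" and q: "0 < q" and c: "0 < c" "c < 1" and C: "0 < C" and \<delta>: "0 < \<delta>"
  shows "\<exists>K>0. \<forall>(a :: int \<Rightarrow> int ^ 'd \<Rightarrow> ennreal) W. comparable C \<delta> a W \<longrightarrow>
    norms_equivalent K (scale_tent_norm p q W) (Lp_norm lebesgue p (median_fun q c a))"
proof (cases "p = \<infinity>")
  case False
  then show ?thesis using scale_tent_norm_equiv_finite[OF p _ q c C \<delta>] by blast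
next
  case p: True
  show ?thesis
  proof (cases "q = \<infinity>")
    case True
    then show ?thesis using p C scale_tent_norm_equiv_infinite_infinite[OF c C \<delta>] by blast
  next
    case False
    define K1 where "K1 = 3 * C powr enn2real q * 5 ^ CARD('d) * 25 ^ CARD('d) * 2 ^ CARD('d) / ((1 - c) * unit_ball_vol CARD('d))"
    define K2 where "K2 = 4 * C powr enn2real q * unit_ball_vol CARD('d) * (2 * CARD('d)) ^ CARD('d) / (\<delta> * c)"
    have "0 < K1" using C c by (simp add: K1_def)
    have "norms_equivalent (max (K1 powr (1 / enn2real q)) (K2 powr (1 / enn2real q))) (scale_tent_norm p q W) (Lp_norm lebesgue p (median_fun q c a))"
      if W: "comparable C \<delta> a W" for a :: "int \<Rightarrow> int ^ 'd \<Rightarrow> ennreal" and W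
    proof (rule norms_equivalentI)
      show "scale_tent_norm p q W \<le> ennreal (K1 powr (1 / enn2real q)) * Lp_norm lebesgue p (median_fun q c a)"
        using scale_tent_norm_equiv_infinite_finite_le[OF q False c C W K1_def] p by (simp add: Lp_norm_def esssup_median_fun)
      show "Lp_norm lebesgue p (median_fun q c a) \<le> ennreal (K2 powr (1 / enn2real q)) * scale_tent_norm p q W"
        using scale_tent_norm_equiv_infinite_finite_ge[OF q False c C \<delta> W K2_def] p
        by (auto simp: Lp_norm_def esssup_median_fun intro!: SUP_least)
    qed
    then show ?thesis using \<open>0 < K1\<close>
      by (intro exI[of _ "max (K1 powr (1 / enn2real q)) (K2 powr (1 / enn2real q))"]) (auto simp: less_max_iff_disj)
  qed
qed

section \<open>Translation of the dyadic definitions\<close>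


text \<open>Makes the definite description in \<open>side_length\<close> well defined and lets sums
  over sets of cubes be reindexed by pairs.\<close>

lemma cube_inj: "cube k n = cube l m \<longleftrightarrow> k = l \<and> n = m"
proof
  assume eq: "cube k n = cube l m"
  then have "k = l" by (intro order_antisym cube_subset_imp_le[of k n l m] cube_subset_imp_le[of l m k n]) auto
  moreover obtain x where "x \<in> cube k n" using cube_nonempty by blast
  ultimately show "k = l \<and> n = m" using eq by (auto simp: cube_def)
qed simp

lemma dyadic_cubes_gen_eq: "dyadic_cubes_gen k = range (cube k)"
proof -
  have img: "(\<lambda>y. (2 powi k) *\<^sub>R x + y) ` {y. \<forall>i. 0 \<le> y $ i \<and> y $ i < 2 powi k} = cube k n"
    if n: "\<And>i. x $ i = real_of_int (n $ i)" for x :: "real ^ 'a" and n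
  proof -
    have tr: "z \<in> (\<lambda>y. v + y) ` S \<longleftrightarrow> z - v \<in> S" for z v :: "real ^ 'a" and S
      by (auto simp: image_iff intro: bexI[of _ "z - v"])
    show ?thesis
      by (intro set_eqI, subst tr) (auto simp: cube_altdef n algebra_simps)
  qed
  show ?thesis
  proof (intro equalityI subsetI)
    fix Q :: "(real ^ 'a) set" assume "Q \<in> dyadic_cubes_gen k"
    then obtain x :: "real ^ 'a" where x: "\<forall>i. x $ i \<in> \<int>"
      "Q = (\<lambda>y. (2 powi k) *\<^sub>R x + y) ` {y. \<forall>i. 0 \<le> y $ i \<and> y $ i < 2 powi k}"
      by (auto simp: dyadic_cubes_gen_def)
    have "x $ i = real_of_int ((\<chi> i. \<lfloor>x $ i\<rfloor>) $ i)" for i using x(1) by auto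
    from img[OF this] x(2) show "Q \<in> range (cube k)" by auto
  next
    fix Q :: "(real ^ 'a) set" assume "Q \<in> range (cube k)"
    then obtain n where n: "Q = cube k n" by auto
    from img[of "\<chi> i. real_of_int (n $ i)" n] n show "Q \<in> dyadic_cubes_gen k"
      unfolding dyadic_cubes_gen_def by (intro CollectI exI[of _ "\<chi> i. real_of_int (n $ i)"]) auto
  qed
qed

lemma dyadic_cubes_eq: "dyadic_cubes = range (\<lambda>(k, n). cube k n)"
  by (auto simp: dyadic_cubes_def dyadic_cubes_gen_eq)

lemma side_length_cube: "side_length (cube k n) = 2 powi k"
  unfolding side_length_def dyadic_cubes_gen_eq
  by (rule the_equality) (auto simp: cube_inj)

lemma whitney_box_cube: "whitney_box (cube k n) = {2 powi k / 2<..2 powi k} \<times> cube k n"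
  by (simp add: whitney_box_def side_length_cube)

lemma sets_whitney_box: "whitney_box (cube k n) \<in> sets borel"
  unfolding whitney_box_cube by (intro borel_Times) auto

lemma whitney_boxD:
  assumes "z \<in> whitney_box (cube k n)"
  shows "0 < fst z" "fst z \<le> 2 powi k" "2 powi k \<le> 2 * fst z"
proof -
  have "(0::real) < 2 powi k" by simp
  with assms show "0 < fst z" "fst z \<le> 2 powi k" "2 powi k \<le> 2 * fst z"
    unfolding whitney_box_cube mem_Times_iff greaterThanAtMost_iff by linarith+
qed

lemma measure_cube: "measure lebesgue (cube k (n :: int ^ 'd)) = (2 powi k) ^ CARD('d)"
  by (simp add: measure_def emeasure_cube)

definition whitney_coeff :: "ennreal \<Rightarrow> real \<Rightarrow> (real \<times> (real ^ 'd) \<Rightarrow> complex) \<Rightarrow> int \<Rightarrow> int ^ 'd \<Rightarrow> ennreal" where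
  "whitney_coeff r \<beta> f k n = ennreal (measure lebesgue (cube k n) powr (- \<beta> / CARD('d))) * whitney_norm r f (cube k n)"

lemma infsum_eq_nn_integral_count_space:
  fixes f :: "'i::countable \<Rightarrow> ennreal"
  shows "infsum f UNIV = (\<integral>\<^sup>+p. f p \<partial>count_space UNIV)"
proof (rule antisym)
  have eq: "infsum f UNIV = (SUP F\<in>{F. finite F \<and> F \<subseteq> UNIV}. sum f F)"
    by (rule nonneg_infsum_complete) simp
  show "infsum f UNIV \<le> (\<integral>\<^sup>+p. f p \<partial>count_space UNIV)"
    unfolding eq by (intro SUP_least sum_le_nn_integral_count_space) simp
  show "(\<integral>\<^sup>+p. f p \<partial>count_space UNIV) \<le> infsum f UNIV"
    unfolding eq by (intro nn_integral_count_space_least SUP_upper) simp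
qed

text \<open>The cubes are reindexed injectively by pairs, and the weight with exponent
  \<open>-\<beta> * q / d\<close> is the \<open>q\<close>-th power of the one in
  \<open>whitney_coeff\<close>.\<close>

lemma G_fun_cube:
  fixes f :: "real \<times> (real ^ 'd) \<Rightarrow> complex"
  assumes q: "0 < q"
  shows "G_fun q r \<beta> (cube K N) f x = dyadic_lq q cube (sub_fam K N (whitney_coeff r \<beta> f)) x"
proof -
  let ?D = "{p. cube (fst p) (snd p) \<subseteq> cube K N} :: (int \<times> (int ^ 'd)) set"
  let ?c = "\<lambda>p. cube (fst p) (snd p) :: (real ^ 'd) set"
  have D: "{Q \<in> dyadic_cubes. Q \<subseteq> cube K N} = ?c ` ?D"
    by (auto simp: dyadic_cubes_eq case_prod_beta)
  have inj: "inj_on ?c ?D" by (auto simp: inj_on_def cube_inj prod_eq_iff)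
  show ?thesis
  proof (cases "q = \<infinity>")
    case True
    have "(SUP Q\<in>?c ` ?D. indicator Q x * ennreal (measure lebesgue Q powr (- \<beta> / CARD('d))) * whitney_norm r f Q)
      = (SUP p\<in>?D. indicator (?c p) x * whitney_coeff r \<beta> f (fst p) (snd p))"
      by (simp add: image_image whitney_coeff_def mult.assoc)
    also have "\<dots> = (SUP p. indicator (?c p) x * sub_fam K N (whitney_coeff r \<beta> f) (fst p) (snd p))"
    proof (rule antisym)
      show "(SUP p\<in>?D. indicator (?c p) x * whitney_coeff r \<beta> f (fst p) (snd p))
        \<le> (SUP p. indicator (?c p) x * sub_fam K N (whitney_coeff r \<beta> f) (fst p) (snd p))"
        by (intro SUP_mono) (auto simp: sub_fam_def)
      show "(SUP p. indicator (?c p) x * sub_fam K N (whitney_coeff r \<beta> f) (fst p) (snd p))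
        \<le> (SUP p\<in>?D. indicator (?c p) x * whitney_coeff r \<beta> f (fst p) (snd p))"
      proof (rule SUP_least)
        fix p :: "int \<times> (int ^ 'd)"
        show "indicator (?c p) x * sub_fam K N (whitney_coeff r \<beta> f) (fst p) (snd p)
          \<le> (SUP p\<in>?D. indicator (?c p) x * whitney_coeff r \<beta> f (fst p) (snd p))"
        proof (cases "p \<in> ?D")
          case True
          then show ?thesis by (intro SUP_upper2[of p]) (auto simp: sub_fam_def)
        qed (simp add: sub_fam_def)
      qed
    qed
    finally show ?thesis using True by (simp add: G_fun_def dyadic_lq_def D dyadic_sup_def case_prod_beta)
  next
    case False
    let ?q = "enn2real q"
    let ?\<phi> = "\<lambda>Q :: (real ^ 'd) set. indicator Q x * ennreal (measure lebesgue Q powr (- \<beta> * ?q / CARD('d))) * epowr (whitney_norm r f Q) ?q"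
    have \<phi>: "?\<phi> (cube k n) = indicator (cube k n) x * epowr (whitney_coeff r \<beta> f k n) ?q" for k n
      by (simp add: whitney_coeff_def epowr_mult epowr_ennreal powr_powr mult.assoc)
    have "(\<Sum>\<^sub>\<infinity>Q\<in>?c ` ?D. ?\<phi> Q) = (\<Sum>\<^sub>\<infinity>p\<in>?D. ?\<phi> (?c p))"
      using infsum_reindex[OF inj, of ?\<phi>] by (simp add: o_def)
    also have "\<dots> = (\<Sum>\<^sub>\<infinity>p\<in>UNIV. indicator (?c p) x * epowr (sub_fam K N (whitney_coeff r \<beta> f) (fst p) (snd p)) ?q)"
      unfolding \<phi> by (rule infsum_cong_neutral) (auto simp: sub_fam_def)
    also have "\<dots> = dyadic_sum cube (\<lambda>k n. epowr (sub_fam K N (whitney_coeff r \<beta> f) k n) ?q) x"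
      unfolding dyadic_sum_def case_prod_beta by (rule infsum_eq_nn_integral_count_space)
    finally show ?thesis using False by (simp add: G_fun_def dyadic_lq_def D)
  qed
qed

lemma m_cube_cube:
  fixes f :: "real \<times> (real ^ 'd) \<Rightarrow> complex"
  assumes q: "0 < q"
  shows "m_cube q r \<beta> (cube K N) c f = median q c (whitney_coeff r \<beta> f) K N"
proof -
  let ?G = "dyadic_lq q cube (sub_fam K N (whitney_coeff r \<beta> f))"
  have "emeasure lebesgue {x \<in> cube K N. ?G x > t} = emeasure lborel {x \<in> cube K N. ?G x > t}" for t
  proof (rule emeasure_lebesgue_borel)
    have "{x \<in> cube K N. ?G x > t} = cube K N \<inter> {x. ?G x > t}" by auto
    then show "{x \<in> cube K N. ?G x > t} \<in> sets borel" by simp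
  qed
  then show ?thesis by (simp add: m_cube_def median_def G_fun_cube[OF q])
qed

lemma m_fun_eq_median_fun:
  assumes q: "0 < q"
  shows "m_fun q r \<beta> c f = median_fun q c (whitney_coeff r \<beta> f)"
  by (auto simp: fun_eq_iff m_fun_def median_fun_def dyadic_cubes_eq image_image case_prod_beta m_cube_cube[OF q])

section \<open>Comparison of Whitney means\<close>


text \<open>A mean of order \<open>r\<close>, up to constants, only if \<open>B\<close> has measure comparable to \<open>l\<^bsup>d+1\<^esup>\<close>.\<close>

definition box_mean :: "ennreal \<Rightarrow> real \<Rightarrow> (real \<times> (real ^ 'd)) set \<Rightarrow> (real \<times> (real ^ 'd) \<Rightarrow> ennreal) \<Rightarrow> ennreal" where
  "box_mean r l B h = (if r = \<infinity> then esssup lborel (\<lambda>z. h z * indicator B z)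
     else epowr (ennreal (1 / l ^ (CARD('d) + 1)) * (\<integral>\<^sup>+z\<in>B. epowr (h z) (enn2real r) \<partial>lborel)) (1 / enn2real r))"

definition root_const :: "ennreal \<Rightarrow> real \<Rightarrow> real" where
  "root_const r x = (if r = \<infinity> then 1 else x powr (1 / enn2real r))"

lemma root_const_pos: "0 < x \<Longrightarrow> 0 < root_const r x"
  by (simp add: root_const_def)

lemma box_mean_mono:
  fixes h :: "real \<times> (real ^ 'd) \<Rightarrow> ennreal"
  assumes r: "0 < r" and h: "h \<in> borel_measurable borel" and B: "B \<in> sets borel" and sub: "B \<subseteq> B'"
  shows "box_mean r l B h \<le> box_mean r l B' h"
proof (cases "r = \<infinity>")
  case True
  have "(\<lambda>z. h z * indicator B z) \<in> borel_measurable lborel" using h B by simp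
  moreover have "h z * indicator B z \<le> h z * indicator B' z" for z
    using sub by (auto simp: indicator_def)
  ultimately show ?thesis using True by (simp add: box_mean_def esssup_mono)
next
  case False
  then show ?thesis using enn2real_pos[OF r False] sub
    by (auto simp: box_mean_def indicator_def intro!: epowr_mono mult_left_mono nn_integral_mono)
qed

text \<open>The set stays the same and only the normalisation by \<open>l^(d + 1)\<close> changes;
  for \<open>r = \<infinity>\<close> there is none.\<close>

lemma box_mean_scale:
  fixes h :: "real \<times> (real ^ 'd) \<Rightarrow> ennreal"
  assumes r: "0 < r" and l: "0 < l" "0 < l'" "l \<le> 4 * l'"
  shows "box_mean r l' B h \<le> ennreal (root_const r (4 ^ (CARD('d) + 1))) * box_mean r l B h"
proof (cases "r = \<infinity>")
  case False
  let ?r = "enn2real r" and ?d = "CARD('d) + 1" and ?I = "\<integral>\<^sup>+z\<in>B. epowr (h z) (enn2real r) \<partial>lborel"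
  have r': "0 < ?r" using r False by (rule enn2real_pos)
  have "l ^ ?d \<le> (4 * l') ^ ?d" using l by (intro power_mono) auto
  then have "1 / l' ^ ?d \<le> 4 ^ ?d * (1 / l ^ ?d)"
    using l by (simp add: power_mult_distrib field_simps)
  then have "ennreal (1 / l' ^ ?d) \<le> ennreal (4 ^ ?d) * ennreal (1 / l ^ ?d)"
    using l by (simp add: ennreal_leI flip: ennreal_mult)
  then have "ennreal (1 / l' ^ ?d) * ?I \<le> ennreal (4 ^ ?d) * ennreal (1 / l ^ ?d) * ?I"
    by (rule mult_right_mono) simp
  then have "ennreal (1 / l' ^ ?d) * ?I \<le> ennreal (4 ^ ?d) * (ennreal (1 / l ^ ?d) * ?I)"
    by (simp only: mult.assoc)
  from epowr_root_le[OF this _ r'] show ?thesis using False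
    by (simp add: box_mean_def root_const_def)
qed (simp add: box_mean_def root_const_def)

text \<open>The integral over \<open>B\<close> is at most the sum over the pieces, hence at most
  \<open>M\<close> times the largest. The root is taken only afterwards, so \<open>r < 1\<close> is
  treated like any other finite \<open>r\<close>; for \<open>r = \<infinity>\<close> nothing is
  lost, whence the form of \<open>root_const\<close>.\<close>

lemma box_mean_pigeonhole:
  fixes h :: "real \<times> (real ^ 'd) \<Rightarrow> ennreal"
  assumes r: "0 < r" and h[measurable]: "h \<in> borel_measurable borel"
    and I: "finite I" "I \<noteq> {}" and card: "real (card I) \<le> M"
    and B: "B \<in> sets borel" and Bi[measurable]: "\<And>i. i \<in> I \<Longrightarrow> Bi i \<in> sets borel"
    and cover: "B \<subseteq> (\<Union>i\<in>I. Bi i)"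
  shows "\<exists>i\<in>I. box_mean r l B h \<le> ennreal (root_const r M) * box_mean r l (Bi i) h"
proof -
  let ?\<phi> = "\<lambda>i. box_mean r l (Bi i) h"
  have "Max (?\<phi> ` I) \<in> ?\<phi> ` I" using I by (intro Max_in) auto
  then obtain j where j: "j \<in> I" "?\<phi> j = Max (?\<phi> ` I)" by auto
  have max: "?\<phi> i \<le> ?\<phi> j" if "i \<in> I" for i
    unfolding j(2) using I that by (intro Max_ge) auto
  have "box_mean r l B h \<le> ennreal (root_const r M) * ?\<phi> j"
  proof (cases "r = \<infinity>")
    case True
    have "AE z in lborel. \<forall>i\<in>I. h z * indicator (Bi i) z \<le> ?\<phi> i"
      using I(1) True esssup_AE[of "\<lambda>z. h z * indicator (Bi _) z" lborel]
      by (simp add: AE_finite_all box_mean_def esssup_AE)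
    then have "AE z in lborel. h z * indicator B z \<le> ?\<phi> j"
    proof eventually_elim
      case (elim z)
      show ?case
      proof (cases "z \<in> B")
        case True
        then obtain i where i: "i \<in> I" "z \<in> Bi i" using cover by blast
        with elim have "h z \<le> ?\<phi> i" by fastforce
        with max[OF i(1)] True show ?thesis by simp
      qed simp
    qed
    then have "esssup lborel (\<lambda>z. h z * indicator B z) \<le> ?\<phi> j"
      using B by (intro esssup_I) auto
    then show ?thesis using True by (simp add: root_const_def box_mean_def)
  next
    case False
    let ?r = "enn2real r" and ?d = "CARD('d) + 1"
    let ?I = "\<lambda>B. \<integral>\<^sup>+z\<in>B. epowr (h z) ?r \<partial>lborel"
    have r': "0 < ?r" using r False by (rule enn2real_pos)
    have le: "ennreal (1 / l ^ ?d) * ?I (Bi i) \<le> ennreal (1 / l ^ ?d) * ?I (Bi j)" if "i \<in> I" for i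
      using max[OF that] False r' by (simp add: box_mean_def epowr_le_iff)
    have "?I B \<le> (\<integral>\<^sup>+z. (\<Sum>i\<in>I. epowr (h z) ?r * indicator (Bi i) z) \<partial>lborel)"
    proof (rule nn_integral_mono)
      fix z
      show "epowr (h z) ?r * indicator B z \<le> (\<Sum>i\<in>I. epowr (h z) ?r * indicator (Bi i) z)"
      proof (cases "z \<in> B")
        case True
        then obtain i where i: "i \<in> I" "z \<in> Bi i" using cover by blast
        have "epowr (h z) ?r * indicator B z = epowr (h z) ?r * indicator (Bi i) z" using True i by simp
        also have "\<dots> \<le> (\<Sum>i\<in>I. epowr (h z) ?r * indicator (Bi i) z)"
          using I(1) i(1) by (intro member_le_sum) auto
        finally show ?thesis .
      qed simp
    qed
    also have "\<dots> = (\<Sum>i\<in>I. ?I (Bi i))"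
      by (rule nn_integral_sum) measurable
    finally have "ennreal (1 / l ^ ?d) * ?I B \<le> (\<Sum>i\<in>I. ennreal (1 / l ^ ?d) * ?I (Bi i))"
      by (simp add: mult_left_mono flip: sum_distrib_left)
    also have "\<dots> \<le> (\<Sum>i\<in>I. ennreal (1 / l ^ ?d) * ?I (Bi j))"
      by (intro sum_mono le)
    also have "\<dots> = ennreal (real (card I)) * (ennreal (1 / l ^ ?d) * ?I (Bi j))"
      by (simp add: ennreal_of_nat_eq_real_of_nat)
    also have "\<dots> \<le> ennreal M * (ennreal (1 / l ^ ?d) * ?I (Bi j))"
      using card by (intro mult_right_mono ennreal_leI) auto
    finally have "ennreal (1 / l ^ ?d) * ?I B \<le> ennreal M * (ennreal (1 / l ^ ?d) * ?I (Bi j))" .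
    from epowr_root_le[OF this _ r'] card show ?thesis
      using False by (simp add: box_mean_def root_const_def)
  qed
  with j(1) show ?thesis by blast
qed

section \<open>Tent regions and measurability of their means\<close>

definition tent_region :: "real \<Rightarrow> real ^ 'd \<Rightarrow> (real \<times> (real ^ 'd)) set" where
  "tent_region t x = {t / 2<..t} \<times> ball x t"

lemma sets_tent_region [measurable]: "tent_region t x \<in> sets borel"
  unfolding tent_region_def by (intro borel_Times) auto

text \<open>For finite \<open>r\<close> this is measurability of a parameter integral. For
  \<open>r = \<infinity>\<close> the essential supremum exceeds \<open>y\<close> exactly if the
  superlevel set has positive measure, and that measure depends measurably on
  \<open>(t, x)\<close>.\<close>

lemma measurable_box_mean_tent_region:
  fixes h :: "real \<times> (real ^ 'd) \<Rightarrow> ennreal"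
  assumes h: "h \<in> borel_measurable borel"
  shows "(\<lambda>z. box_mean r (fst z) (tent_region (fst z) (snd z)) h) \<in> borel_measurable (borel \<Otimes>\<^sub>M borel)"
proof -
  let ?M = "(borel \<Otimes>\<^sub>M borel) \<Otimes>\<^sub>M (lborel :: (real \<times> (real ^ 'd)) measure)"
  have hm: "h \<in> borel_measurable (borel \<Otimes>\<^sub>M borel)" using h by (simp add: borel_prod)
  have sM: "sets ?M = sets ((borel \<Otimes>\<^sub>M borel) \<Otimes>\<^sub>M (borel \<Otimes>\<^sub>M (borel :: (real ^ 'd) measure)))"
    by (intro sets_pair_measure_cong) (simp_all only: sets_lborel borel_prod)
  have h2[measurable]: "(\<lambda>p. h (snd p)) \<in> borel_measurable ?M"
    using h by (intro measurable_compose[OF measurable_snd]) simp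
  have ind: "(\<lambda>p. indicator (tent_region (fst (fst p)) (snd (fst p))) (snd p) :: ennreal) \<in> borel_measurable ?M"
  proof -
    have "Measurable.pred ((borel \<Otimes>\<^sub>M borel) \<Otimes>\<^sub>M (borel \<Otimes>\<^sub>M borel))
       (\<lambda>p :: (real \<times> (real ^ 'd)) \<times> (real \<times> (real ^ 'd)). fst (fst p) / 2 < fst (snd p) \<and> fst (snd p) \<le> fst (fst p) \<and> dist (snd (fst p)) (snd (snd p)) < fst (fst p))"
      by measurable
    then have "Measurable.pred ?M (\<lambda>p. snd p \<in> tent_region (fst (fst p)) (snd (fst p)))"
      by (simp add: tent_region_def mem_Times_iff measurable_cong_sets[OF sM refl])
    then show ?thesis
      unfolding indicator_def by measurable
  qed
  have lift: "(\<lambda>z. \<integral>\<^sup>+w. g (z, w) \<partial>lborel) \<in> borel_measurable (borel \<Otimes>\<^sub>M borel)"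
    if "g \<in> borel_measurable ?M" for g :: "(real \<times> (real ^ 'd)) \<times> (real \<times> (real ^ 'd)) \<Rightarrow> ennreal"
    using that by (intro lborel.borel_measurable_nn_integral) (simp add: case_prod_beta)
  show ?thesis
  proof (cases "r = \<infinity>")
    case True
    show ?thesis
    proof (rule borel_measurableI_greater)
      fix y :: ennreal
      let ?S = "\<lambda>z. {w. y < h w * indicator (tent_region (fst z) (snd z)) w}"
      have S[measurable]: "?S z \<in> sets borel" for z
      proof -
        have [measurable]: "h \<in> borel_measurable borel" by (rule h)
        show ?thesis by measurable
      qed
      have iff: "y < esssup lborel (\<lambda>w. h w * indicator (tent_region (fst z) (snd z)) w) \<longleftrightarrow> 0 < emeasure lborel (?S z)" for z
      proof
        assume "y < esssup lborel (\<lambda>w. h w * indicator (tent_region (fst z) (snd z)) w)"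
        moreover have "(\<lambda>w. h w * indicator (tent_region (fst z) (snd z)) w) \<in> borel_measurable lborel"
          using h by simp
        ultimately show "0 < emeasure lborel (?S z)"
          using esssup_pos_measure[of "\<lambda>w. h w * indicator (tent_region (fst z) (snd z)) w" lborel y] by simp
      next
        assume pos: "0 < emeasure lborel (?S z)"
        show "y < esssup lborel (\<lambda>w. h w * indicator (tent_region (fst z) (snd z)) w)"
        proof (rule ccontr)
          assume "\<not> ?thesis"
          then have le: "esssup lborel (\<lambda>w. h w * indicator (tent_region (fst z) (snd z)) w) \<le> y" by simp
          have "AE w in lborel. w \<notin> ?S z"
            using esssup_AE[of "\<lambda>w. h w * indicator (tent_region (fst z) (snd z)) w" lborel]
            by eventually_elim (use le in \<open>auto simp: not_less\<close>)
          then have "emeasure lborel (?S z) = 0"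
            by (subst (asm) AE_iff_measurable[OF _ refl]) auto
          with pos show False by simp
        qed
      qed
      have "(\<lambda>p. h (snd p) * indicator (tent_region (fst (fst p)) (snd (fst p))) (snd p)) \<in> borel_measurable ?M"
        using h2 ind by (rule borel_measurable_times_ennreal)
      from lborel.measurable_emeasure_Pair[OF borel_measurable_less[OF borel_measurable_const this, of y]]
      have "(\<lambda>z. emeasure lborel (?S z)) \<in> borel_measurable (borel \<Otimes>\<^sub>M borel)"
        by (simp add: space_pair_measure vimage_def)
      then have "{z \<in> space (borel \<Otimes>\<^sub>M borel). 0 < emeasure lborel (?S z)} \<in> sets (borel \<Otimes>\<^sub>M (borel :: (real ^ 'd) measure))"
        by measurable
      then show "{z \<in> space (borel \<Otimes>\<^sub>M borel). y < box_mean r (fst z) (tent_region (fst z) (snd z)) h} \<in> sets (borel \<Otimes>\<^sub>M (borel :: (real ^ 'd) measure))"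
        using True by (simp add: box_mean_def iff)
    qed
  next
    case False
    have "(\<lambda>p. epowr (h (snd p)) (enn2real r) * indicator (tent_region (fst (fst p)) (snd (fst p))) (snd p)) \<in> borel_measurable ?M"
      using ind h2 by (intro borel_measurable_times_ennreal measurable_epowr)
    from lift[OF this] have [measurable]: "(\<lambda>z. \<integral>\<^sup>+w. epowr (h w) (enn2real r) * indicator (tent_region (fst z) (snd z)) w \<partial>lborel) \<in> borel_measurable (borel \<Otimes>\<^sub>M (borel :: (real ^ 'd) measure))"
      by simp
    show ?thesis using False by (simp add: box_mean_def)
  qed
qed

text \<open>A Borel function is needed to apply Fubini's theorem to the means in the definition of \<open>W_fun\<close>.\<close>

lemma borel_representative:
  fixes f :: "real \<times> (real ^ 'd) \<Rightarrow> complex"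
  assumes f: "f \<in> borel_measurable (lebesgue_on ({0<..} \<times> UNIV))"
  obtains h where "h \<in> borel_measurable borel"
    "AE z in lborel. 0 < fst z \<longrightarrow> ennreal (fst z powr (- \<beta>) * norm (f z)) = h z"
proof -
  let ?H = "{0<..} \<times> UNIV :: (real \<times> (real ^ 'd)) set"
  have H: "?H \<in> sets lebesgue" by (intro sets_completionI_sets) (simp add: borel_Times)
  have [measurable]: "fst \<in> borel_measurable (lebesgue_on ?H)"
    by (intro measurable_restrict_space1 measurable_completion) (simp add: borel_measurable_continuous_onI continuous_on_fst)
  note f[measurable]
  have "(\<lambda>z. ennreal (fst z powr (- \<beta>) * norm (f z))) \<in> borel_measurable (lebesgue_on ?H)"
    by measurable
  then have "(\<lambda>z. ennreal (fst z powr (- \<beta>) * norm (f z)) * indicator ?H z) \<in> borel_measurable (completion lborel)"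
    using H by (subst (asm) borel_measurable_restrict_space_iff_ennreal) auto
  from completion_ex_borel_measurable[OF this] obtain h where h: "h \<in> borel_measurable lborel"
    "AE z in lborel. ennreal (fst z powr (- \<beta>) * norm (f z)) * indicator ?H z = h z" by blast
  from h(2) have "AE z in lborel. 0 < fst z \<longrightarrow> ennreal (fst z powr (- \<beta>) * norm (f z)) = h z"
    by eventually_elim (auto simp: indicator_def split: if_splits)
  with h(1) show ?thesis by (intro that[of h]) auto
qed

text \<open>\<open>2 / unit_ball_vol CARD('d)\<close> is the reciprocal volume of the tent region in
  units of \<open>t^(d + 1)\<close>. \<open>f\<close> enters through an iterated mean, so for finite
  \<open>r\<close> the almost everywhere identity with \<open>h\<close> is passed to slices before
  Tonelli is applied to \<open>h\<close>.\<close>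

lemma W_fun_eq_box_mean:
  fixes f :: "real \<times> (real ^ 'd) \<Rightarrow> complex"
  assumes r: "0 < r" and t: "0 < t"
    and f: "f \<in> borel_measurable (lebesgue_on ({0<..} \<times> UNIV))"
    and h[measurable]: "h \<in> borel_measurable borel"
    and ae: "AE z in lborel. 0 < fst z \<longrightarrow> ennreal (fst z powr (- \<beta>) * norm (f z)) = h z"
  shows "W_fun r \<beta> f t x = ennreal (root_const r (2 / unit_ball_vol CARD('d))) * box_mean r t (tent_region t x) h"
proof (cases "r = \<infinity>")
  case True
  let ?R = "tent_region t x" and ?H = "{0<..} \<times> UNIV :: (real \<times> (real ^ 'd)) set"
  let ?g = "\<lambda>z. ennreal (norm (fst z powr (- \<beta>) *\<^sub>R f z))"
  have R: "?R \<in> sets lebesgue" by (intro sets_completionI_sets) simp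
  have RH: "?R \<subseteq> ?H" using t by (auto simp: tent_region_def)
  have gm: "?g \<in> borel_measurable (lebesgue_on ?R)"
  proof -
    have "fst \<in> borel_measurable (lebesgue_on ?R)"
      by (intro measurable_restrict_space1 measurable_completion) (simp add: borel_measurable_continuous_onI continuous_on_fst)
    moreover have "f \<in> borel_measurable (lebesgue_on ?R)"
      using f RH by (rule measurable_restrict_mono)
    ultimately show ?thesis by measurable
  qed
  have iff: "(AE z in lebesgue_on ?R. ?g z \<le> c) \<longleftrightarrow> (AE z in lborel. h z * indicator ?R z \<le> c)" for c
  proof -
    have "(AE z in lebesgue_on ?R. ?g z \<le> c) \<longleftrightarrow> (AE z in lborel. z \<in> ?R \<longrightarrow> ?g z \<le> c)"
      using R by (simp add: AE_restrict_space_iff AE_completion_iff)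
    also have "\<dots> \<longleftrightarrow> (AE z in lborel. h z * indicator ?R z \<le> c)"
    proof (rule eventually_subst)
      show "AE z in lborel. (z \<in> ?R \<longrightarrow> ?g z \<le> c) \<longleftrightarrow> (h z * indicator ?R z \<le> c)"
        using ae
      proof eventually_elim
        case (elim z)
        show ?case
        proof (cases "z \<in> ?R")
          case True
          with RH have "0 < fst z" by auto
          with elim True show ?thesis by simp
        qed simp
      qed
    qed
    finally show ?thesis .
  qed
  have hm: "(\<lambda>z. h z * indicator ?R z) \<in> borel_measurable lborel" by simp
  have "esssup (lebesgue_on ?R) ?g = esssup lborel (\<lambda>z. h z * indicator ?R z)"
    unfolding esssup_eq_AE[OF gm] esssup_eq_AE[OF hm] iff ..
  then show ?thesis using True
    by (simp add: W_fun_def box_mean_def root_const_def tent_region_def case_prod_beta')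
next
  case False
  let ?r = "enn2real r" and ?w = "unit_ball_vol CARD('d)" and ?d = "CARD('d)"
  have r': "0 < ?r" using r False by (rule enn2real_pos)
  have w: "0 < ?w" by simp
  let ?F = "\<lambda>s y. ennreal (norm (s powr (- \<beta>) *\<^sub>R f (s, y)) powr ?r)"
  let ?c = "ennreal (1 / (?w * t ^ ?d))"
  have hm: "(\<lambda>z. epowr (h z) ?r * indicator (tent_region t x) z) \<in> borel_measurable (lborel \<Otimes>\<^sub>M lborel)"
    by (simp add: lborel_prod)
  have ae2: "AE s in lborel. AE y in lborel. 0 < s \<longrightarrow> ennreal (s powr (- \<beta>) * norm (f (s, y))) = h (s, y)"
  proof -
    have "AE z in lborel \<Otimes>\<^sub>M lborel. 0 < fst z \<longrightarrow> ennreal (fst z powr (- \<beta>) * norm (f z)) = h z"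
      unfolding lborel_prod by (rule ae)
    from lborel_pair.AE_pair[OF this] show ?thesis by simp
  qed
  have "mean_integral {t / 2<..t} (\<lambda>s. mean_integral (ball x t) (?F s))
      = (\<integral>\<^sup>+s\<in>{t / 2<..t}. (\<integral>\<^sup>+y\<in>ball x t. ?F s y \<partial>lborel) * ?c \<partial>lborel) * ennreal (2 / t)"
  proof -
    have "emeasure lebesgue {t / 2<..t} = ennreal (t / 2)" using t by simp
    moreover have "inverse (ennreal (t / 2)) = ennreal (2 / t)" using t by (simp add: inverse_ennreal)
    ultimately show ?thesis unfolding mean_integral_ball[OF t]
      by (simp only: mean_integral_def nn_integral_completion divide_ennreal_def)
  qed
  also have "(\<integral>\<^sup>+s\<in>{t / 2<..t}. (\<integral>\<^sup>+y\<in>ball x t. ?F s y \<partial>lborel) * ?c \<partial>lborel)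
     = (\<integral>\<^sup>+s. (\<integral>\<^sup>+y. epowr (h (s, y)) ?r * indicator (tent_region t x) (s, y) \<partial>lborel) * ?c \<partial>lborel)"
  proof (rule nn_integral_cong_AE)
    show "AE s in lborel. (\<integral>\<^sup>+y\<in>ball x t. ?F s y \<partial>lborel) * ?c * indicator {t / 2<..t} s
       = (\<integral>\<^sup>+y. epowr (h (s, y)) ?r * indicator (tent_region t x) (s, y) \<partial>lborel) * ?c"
      using ae2
    proof eventually_elim
      case (elim s)
      show ?case
      proof (cases "s \<in> {t / 2<..t}")
        case True
        then have s: "0 < s" using t by auto
        have "(\<integral>\<^sup>+y\<in>ball x t. ?F s y \<partial>lborel) = (\<integral>\<^sup>+y. epowr (h (s, y)) ?r * indicator (tent_region t x) (s, y) \<partial>lborel)"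
        proof (rule nn_integral_cong_AE)
          show "AE y in lborel. ?F s y * indicator (ball x t) y = epowr (h (s, y)) ?r * indicator (tent_region t x) (s, y)"
            using elim
          proof eventually_elim
            case (elim y)
            with s have "h (s, y) = ennreal (norm (s powr (- \<beta>) *\<^sub>R f (s, y)))" by simp
            then have "epowr (h (s, y)) ?r = ?F s y" by (simp only: epowr_ennreal[OF norm_ge_zero])
            then show ?case using True by (auto simp: tent_region_def indicator_def)
          qed
        qed
        with True show ?thesis by simp
      next
        case False
        then have "indicator (tent_region t x) (s, y) = (0 :: ennreal)" for y
          by (auto simp: tent_region_def indicator_def)
        with False show ?thesis by simp
      qed
    qed
  qed
  also have "\<dots> = (\<integral>\<^sup>+s. (\<integral>\<^sup>+y. epowr (h (s, y)) ?r * indicator (tent_region t x) (s, y) \<partial>lborel) \<partial>lborel) * ?c"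
    using lborel.borel_measurable_nn_integral_fst[OF hm] by (intro nn_integral_multc) simp
  also have "(\<integral>\<^sup>+s. (\<integral>\<^sup>+y. epowr (h (s, y)) ?r * indicator (tent_region t x) (s, y) \<partial>lborel) \<partial>lborel)
     = (\<integral>\<^sup>+z\<in>tent_region t x. epowr (h z) ?r \<partial>lborel)"
    using lborel.nn_integral_fst[OF hm] by (simp add: lborel_prod)
  also have "(\<integral>\<^sup>+z\<in>tent_region t x. epowr (h z) ?r \<partial>lborel) * ?c * ennreal (2 / t)
     = ennreal (2 / ?w) * (ennreal (1 / t ^ (?d + 1)) * (\<integral>\<^sup>+z\<in>tent_region t x. epowr (h z) ?r \<partial>lborel))"
  proof -
    let ?J = "\<integral>\<^sup>+z\<in>tent_region t x. epowr (h z) ?r \<partial>lborel"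
    have "?c * ennreal (2 / t) = ennreal (1 / (?w * t ^ ?d) * (2 / t))"
      by (rule ennreal_mult[symmetric]) (use t w in auto)
    also have "1 / (?w * t ^ ?d) * (2 / t) = 2 / ?w * (1 / t ^ (?d + 1))" by simp
    also have "ennreal (2 / ?w * (1 / t ^ (?d + 1))) = ennreal (2 / ?w) * ennreal (1 / t ^ (?d + 1))"
      by (rule ennreal_mult) (use t w in auto)
    finally have eq: "?c * ennreal (2 / t) = ennreal (2 / ?w) * ennreal (1 / t ^ (?d + 1))" .
    have "?J * ?c * ennreal (2 / t) = ?J * (?c * ennreal (2 / t))" by (rule mult.assoc)
    also have "\<dots> = ennreal (2 / ?w) * (ennreal (1 / t ^ (?d + 1)) * ?J)"
      unfolding eq by (simp only: mult_ac)
    finally show ?thesis .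
  qed
  finally show ?thesis using False w
    by (simp add: W_fun_def box_mean_def root_const_def epowr_mult epowr_ennreal)
qed

text \<open>The power of the time variable is essentially constant on a Whitney box; the absolute
  value in the constant covers both signs of \<open>b\<close>.\<close>

lemma powr_doubling:
  fixes s L b :: real
  assumes "0 < s" "s \<le> L" "L \<le> 2 * s"
  shows "s powr b \<le> 2 powr \<bar>b\<bar> * L powr b" "L powr b \<le> 2 powr \<bar>b\<bar> * s powr b"
proof -
  have ge1: "1 \<le> 2 powr \<bar>b\<bar>" by (simp add: ge_one_powr_ge_zero)
  have grow: "z \<le> 2 powr \<bar>b\<bar> * z" if "0 \<le> z" for z
    using mult_right_mono[OF ge1 that] by simp
  have "s powr b \<le> 2 powr \<bar>b\<bar> * L powr b \<and> L powr b \<le> 2 powr \<bar>b\<bar> * s powr b"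
  proof (cases "0 \<le> b")
    case True
    have "s powr b \<le> L powr b" using assms True by (intro powr_mono2) auto
    moreover have "L powr b \<le> (2 * s) powr b" using assms True by (intro powr_mono2) auto
    then have "L powr b \<le> 2 powr \<bar>b\<bar> * s powr b" using assms True by (simp add: powr_mult)
    ultimately show ?thesis using grow[of "L powr b"] by simp
  next
    case False
    have "L powr b \<le> s powr b" using assms False by (intro powr_mono2') auto
    moreover have "(2 * s) powr b \<le> L powr b" using assms False by (intro powr_mono2') auto
    then have "2 powr b * s powr b \<le> L powr b" using assms by (simp add: powr_mult)
    then have "s powr b \<le> 2 powr \<bar>b\<bar> * L powr b"
      using False by (simp add: powr_minus field_simps)
    ultimately show ?thesis using grow[of "s powr b"] by simp
  qed
  then show "s powr b \<le> 2 powr \<bar>b\<bar> * L powr b" "L powr b \<le> 2 powr \<bar>b\<bar> * s powr b" by auto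
qed

lemma box_mean_cmult_mono:
  fixes u v :: "real \<times> (real ^ 'd) \<Rightarrow> ennreal"
  assumes r: "0 < r" and K: "0 \<le> K" and [measurable]: "u \<in> borel_measurable borel" "v \<in> borel_measurable borel" "B \<in> sets borel"
    and le: "\<And>z. z \<in> B \<Longrightarrow> u z \<le> ennreal K * v z"
  shows "box_mean r l B u \<le> ennreal K * box_mean r l B v"
proof (cases "r = \<infinity>")
  case True
  have "esssup lborel (\<lambda>z. u z * indicator B z) \<le> ennreal K * esssup lborel (\<lambda>z. v z * indicator B z)"
  proof (rule esssup_I)
    show "AE z in lborel. u z * indicator B z \<le> ennreal K * esssup lborel (\<lambda>z. v z * indicator B z)"
      using esssup_AE[of "\<lambda>z. v z * indicator B z" lborel]
    proof eventually_elim
      case (elim z)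
      show ?case
      proof (cases "z \<in> B")
        case True
        have "ennreal K * v z \<le> ennreal K * esssup lborel (\<lambda>z. v z * indicator B z)"
          using mult_left_mono[OF elim, of "ennreal K"] True by simp
        with le[OF True] True show ?thesis by simp
      qed simp
    qed
  qed measurable
  then show ?thesis using True by (simp add: box_mean_def)
next
  case False
  let ?r = "enn2real r"
  have r': "0 < ?r" using r False by (rule enn2real_pos)
  let ?I = "\<lambda>h. \<integral>\<^sup>+z\<in>B. epowr (h z) ?r \<partial>lborel"
  have "?I u \<le> (\<integral>\<^sup>+z. ennreal (K powr ?r) * (epowr (v z) ?r * indicator B z) \<partial>lborel)"
  proof (rule nn_integral_mono)
    fix z
    show "epowr (u z) ?r * indicator B z \<le> ennreal (K powr ?r) * (epowr (v z) ?r * indicator B z)"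
    proof (cases "z \<in> B")
      case True
      with epowr_mono[OF _ le[OF True], of ?r] r' K show ?thesis
        by (simp add: epowr_mult epowr_ennreal)
    qed simp
  qed
  also have "\<dots> = ennreal (K powr ?r) * ?I v"
    by (rule nn_integral_cmult) measurable
  finally have "ennreal (1 / l ^ (CARD('d) + 1)) * ?I u \<le> ennreal (1 / l ^ (CARD('d) + 1)) * (ennreal (K powr ?r) * ?I v)"
    by (rule mult_left_mono) simp
  also have "\<dots> = ennreal (K powr ?r) * (ennreal (1 / l ^ (CARD('d) + 1)) * ?I v)"
    by (rule mult.left_commute)
  finally show ?thesis
    using epowr_root_le[OF _ _ r', of _ "K powr ?r"] False r' K by (simp add: box_mean_def powr_powr)
qed

text \<open>On the box the time \<open>s\<close> lies between \<open>L / 2\<close> and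
  \<open>L\<close>, so the weight \<open>1 / s^(d + 1)\<close> is within a factor
  \<open>2^(d + 1)\<close> of its value at \<open>L\<close>. For \<open>r = \<infinity>\<close> the
  weight matters only through its positivity.\<close>

lemma whitney_norm_box_mean:
  fixes f :: "real \<times> (real ^ 'd) \<Rightarrow> complex"
  assumes r: "0 < r"
    and f: "f \<in> borel_measurable (lebesgue_on ({0<..} \<times> UNIV))"
    and g[measurable]: "g \<in> borel_measurable borel"
    and ae: "AE z in lborel. 0 < fst z \<longrightarrow> ennreal (norm (f z)) = g z"
  shows "box_mean r (2 powi k) (whitney_box (cube k n)) g \<le> whitney_norm r f (cube k n)"
    and "whitney_norm r f (cube k n) \<le> ennreal (root_const r (2 ^ (CARD('d) + 1))) * box_mean r (2 powi k) (whitney_box (cube k n)) g"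
proof -
  let ?L = "2 powi k :: real" and ?B = "whitney_box (cube k n)" and ?d = "CARD('d) + 1"
  let ?w = "\<lambda>(s, y). ennreal (1 / s ^ ?d)"
  let ?M = "density (lebesgue_on ?B) ?w"
  let ?g = "\<lambda>z. ennreal (norm (f z))"
  have [measurable]: "?B \<in> sets borel" by (rule sets_whitney_box)
  have B: "?B \<in> sets lebesgue" by (intro sets_completionI_sets) simp
  note inB = whitney_boxD[of _ k n]
  have "fst \<in> borel_measurable (lebesgue_on ?B)"
    by (intro measurable_restrict_space1 measurable_completion) (simp add: borel_measurable_continuous_onI continuous_on_fst)
  then have w: "?w \<in> borel_measurable (lebesgue_on ?B)"
    unfolding case_prod_beta by measurable
  have "f \<in> borel_measurable (lebesgue_on ?B)"
    using f by (rule measurable_restrict_mono) (use inB in auto)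
  then have gB: "?g \<in> borel_measurable (lebesgue_on ?B)" by measurable
  have aeB: "AE z in lborel. z \<in> ?B \<longrightarrow> ?g z = g z"
    using ae by eventually_elim (use inB(1) in blast)
  have "box_mean r ?L ?B g \<le> whitney_norm r f (cube k n) \<and>
    whitney_norm r f (cube k n) \<le> ennreal (root_const r (2 ^ ?d)) * box_mean r ?L ?B g"
  proof (cases "r = \<infinity>")
    case True
    have iff: "(AE z in ?M. ?g z \<le> e) \<longleftrightarrow> (AE z in lborel. g z * indicator ?B z \<le> e)" for e
    proof -
      have "(AE z in ?M. ?g z \<le> e) \<longleftrightarrow> (AE z in lebesgue_on ?B. 0 < ?w z \<longrightarrow> ?g z \<le> e)"
        by (rule AE_density[OF w])
      also have "\<dots> \<longleftrightarrow> (AE z in lborel. z \<in> ?B \<longrightarrow> 0 < ?w z \<longrightarrow> ?g z \<le> e)"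
        using B by (simp add: AE_restrict_space_iff AE_completion_iff)
      also have "\<dots> \<longleftrightarrow> (AE z in lborel. g z * indicator ?B z \<le> e)"
      proof (rule eventually_subst)
        show "AE z in lborel. (z \<in> ?B \<longrightarrow> 0 < ?w z \<longrightarrow> ?g z \<le> e) \<longleftrightarrow> g z * indicator ?B z \<le> e"
          using aeB
        proof eventually_elim
          case (elim z)
          show ?case
          proof (cases "z \<in> ?B")
            case True
            with elim inB(1)[OF True] show ?thesis by (cases z) auto
          qed simp
        qed
      qed
      finally show ?thesis .
    qed
    have gM: "?g \<in> borel_measurable ?M" using gB by simp
    have gm: "(\<lambda>z. g z * indicator ?B z) \<in> borel_measurable lborel" by measurable
    have "whitney_norm r f (cube k n) = esssup ?M ?g"
      unfolding whitney_norm_def Lp_norm_def if_P[OF True] ..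
    also have "\<dots> = esssup lborel (\<lambda>z. g z * indicator ?B z)"
      unfolding esssup_eq_AE[OF gM] esssup_eq_AE[OF gm] iff ..
    finally show ?thesis using True by (simp add: box_mean_def root_const_def)
  next
    case False
    let ?r = "enn2real r"
    have r': "0 < ?r" using r False by (rule enn2real_pos)
    let ?I = "\<integral>\<^sup>+z\<in>?B. ennreal (1 / fst z ^ ?d) * epowr (g z) ?r \<partial>lborel" and ?J = "\<integral>\<^sup>+z\<in>?B. epowr (g z) ?r \<partial>lborel"
    have "(\<integral>\<^sup>+z. epowr (?g z) ?r \<partial>?M) = (\<integral>\<^sup>+z. ?w z * epowr (?g z) ?r \<partial>lebesgue_on ?B)"
      by (intro nn_integral_density w measurable_epowr gB)
    also have "\<dots> = (\<integral>\<^sup>+z\<in>?B. ennreal (1 / fst z ^ ?d) * epowr (?g z) ?r \<partial>lborel)"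
      using B by (simp add: nn_integral_restrict_space nn_integral_completion case_prod_beta)
    also have "\<dots> = ?I"
    proof (rule nn_integral_cong_AE)
      show "AE z in lborel. ennreal (1 / fst z ^ ?d) * epowr (?g z) ?r * indicator ?B z
        = ennreal (1 / fst z ^ ?d) * epowr (g z) ?r * indicator ?B z"
        using aeB by eventually_elim (auto simp: indicator_def)
    qed
    finally have I: "whitney_norm r f (cube k n) = epowr ?I (1 / ?r)"
      using False by (simp add: whitney_norm_def Lp_norm_def)
    have "ennreal (1 / ?L ^ ?d) * ?J = (\<integral>\<^sup>+z. ennreal (1 / ?L ^ ?d) * (epowr (g z) ?r * indicator ?B z) \<partial>lborel)"
      by (rule nn_integral_cmult[symmetric]) measurable
    also have "\<dots> \<le> ?I"
    proof (rule nn_integral_mono)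
      fix z
      show "ennreal (1 / ?L ^ ?d) * (epowr (g z) ?r * indicator ?B z) \<le> ennreal (1 / fst z ^ ?d) * epowr (g z) ?r * indicator ?B z"
      proof (cases "z \<in> ?B")
        case True
        have "1 / ?L ^ ?d \<le> 1 / fst z ^ ?d"
          using inB[OF True] by (intro divide_left_mono power_mono) auto
        from mult_right_mono[OF ennreal_leI[OF this], of "epowr (g z) ?r"] True show ?thesis by simp
      qed simp
    qed
    finally have 1: "ennreal (1 / ?L ^ ?d) * ?J \<le> ennreal 1 * ?I" by simp
    have "?I \<le> (\<integral>\<^sup>+z. ennreal (2 ^ ?d * (1 / ?L ^ ?d)) * (epowr (g z) ?r * indicator ?B z) \<partial>lborel)"
    proof (rule nn_integral_mono)
      fix z
      show "ennreal (1 / fst z ^ ?d) * epowr (g z) ?r * indicator ?B z \<le> ennreal (2 ^ ?d * (1 / ?L ^ ?d)) * (epowr (g z) ?r * indicator ?B z)"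
      proof (cases "z \<in> ?B")
        case True
        have "?L ^ ?d \<le> (2 * fst z) ^ ?d" using inB[OF True] by (intro power_mono) auto
        then have "1 / fst z ^ ?d \<le> 2 ^ ?d * (1 / ?L ^ ?d)"
          using inB[OF True] by (simp add: power_mult_distrib field_simps)
        from mult_right_mono[OF ennreal_leI[OF this], of "epowr (g z) ?r"] True show ?thesis by simp
      qed simp
    qed
    also have "\<dots> = ennreal (2 ^ ?d * (1 / ?L ^ ?d)) * ?J"
      by (rule nn_integral_cmult) measurable
    also have "ennreal (2 ^ ?d * (1 / ?L ^ ?d)) = ennreal (2 ^ ?d) * ennreal (1 / ?L ^ ?d)"
      by (rule ennreal_mult) auto
    finally have 2: "?I \<le> ennreal (2 ^ ?d) * (ennreal (1 / ?L ^ ?d) * ?J)" by (simp only: mult.assoc)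
    show ?thesis
      using epowr_root_le[OF 1 _ r'] epowr_root_le[OF 2 _ r'] False
      by (simp add: I box_mean_def root_const_def)
  qed
  then show "box_mean r ?L ?B g \<le> whitney_norm r f (cube k n)"
    "whitney_norm r f (cube k n) \<le> ennreal (root_const r (2 ^ ?d)) * box_mean r ?L ?B g" by auto
qed

text \<open>\<open>|Q|^(-\<beta> / d)\<close> equals \<open>L powr (-\<beta>)\<close>, which is
  comparable to \<open>s powr (-\<beta>)\<close> on the box, so the weight can be moved inside the
  mean.\<close>

lemma whitney_coeff_box_mean:
  fixes f :: "real \<times> (real ^ 'd) \<Rightarrow> complex"
  assumes r: "0 < r"
    and f: "f \<in> borel_measurable (lebesgue_on ({0<..} \<times> UNIV))"
    and h[measurable]: "h \<in> borel_measurable borel"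
    and ae: "AE z in lborel. 0 < fst z \<longrightarrow> ennreal (fst z powr (- \<beta>) * norm (f z)) = h z"
  shows "box_mean r (2 powi k) (whitney_box (cube k n)) h \<le> ennreal (2 powr \<bar>\<beta>\<bar>) * whitney_coeff r \<beta> f k n"
    and "whitney_coeff r \<beta> f k n \<le> ennreal (2 powr \<bar>\<beta>\<bar> * root_const r (2 ^ (CARD('d) + 1))) * box_mean r (2 powi k) (whitney_box (cube k n)) h"
proof -
  let ?L = "2 powi k :: real" and ?B = "whitney_box (cube k n)" and ?c = "root_const r (2 ^ (CARD('d) + 1))"
  have L: "0 < ?L" by simp
  note B = sets_whitney_box[of k n] and inB = whitney_boxD[of _ k n]
  \<comment> \<open>\<open>h\<close> represents the weighted modulus of \<open>f\<close>; undoing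
    the weight gives a Borel representative of the modulus itself, to which the unweighted
    comparison applies.\<close>
  define g where "g z = ennreal (fst z powr \<beta>) * h z" for z
  have g[measurable]: "g \<in> borel_measurable borel"
  proof -
    have [measurable]: "(fst :: real \<times> (real ^ 'd) \<Rightarrow> real) \<in> borel_measurable borel"
      by (simp add: borel_measurable_continuous_onI continuous_on_fst)
    show ?thesis unfolding g_def by measurable
  qed
  have "AE z in lborel. 0 < fst z \<longrightarrow> ennreal (norm (f z)) = g z"
    using ae
  proof eventually_elim
    case (elim z)
    show ?case
    proof
      assume z: "0 < fst z"
      with elim have "h z = ennreal (fst z powr (- \<beta>) * norm (f z))" by simp
      moreover have "fst z powr \<beta> * (fst z powr (- \<beta>) * norm (f z)) = norm (f z)"
        using z by (simp add: powr_minus)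
      ultimately show "ennreal (norm (f z)) = g z"
        by (simp add: g_def flip: ennreal_mult)
    qed
  qed
  note wn = whitney_norm_box_mean[OF r f g this, of k n]
  have "measure lebesgue (cube k n) powr (- \<beta> / CARD('d)) = ?L powr (- \<beta>)"
    using L by (simp add: measure_cube powr_powr flip: powr_realpow)
  then have coeff: "whitney_coeff r \<beta> f k n = ennreal (?L powr (- \<beta>)) * whitney_norm r f (cube k n)"
    by (simp add: whitney_coeff_def)
  note pw = powr_doubling[OF inB, of _ \<beta>]
  have 1: "box_mean r ?L ?B h \<le> ennreal (2 powr \<bar>\<beta>\<bar> * ?L powr (- \<beta>)) * box_mean r ?L ?B g"
  proof (rule box_mean_cmult_mono[OF r _ h g B])
    fix z assume z: "z \<in> ?B"
    have "1 \<le> 2 powr \<bar>\<beta>\<bar> * ?L powr (- \<beta>) * fst z powr \<beta>"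
      using pw(2)[OF z z z] L by (simp add: powr_minus field_simps)
    from mult_right_mono[OF ennreal_leI[OF this], of "h z"]
    show "h z \<le> ennreal (2 powr \<bar>\<beta>\<bar> * ?L powr (- \<beta>)) * g z"
      by (simp add: g_def ennreal_mult mult.assoc)
  qed simp
  have 2: "box_mean r ?L ?B g \<le> ennreal (2 powr \<bar>\<beta>\<bar> * ?L powr \<beta>) * box_mean r ?L ?B h"
  proof (rule box_mean_cmult_mono[OF r _ g h B])
    fix z assume z: "z \<in> ?B"
    from mult_right_mono[OF ennreal_leI[OF pw(1)[OF z z z]], of "h z"]
    show "g z \<le> ennreal (2 powr \<bar>\<beta>\<bar> * ?L powr \<beta>) * h z" by (simp add: g_def)
  qed simp
  show "box_mean r ?L ?B h \<le> ennreal (2 powr \<bar>\<beta>\<bar>) * whitney_coeff r \<beta> f k n"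
    using order_trans[OF 1 mult_left_mono[OF wn(1)]] by (simp add: coeff ennreal_mult mult.assoc)
  have "whitney_coeff r \<beta> f k n \<le> ennreal (?L powr (- \<beta>)) * (ennreal ?c * (ennreal (2 powr \<bar>\<beta>\<bar> * ?L powr \<beta>) * box_mean r ?L ?B h))"
    unfolding coeff by (intro mult_left_mono order_trans[OF wn(2)] 2) auto
  also have "\<dots> = ennreal (?L powr (- \<beta>) * (?c * (2 powr \<bar>\<beta>\<bar> * ?L powr \<beta>))) * box_mean r ?L ?B h"
    by (simp add: ennreal_mult root_const_def mult.assoc del: power_Suc)
  also have "?L powr (- \<beta>) * (?c * (2 powr \<bar>\<beta>\<bar> * ?L powr \<beta>)) = 2 powr \<bar>\<beta>\<bar> * ?c"
    using L by (simp add: powr_minus field_simps)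
  finally show "whitney_coeff r \<beta> f k n \<le> ennreal (2 powr \<bar>\<beta>\<bar> * ?c) * box_mean r ?L ?B h" .
qed

section \<open>Whitney boxes against tent regions\<close>

lemma nn_integral_inverse_ge:
  assumes "0 < u" "u < v" "v \<le> w"
  shows "ennreal ((v - u) / w) \<le> (\<integral>\<^sup>+t\<in>{u<..v}. ennreal (1 / t) \<partial>lborel)"
proof -
  have "ennreal ((v - u) / w) = ennreal (1 / w) * ennreal (v - u)"
    using assms by (simp flip: ennreal_mult)
  also have "\<dots> = (\<integral>\<^sup>+t. ennreal (1 / w) * indicator {u<..v} t \<partial>lborel)"
    using assms by (subst nn_integral_cmult_indicator) auto
  also have "\<dots> \<le> (\<integral>\<^sup>+t\<in>{u<..v}. ennreal (1 / t) \<partial>lborel)"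
  proof (rule nn_integral_mono)
    fix t
    have "1 / w \<le> 1 / t" if "t \<in> {u<..v}" using that assms by (intro divide_left_mono) auto
    then show "ennreal (1 / w) * indicator {u<..v} t \<le> ennreal (1 / t) * indicator {u<..v} t"
      by (auto simp: indicator_def intro: ennreal_leI)
  qed
  finally show ?thesis .
qed

text \<open>The times in the region meet at most two dyadic octaves, and
  \<open>dist x y < 2^K \<le> 2 * 2^l\<close> for both scales. The finer scale \<open>K - 1\<close>
  is the reason for allowing a radius of two side lengths.\<close>

lemma tent_region_covered:
  assumes t: "2 powi K / 2 < t" "t \<le> 2 powi K"
  shows "tent_region t x \<subseteq> (\<Union>(l, n)\<in>(SIGMA l:{K - 1, K}. {n. near n (grid_index l x)}). whitney_box (cube l n))"
proof
  fix z assume "z \<in> tent_region t x"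
  then obtain s y where z: "z = (s, y)" "t / 2 < s" "s \<le> t" "dist x y < t"
    by (auto simp: tent_region_def)
  have K: "(2::real) powi (K - 1) = 2 powi K / 2" by (simp add: power_int_diff)
  define l where "l = (if 2 powi K / 2 < s then K else K - 1)"
  have l: "l \<in> {K - 1, K}" "2 powi l / 2 < s" "s \<le> 2 powi l" "2 powi K \<le> 2 * (2 powi l :: real)"
    using z t K by (auto simp: l_def)
  have "near (grid_index l y) (grid_index l x)"
    using z(4) t(2) l(4) by (intro near_of_dist_less) (simp add: dist_commute)
  moreover have "z \<in> whitney_box (cube l (grid_index l y))"
    unfolding whitney_box_cube using l z(1) by (auto simp: cube_def)
  ultimately show "z \<in> (\<Union>(l, n)\<in>(SIGMA l:{K - 1, K}. {n. near n (grid_index l x)}). whitney_box (cube l n))"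
    using l(1) by (intro UN_I[of "(l, grid_index l y)"]) auto
qed

text \<open>Pigeonhole over the \<open>2 * 5^d\<close> boxes of the covering, two scales with
  \<open>5^d\<close> neighbours each, followed by a change of normalisation from \<open>t\<close> to
  the side length.\<close>

lemma W_fun_le_whitney_coeff:
  fixes f :: "real \<times> (real ^ 'd) \<Rightarrow> complex"
  assumes r: "0 < r" and t: "0 < t"
    and f: "f \<in> borel_measurable (lebesgue_on ({0<..} \<times> UNIV))"
    and h: "h \<in> borel_measurable borel"
    and ae: "AE z in lborel. 0 < fst z \<longrightarrow> ennreal (fst z powr (- \<beta>) * norm (f z)) = h z"
    and C: "root_const r (2 / unit_ball_vol CARD('d)) * (root_const r (2 * 5 ^ CARD('d)) * (root_const r (4 ^ (CARD('d) + 1)) * 2 powr \<bar>\<beta>\<bar>)) \<le> C"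
  shows "\<exists>l n. 2 powi l / 2 < t \<and> t \<le> 2 * 2 powi l \<and> x \<in> star l n \<and> W_fun r \<beta> f t x \<le> ennreal C * whitney_coeff r \<beta> f l n"
proof -
  obtain K :: int where K: "2 powi K / 2 < t" "t \<le> 2 powi K" using ex_dyadic_scale[OF t] by blast
  let ?I = "SIGMA l:{K - 1, K}. {n. near n (grid_index l x)}"
  have card: "card ?I = 2 * 5 ^ CARD('d)" by (subst card_SigmaI) (auto simp: card_near)
  have "\<exists>p\<in>?I. box_mean r t (tent_region t x) h \<le> ennreal (root_const r (2 * 5 ^ CARD('d))) * box_mean r t (case p of (l, n) \<Rightarrow> whitney_box (cube l n)) h"
  proof (rule box_mean_pigeonhole[OF r h])
    show "?I \<noteq> {}" using card by (intro notI) simp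
    show "finite ?I" by (intro finite_SigmaI) auto
    show "real (card ?I) \<le> 2 * 5 ^ CARD('d)" by (simp add: card)
    show "tent_region t x \<subseteq> (\<Union>p\<in>?I. case p of (l, n) \<Rightarrow> whitney_box (cube l n))" by (rule tent_region_covered[OF K])
    show "(case p of (l, n) \<Rightarrow> whitney_box (cube l n)) \<in> sets borel" if "p \<in> ?I" for p :: "int \<times> (int ^ 'd)"
      by (cases p) (simp add: sets_whitney_box)
  qed simp
  then obtain p where p: "p \<in> ?I"
    "box_mean r t (tent_region t x) h \<le> ennreal (root_const r (2 * 5 ^ CARD('d))) * box_mean r t (case p of (l, n) \<Rightarrow> whitney_box (cube l n)) h"
    by (rule bexE)
  obtain l n where "p = (l, n)" by (rule prod.exhaust)
  with p have ln: "(l, n) \<in> ?I" "box_mean r t (tent_region t x) h \<le> ennreal (root_const r (2 * 5 ^ CARD('d))) * box_mean r t (whitney_box (cube l n)) h"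
    by simp_all
  have K': "(2::real) powi (K - 1) = 2 powi K / 2" by (simp add: power_int_diff)
  have s: "(0::real) < 2 powi K" by simp
  have l: "2 powi l / 2 < t" "t \<le> 2 * 2 powi l" "2 powi l \<le> 4 * t"
    using ln(1) K K' s by auto
  have x: "x \<in> star l n" using ln(1) by (auto simp: star_def near_commute)
  note ln(2)
  also have "box_mean r t (whitney_box (cube l n)) h \<le> ennreal (root_const r (4 ^ (CARD('d) + 1))) * box_mean r (2 powi l) (whitney_box (cube l n)) h"
    by (rule box_mean_scale[OF r _ t l(3)]) simp
  also have "box_mean r (2 powi l) (whitney_box (cube l n)) h \<le> ennreal (2 powr \<bar>\<beta>\<bar>) * whitney_coeff r \<beta> f l n"
    by (rule whitney_coeff_box_mean(1)[OF r f h ae])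
  finally have "box_mean r t (tent_region t x) h \<le> ennreal (root_const r (2 * 5 ^ CARD('d))) *
     (ennreal (root_const r (4 ^ (CARD('d) + 1))) * (ennreal (2 powr \<bar>\<beta>\<bar>) * whitney_coeff r \<beta> f l n))"
    by (simp add: mult_left_mono)
  then have "W_fun r \<beta> f t x \<le> ennreal (root_const r (2 / unit_ball_vol CARD('d))) * (ennreal (root_const r (2 * 5 ^ CARD('d))) *
     (ennreal (root_const r (4 ^ (CARD('d) + 1))) * (ennreal (2 powr \<bar>\<beta>\<bar>) * whitney_coeff r \<beta> f l n)))"
    unfolding W_fun_eq_box_mean[OF r t f h ae] by (rule mult_left_mono) simp
  also have "\<dots> = ennreal (root_const r (2 / unit_ball_vol CARD('d)) * (root_const r (2 * 5 ^ CARD('d)) * (root_const r (4 ^ (CARD('d) + 1)) * 2 powr \<bar>\<beta>\<bar>))) * whitney_coeff r \<beta> f l n"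
    by (simp add: ennreal_mult root_const_pos less_imp_le mult.assoc del: power_Suc)
  also have "\<dots> \<le> ennreal C * whitney_coeff r \<beta> f l n"
    by (intro mult_right_mono ennreal_leI C) simp
  finally show ?thesis using l x by blast
qed

text \<open>The box is cut into two time halves and \<open>2^(N d)\<close> subcubes in space, and
  the piece with the largest mean is kept. \<open>N = 4 d\<close> makes a subcube so small that a
  ball of radius \<open>t > 3/4 L\<close> around any of its points contains it; each time half fits
  into \<open>(t / 2, t]\<close> for a whole interval of \<open>t\<close>.\<close>

lemma whitney_coeff_le_W_fun:
  fixes f :: "real \<times> (real ^ 'd) \<Rightarrow> complex" and n :: "int ^ 'd"
  assumes r: "0 < r"
    and f: "f \<in> borel_measurable (lebesgue_on ({0<..} \<times> UNIV))"
    and h: "h \<in> borel_measurable borel"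
    and ae: "AE z in lborel. 0 < fst z \<longrightarrow> ennreal (fst z powr (- \<beta>) * norm (f z)) = h z"
    and N: "N = 4 * CARD('d)"
    and C: "2 powr \<bar>\<beta>\<bar> * root_const r (2 ^ (CARD('d) + 1)) * (root_const r (2 * (2 ^ N) ^ CARD('d)) * (root_const r (4 ^ (CARD('d) + 1)) *
      (1 / root_const r (2 / unit_ball_vol CARD('d))))) \<le> C"
  shows "\<exists>E T. E \<in> sets borel \<and> E \<subseteq> cube k n \<and> ennreal ((1 / 2 ^ N) ^ CARD('d) * (2 powi k) ^ CARD('d)) \<le> emeasure lborel E \<and>
      T \<in> sets borel \<and> T \<subseteq> {3 / 4 * 2 powi k<..3 / 2 * 2 powi k} \<and>
      ennreal (1 / 4) \<le> (\<integral>\<^sup>+t\<in>T. ennreal (1 / t) \<partial>lborel) \<and> (\<forall>t\<in>T. \<forall>x\<in>E. whitney_coeff r \<beta> f k n \<le> ennreal C * W_fun r \<beta> f t x)"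
proof -
  let ?L = "2 powi k :: real" and ?k = "k - int N"
  have L: "0 < ?L" by simp
  have L': "2 powi ?k = ?L / 2 ^ N" by (simp add: power_int_diff)
  define I :: "((int ^ 'd) \<times> bool) set" where "I = {m. \<forall>i. m $ i \<in> {2 ^ N * n $ i..<2 ^ N * (n $ i + 1)}} \<times> UNIV"
  \<comment> \<open>If \<open>3/4 L < s \<le> L\<close>, then \<open>t / 2 < s \<le> t\<close> for
    all \<open>t\<close> in \<open>(L, 3/2 L]\<close>; if \<open>L/2 < s \<le> 3/4 L\<close>, the
    same holds for all \<open>t\<close> in \<open>(3/4 L, L]\<close>. These intervals of
    \<open>t\<close> are the sets \<open>T b\<close>.\<close>
  define J where "J b = (if b then {3 / 4 * ?L<..?L} else {?L / 2<..3 / 4 * ?L})" for b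
  define T where "T b = (if b then {?L<..3 / 2 * ?L} else {3 / 4 * ?L<..?L})" for b
  define P where "P p = J (snd p) \<times> cube ?k (fst p)" for p :: "(int ^ 'd) \<times> bool"
  have "card {m :: int ^ 'd. \<forall>i. m $ i \<in> {2 ^ N * n $ i..<2 ^ N * (n $ i + 1)}} = (2 ^ N) ^ CARD('d)"
  proof -
    have "card {2 ^ N * c..<2 ^ N * (c + 1)} = 2 ^ N" for c :: int
    proof -
      have "2 ^ N * (c + 1) - 2 ^ N * c = 2 ^ N" by (simp add: algebra_simps)
      then show ?thesis by (simp add: nat_power_eq)
    qed
    then show ?thesis by (simp only: card_vec_set prod_constant)
  qed
  then have card: "card I = 2 * (2 ^ N) ^ CARD('d)" by (simp add: I_def card_cartesian_product)
  then have "0 < card I" by simp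
  then have fin: "finite I" "I \<noteq> {}" by (auto simp: card_gt_0_iff)
  have coarse: "grid_index k y $ i = grid_index ?k y $ i div 2 ^ N" for y :: "real ^ 'd" and i
    using grid_index_coarser[of ?k k y i] by simp
  have div_iff: "a div 2 ^ N = b \<longleftrightarrow> a \<in> {2 ^ N * b..<2 ^ N * (b + 1)}" for a b :: int
  proof -
    have bounds: "0 \<le> a mod 2 ^ N" "a mod 2 ^ N < 2 ^ N" by simp_all
    have "a div 2 ^ N = b \<longleftrightarrow> 2 ^ N * b \<le> a \<and> a < 2 ^ N * b + 2 ^ N"
    proof
      assume "a div 2 ^ N = b"
      then have "a = 2 ^ N * b + a mod 2 ^ N" using mult_div_mod_eq[of "2 ^ N" a] by simp
      with bounds show "2 ^ N * b \<le> a \<and> a < 2 ^ N * b + 2 ^ N" by linarith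
    next
      assume "2 ^ N * b \<le> a \<and> a < 2 ^ N * b + 2 ^ N"
      then show "a div 2 ^ N = b" by (intro int_div_pos_eq[where r = "a - 2 ^ N * b"]) auto
    qed
    then show ?thesis by (simp add: distrib_left)
  qed
  have I_iff: "(m, b) \<in> I \<longleftrightarrow> (\<forall>i. m $ i div 2 ^ N = n $ i)" for m b
    unfolding I_def div_iff by simp
  have cover: "whitney_box (cube k n) \<subseteq> (\<Union>p\<in>I. P p)"
  proof
    fix z assume "z \<in> whitney_box (cube k n)"
    then obtain s y where z: "z = (s, y)" "?L / 2 < s" "s \<le> ?L" "y \<in> cube k n"
      by (auto simp: whitney_box_cube)
    have "(grid_index ?k y, 3 / 4 * ?L < s) \<in> I"
      unfolding I_iff coarse[symmetric] using z(4) by (simp add: cube_def)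
    moreover have "z \<in> P (grid_index ?k y, 3 / 4 * ?L < s)"
      using z by (auto simp: P_def J_def cube_def)
    ultimately show "z \<in> (\<Union>p\<in>I. P p)" by blast
  qed
  have "\<exists>p\<in>I. box_mean r ?L (whitney_box (cube k n)) h \<le> ennreal (root_const r (2 * (2 ^ N) ^ CARD('d))) * box_mean r ?L (P p) h"
  proof (rule box_mean_pigeonhole[OF r h fin _ _ _ cover])
    show "real (card I) \<le> 2 * (2 ^ N) ^ CARD('d)" by (simp add: card)
    show "whitney_box (cube k n) \<in> sets borel" by (rule sets_whitney_box)
    show "P p \<in> sets borel" for p by (auto simp: P_def J_def intro!: borel_Times)
  qed
  then obtain m b where mb: "(m, b) \<in> I"
    "box_mean r ?L (whitney_box (cube k n)) h \<le> ennreal (root_const r (2 * (2 ^ N) ^ CARD('d))) * box_mean r ?L (P (m, b)) h"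
    by auto
  have E_sub: "cube ?k m \<subseteq> cube k n"
  proof
    fix y assume "y \<in> cube ?k m"
    then show "y \<in> cube k n"
      using mb(1) unfolding I_iff cube_def mem_Collect_eq vec_eq_iff[of "grid_index k y"] coarse by simp
  qed
  have E_vol: "ennreal ((1 / 2 ^ N) ^ CARD('d) * ?L ^ CARD('d)) \<le> emeasure lborel (cube ?k m)"
    by (simp add: emeasure_cube L' power_mult_distrib[symmetric])
  have T_sub: "T b \<subseteq> {3 / 4 * ?L<..3 / 2 * ?L}" using L by (auto simp: T_def)
  have T_int: "ennreal (1 / 4) \<le> (\<integral>\<^sup>+t\<in>T b. ennreal (1 / t) \<partial>lborel)"
  proof (cases b)
    case True
    have "ennreal (1 / 4) \<le> ennreal ((3 / 2 * ?L - ?L) / (2 * ?L))"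
      using L by (intro ennreal_leI) (simp add: field_simps)
    also have "\<dots> \<le> (\<integral>\<^sup>+t\<in>{?L<..3 / 2 * ?L}. ennreal (1 / t) \<partial>lborel)"
      using L by (intro nn_integral_inverse_ge) auto
    finally show ?thesis using True by (simp add: T_def)
  next
    case False
    have "ennreal (1 / 4) \<le> ennreal ((?L - 3 / 4 * ?L) / ?L)"
      using L by (intro ennreal_leI) (simp add: field_simps)
    also have "\<dots> \<le> (\<integral>\<^sup>+t\<in>{3 / 4 * ?L<..?L}. ennreal (1 / t) \<partial>lborel)"
      using L by (intro nn_integral_inverse_ge) auto
    finally show ?thesis using False by (simp add: T_def)
  qed
  \<comment> \<open>\<open>4 d < 2^(4 d)\<close> even gives the bound \<open>1 / 2\<close> for
    \<open>2 d / 2^N\<close>.\<close>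
  have small: "2 * CARD('d) * 2 powi ?k \<le> 3 / 4 * ?L"
  proof -
    have "4 * real CARD('d) \<le> 2 ^ N"
      using of_nat_less_two_power[of N, where 'a = real] by (simp add: N)
    then have "2 * real CARD('d) / 2 ^ N \<le> 3 / 4" by (simp add: field_simps)
    then have "2 * real CARD('d) / 2 ^ N * ?L \<le> 3 / 4 * ?L" using L by (intro mult_right_mono) auto
    then show ?thesis by (simp add: L')
  qed
  have "whitney_coeff r \<beta> f k n \<le> ennreal C * W_fun r \<beta> f t x" if t: "t \<in> T b" and x: "x \<in> cube ?k m" for t x
  proof -
    have t0: "3 / 4 * ?L < t" "t \<le> 3 / 2 * ?L" using T_sub t by auto
    then have tpos: "0 < t" using L by linarith
    have P_sub: "P (m, b) \<subseteq> tent_region t x"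
    proof
      fix z assume "z \<in> P (m, b)"
      then obtain s y where z: "z = (s, y)" "s \<in> J b" "y \<in> cube ?k m" by (auto simp: P_def)
      have "dist x y < t" using cube_dist_less[OF x z(3)] small t0(1) by linarith
      moreover have "t / 2 < s \<and> s \<le> t"
        using z(2) t L by (auto simp: J_def T_def split: if_splits)
      ultimately show "z \<in> tent_region t x" by (simp add: tent_region_def z(1))
    qed
    let ?c = "root_const r (2 / unit_ball_vol CARD('d))"
    have cpos: "0 < ?c" by (intro root_const_pos) simp
    have Pm: "P (m, b) \<in> sets borel" by (auto simp: P_def J_def intro!: borel_Times)
    have "box_mean r ?L (P (m, b)) h \<le> box_mean r ?L (tent_region t x) h"
      by (rule box_mean_mono[OF r h Pm P_sub])
    also have "\<dots> \<le> ennreal (root_const r (4 ^ (CARD('d) + 1))) * box_mean r t (tent_region t x) h"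
      using t0 L by (intro box_mean_scale[OF r tpos L]) linarith
    also have "box_mean r t (tent_region t x) h = ennreal (1 / ?c) * W_fun r \<beta> f t x"
    proof -
      have "ennreal (1 / ?c) * ennreal ?c = 1" using cpos by (simp flip: ennreal_mult)
      then show ?thesis unfolding W_fun_eq_box_mean[OF r tpos f h ae] by (simp add: mult.assoc[symmetric])
    qed
    finally have 1: "box_mean r ?L (P (m, b)) h \<le> ennreal (root_const r (4 ^ (CARD('d) + 1))) * (ennreal (1 / ?c) * W_fun r \<beta> f t x)" .
    have "whitney_coeff r \<beta> f k n \<le> ennreal (2 powr \<bar>\<beta>\<bar> * root_const r (2 ^ (CARD('d) + 1))) * box_mean r ?L (whitney_box (cube k n)) h"
      by (rule whitney_coeff_box_mean(2)[OF r f h ae])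
    also note mb(2)
    also note 1
    finally have "whitney_coeff r \<beta> f k n \<le> ennreal (2 powr \<bar>\<beta>\<bar> * root_const r (2 ^ (CARD('d) + 1))) * (ennreal (root_const r (2 * (2 ^ N) ^ CARD('d))) *
       (ennreal (root_const r (4 ^ (CARD('d) + 1))) * (ennreal (1 / ?c) * W_fun r \<beta> f t x)))"
      by (simp add: mult_left_mono)
    also have "\<dots> = ennreal (2 powr \<bar>\<beta>\<bar> * root_const r (2 ^ (CARD('d) + 1)) * (root_const r (2 * (2 ^ N) ^ CARD('d)) * (root_const r (4 ^ (CARD('d) + 1)) * (1 / ?c)))) * W_fun r \<beta> f t x"
    proof -
      have "ennreal u * (ennreal v * (ennreal w * (ennreal e * Z))) = ennreal (u * (v * (w * e))) * Z"
        if "0 \<le> u" "0 \<le> v" "0 \<le> w" "0 \<le> e" for u v w e Z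
        using that by (simp add: ennreal_mult mult.assoc)
      then show ?thesis using cpos by (simp only: root_const_pos less_imp_le powr_ge_zero mult_nonneg_nonneg zero_le_divide_1_iff
          zero_less_power zero_less_numeral mult_pos_pos)
    qed
    also have "\<dots> \<le> ennreal C * W_fun r \<beta> f t x"
      by (intro mult_right_mono ennreal_leI C) simp
    finally show ?thesis .
  qed
  moreover have "T b \<in> sets borel" by (simp add: T_def)
  ultimately show ?thesis using E_sub E_vol T_sub T_int
    by (intro exI[of _ "cube ?k m"] exI[of _ "T b"]) (auto simp: sets_cube)
qed

text \<open>\<open>E\<close> and \<open>T\<close> are chosen cube by cube for the given
  \<open>f\<close>, but \<open>C\<close> and \<open>\<delta>\<close> depend only on
  \<open>d\<close>, \<open>r\<close> and \<open>\<beta>\<close>; this order of quantifiers yields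
  the uniform constant of the theorem.\<close>

lemma comparable_W_fun:
  assumes r: "0 < r"
  shows "\<exists>C>0. \<exists>\<delta>>0. \<forall>f \<in> borel_measurable (lebesgue_on ({0<..} \<times> UNIV)).
    comparable C \<delta> (whitney_coeff r \<beta> (f :: real \<times> (real ^ 'd) \<Rightarrow> complex)) (W_fun r \<beta> f)"
proof -
  define N where "N = 4 * CARD('d)"
  define C1 where "C1 = root_const r (2 / unit_ball_vol CARD('d)) * (root_const r (2 * 5 ^ CARD('d)) * (root_const r (4 ^ (CARD('d) + 1)) * 2 powr \<bar>\<beta>\<bar>))"
  define C2 where "C2 = 2 powr \<bar>\<beta>\<bar> * root_const r (2 ^ (CARD('d) + 1)) * (root_const r (2 * (2 ^ N) ^ CARD('d)) * (root_const r (4 ^ (CARD('d) + 1)) *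
      (1 / root_const r (2 / unit_ball_vol CARD('d)))))"
  define \<delta> :: real where "\<delta> = (1 / 2 ^ N) ^ CARD('d)"
  have "0 < C1" unfolding C1_def by (intro mult_pos_pos root_const_pos) auto
  moreover have "0 < \<delta>" by (simp add: \<delta>_def)
  moreover have "comparable (max C1 C2) \<delta> (whitney_coeff r \<beta> f) (W_fun r \<beta> f)"
    if f: "f \<in> borel_measurable (lebesgue_on ({0<..} \<times> UNIV))" for f :: "real \<times> (real ^ 'd) \<Rightarrow> complex"
  proof -
    obtain h where h: "h \<in> borel_measurable borel"
      and ae: "AE z in lborel. 0 < fst z \<longrightarrow> ennreal (fst z powr (- \<beta>) * norm (f z)) = h z"
      using borel_representative[OF f, of \<beta>] by blast
    have "(\<lambda>z. W_fun r \<beta> f (fst z) (snd z) * indicator {0<..} (fst z)) =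
      (\<lambda>z. ennreal (root_const r (2 / unit_ball_vol CARD('d))) * box_mean r (fst z) (tent_region (fst z) (snd z)) h * indicator {0<..} (fst z))"
      using W_fun_eq_box_mean[OF r _ f h ae] by (auto simp: fun_eq_iff indicator_def)
    moreover have "\<dots> \<in> borel_measurable (borel \<Otimes>\<^sub>M borel)"
      using measurable_box_mean_tent_region[OF h] by measurable
    moreover have "\<exists>l n. 2 powi l / 2 < t \<and> t \<le> 2 * 2 powi l \<and> x \<in> star l n \<and> W_fun r \<beta> f t x \<le> ennreal (max C1 C2) * whitney_coeff r \<beta> f l n"
      if "0 < t" for t x
      by (rule W_fun_le_whitney_coeff[OF r that f h ae]) (simp add: C1_def)
    moreover have "\<exists>E T. ample \<delta> E \<and> dominated (max C1 C2) (whitney_coeff r \<beta> f) (W_fun r \<beta> f) E T"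
    proof -
      let ?P = "\<lambda>k n E T. E \<in> sets borel \<and> E \<subseteq> cube k n \<and> ennreal (\<delta> * (2 powi k) ^ CARD('d)) \<le> emeasure lborel E \<and>
        T \<in> sets borel \<and> T \<subseteq> {3 / 4 * 2 powi k<..3 / 2 * 2 powi k} \<and>
        ennreal (1 / 4) \<le> (\<integral>\<^sup>+t\<in>T. ennreal (1 / t) \<partial>lborel) \<and> (\<forall>t\<in>T. \<forall>x\<in>E. whitney_coeff r \<beta> f k n \<le> ennreal (max C1 C2) * W_fun r \<beta> f t x)"
      have "\<exists>E T. ?P k n E T" for k n
        unfolding \<delta>_def by (rule whitney_coeff_le_W_fun[OF r f h ae N_def]) (simp add: C2_def)
      then have ex: "\<exists>X. ?P k n (fst X) (snd X)" for k n
        by (simp only: split_paired_Ex fst_conv snd_conv)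
      define X where "X k n = (SOME X. ?P k n (fst X) (snd X))" for k n
      have "?P k n (fst (X k n)) (snd (X k n))" for k n
        unfolding X_def by (rule someI_ex[OF ex])
      then show ?thesis unfolding ample_def dominated_def
        by (intro exI[of _ "\<lambda>k n. fst (X k n)"] exI[of _ "\<lambda>k n. snd (X k n)"] conjI allI) blast+
    qed
    ultimately show ?thesis unfolding comparable_def by simp
  qed
  ultimately show ?thesis
    by (intro exI[of _ "max C1 C2"] conjI exI[of _ \<delta>]) (auto simp: less_max_iff_disj)
qed

lemma tent_norm_eq_scale_tent_norm: "tent_norm p q r \<beta> f = scale_tent_norm p q (W_fun r \<beta> f)"
  unfolding tent_norm_def scale_tent_norm_def tent_fun_def ..

theorem proposition3p16:
  fixes p q r :: ennreal and \<beta> c :: real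
  assumes "0 < p" "0 < q" "0 < r" "0 < c" "c < 1"
  shows "\<exists>C>0. \<forall>f \<in> (tent_space p q r \<beta> :: (real \<times> (real ^ 'd) \<Rightarrow> complex) set).
           tent_norm p q r \<beta> f \<le> ennreal C * Lp_norm lebesgue p (m_fun q r \<beta> c f) \<and>
           Lp_norm lebesgue p (m_fun q r \<beta> c f) \<le> ennreal C * tent_norm p q r \<beta> f"
proof -
  obtain C \<delta> where C: "0 < C" "0 < \<delta>"
    "\<And>f :: real \<times> (real ^ 'd) \<Rightarrow> complex. f \<in> borel_measurable (lebesgue_on ({0<..} \<times> UNIV)) \<Longrightarrow>
      comparable C \<delta> (whitney_coeff r \<beta> f) (W_fun r \<beta> f)"
    using comparable_W_fun[OF assms(3), of \<beta>, where 'd = 'd] by blast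
  obtain K where K: "0 < K" "\<And>(a :: int \<Rightarrow> int ^ 'd \<Rightarrow> ennreal) W. comparable C \<delta> a W \<Longrightarrow>
      norms_equivalent K (scale_tent_norm p q W) (Lp_norm lebesgue p (median_fun q c a))"
    using scale_tent_norm_equiv[OF assms(1,2,4,5) C(1,2), where 'd = 'd] by blast
  show ?thesis
    using K(1) K(2)[OF C(3)] assms(2)
    by (intro exI[of _ K]) (auto simp: tent_space_def tent_norm_eq_scale_tent_norm m_fun_eq_median_fun norms_equivalent_def)
qed

end
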